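(* Let $v:\mathbb{R}\to\mathbb{R}$ be a smooth $1$-periodic function which is not constant. For $d>0$ and $p=(\gamma,\mu)\in\mathbb{R}^2$, let $\overline H_d(p)$ be the unique real number for which the ODE $$-\frac{d\,\gamma^2 w''}{\gamma^2+(\mu+w')^2}+\sqrt{\gamma^2+(\mu+w')^2}+\gamma v(y)=\overline H_d(p)\quad\text{in }\mathbb{R}$$ has a $C^2$ $1$-periodic solution $w$, and let $w$ (depending on $d$ and $p$) denote the unique such solution with $w(0)=0$. Then: (1) $\overline H_d(0,\pm\mu)=|\mu|$ for every $\mu\in\mathbb{R}$ and $d>0$. (2) If $\gamma\neq 0$, then $$\frac{\partial \overline H_d(p)}{\partial d}<0\quad\text{for all } d>0,$$ so $\overline H_d(p)$ is strictly decreasing with respect to $d$. (3) $\lim_{d\to 0^+}\overline H_d(p)=\overline H_0(p)$, where $\overline H_0(p)$ is the unique real number such that the equation $$\sqrt{\gamma^2+(\mu+w_0')^2}+\gamma v(y)=\overline H_0(p)\quad\text{in }\mathbb{R}$$ admits $1$-periodic viscosity solutions $w_0$. (4) $\lim_{d\to+\infty}\overline H_d(p)=|p|+\gamma\int_0^1 v(y)\,dy$ and $\lim_{d\to+\infty}w=0$ uniformly in $\mathbb{R}$.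
   Context: For each $d>0$ and $p=(\gamma,\mu)\in\mathbb{R}^2$ there exists a unique number $\overline H_d(p)$ for which the ODE in the claim has a $C^2$ $1$-periodic solution, and that solution is unique once normalized by $w(0)=0$. When $\gamma=0$ the second-order term is understood to be $0$, so the equation reads $|\mu+w'|=\overline H_d(p)$. Here $|p|=\sqrt{\gamma^2+\mu^2}$. Similarly, for each $p$ the number $\overline H_0(p)$ in (3) exists and is unique (the viscosity solution $w_0$ itself need not be unique). *)

theory Defs
  imports "HOL-Analysis.Analysis" "HOL-Library.Periodic_Fun"
begin

definition Ck_real :: "nat \<Rightarrow> (real \<Rightarrow> real) \<Rightarrow> bool" where
  "Ck_real k f \<longleftrightarrow>
     (\<forall>j<k. \<forall>x. (deriv ^^ j) f differentiable (at x)) \<and> continuous_on UNIV ((deriv ^^ k) f)"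

definition smooth_real :: "(real \<Rightarrow> real) \<Rightarrow> bool" where
  "smooth_real f \<longleftrightarrow> (\<forall>k. Ck_real k f)"

text \<open>
  The locale predicate \<^const>\<open>periodic_fun_simple'\<close> says that a function has period 1.
  For \<open>\<gamma> = 0\<close> the numerator of the second-order term is 0, so that term is 0 also where its
  denominator vanishes (as \<open>0 / 0 = 0\<close>), and the equation reads \<open>\<bar>\<mu> + w'\<bar> = H\<close> as intended.
\<close>
definition cell_solution ::
  "(real \<Rightarrow> real) \<Rightarrow> real \<Rightarrow> real \<times> real \<Rightarrow> real \<Rightarrow> (real \<Rightarrow> real) \<Rightarrow> bool" where
  "cell_solution v d p H w \<longleftrightarrow> (case p of (\<gamma>, \<mu>) \<Rightarrow>
     Ck_real 2 w \<and> periodic_fun_simple' w \<and>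
     (\<forall>y. - (d * \<gamma>\<^sup>2 * deriv (deriv w) y) / (\<gamma>\<^sup>2 + (\<mu> + deriv w y)\<^sup>2)
            + sqrt (\<gamma>\<^sup>2 + (\<mu> + deriv w y)\<^sup>2) + \<gamma> * v y = H))"

definition Hbar :: "(real \<Rightarrow> real) \<Rightarrow> real \<Rightarrow> real \<times> real \<Rightarrow> real" where
  "Hbar v d p = (THE H. \<exists>w. cell_solution v d p H w)"

definition corrector :: "(real \<Rightarrow> real) \<Rightarrow> real \<Rightarrow> real \<times> real \<Rightarrow> real \<Rightarrow> real" where
  "corrector v d p = (THE w. cell_solution v d p (Hbar v d p) w \<and> w 0 = 0)"

text \<open>
  Viscosity solutions in the sense of Crandall and Lions of the first-order equation
  \<open>F(y, u'(y)) = c\<close> on the real line, with \<open>C\<^sup>1\<close> test functions.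
\<close>
definition viscosity_subsolution ::
  "(real \<Rightarrow> real \<Rightarrow> real) \<Rightarrow> real \<Rightarrow> (real \<Rightarrow> real) \<Rightarrow> bool" where
  "viscosity_subsolution F c u \<longleftrightarrow> continuous_on UNIV u \<and>
     (\<forall>\<phi> y. Ck_real 1 \<phi> \<longrightarrow> (\<forall>\<^sub>F z in nhds y. u z - \<phi> z \<le> u y - \<phi> y) \<longrightarrow> F y (deriv \<phi> y) \<le> c)"

definition viscosity_supersolution ::
  "(real \<Rightarrow> real \<Rightarrow> real) \<Rightarrow> real \<Rightarrow> (real \<Rightarrow> real) \<Rightarrow> bool" where
  "viscosity_supersolution F c u \<longleftrightarrow> continuous_on UNIV u \<and>
     (\<forall>\<phi> y. Ck_real 1 \<phi> \<longrightarrow> (\<forall>\<^sub>F z in nhds y. u z - \<phi> z \<ge> u y - \<phi> y) \<longrightarrow> F y (deriv \<phi> y) \<ge> c)"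

definition viscosity_solution ::
  "(real \<Rightarrow> real \<Rightarrow> real) \<Rightarrow> real \<Rightarrow> (real \<Rightarrow> real) \<Rightarrow> bool" where
  "viscosity_solution F c u \<longleftrightarrow> viscosity_subsolution F c u \<and> viscosity_supersolution F c u"

definition Hbar0 :: "(real \<Rightarrow> real) \<Rightarrow> real \<times> real \<Rightarrow> real" where
  "Hbar0 v p = (case p of (\<gamma>, \<mu>) \<Rightarrow>
     THE H. \<exists>w. periodic_fun_simple' w \<and>
       viscosity_solution (\<lambda>y q. sqrt (\<gamma>\<^sup>2 + (\<mu> + q)\<^sup>2) + \<gamma> * v y) H w)"

end

theory Submission
  imports Defs
begin

text \<open>
  For \<open>\<gamma> = 0\<close> the equation forces \<open>\<mu> + w'\<close> to have constant modulus, hence to be constant, and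
  everything is explicit. Let \<open>\<gamma> \<noteq> 0\<close> and write \<open>u = \<mu> + w'\<close>, \<open>S(u) = sqrt (\<gamma>\<^sup>2 + u\<^sup>2)\<close>. The cell
  problem then is the first-order problem of finding a 1-periodic \<open>u\<close> of mean \<open>\<mu>\<close> with
  \<open>d \<gamma>\<^sup>2 u' = S(u)\<^sup>2 (S(u) + \<gamma> v - H)\<close>. At an extremum of \<open>w\<close> one has \<open>u = \<mu>\<close> and a sign for \<open>u'\<close>,
  and at an extremum of \<open>u\<close> one has \<open>u' = 0\<close>; this maximum principle bounds \<open>H\<close> and \<open>u\<close>
  independently of \<open>d\<close> and gives uniqueness and Lipschitz dependence of \<open>H\<close> on \<open>d\<close>. By Gronwall,
  \<open>u\<close> depends on \<open>d\<close> in a Lipschitz way too.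

  Existence is a double shooting argument (\<open>shooting\<close>): for a nonlinearity truncated outside
  the a priori bound, each initial value \<open>x\<close> admits exactly one \<open>H\<close> for which the solution
  closes up after one period, this \<open>H\<close> is continuous in \<open>x\<close>, and the mean of the
  resulting solution is a continuous surjective function of \<open>x\<close>.

  For the derivative in \<open>d\<close>, the equation linearised at \<open>u\<close> is tested with a positive periodic
  solution \<open>n\<close> of \<open>n' + B n = l\<close>, where \<open>B\<close> is the derivative of the right-hand side in \<open>u\<close> and
  \<open>l\<close> is a constant. Since a difference of slopes has mean zero, the linear part drops out and
  \<open>dH/dd = - \<gamma>\<^sup>2 (\<integral> n u') / (\<integral> n S(u)\<^sup>2)\<close> (\<open>Hbar_expansion\<close>). The sign of the numerator
  (\<open>weighted_slope_integral_pos\<close>) is the heart of the matter. Put \<open>M = n S(u)\<^sup>2\<close> and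
  \<open>\<zeta> = u / S(u)\<close>. Then \<open>M'\<close> is a positive multiple of \<open>x - \<zeta>\<close> with \<open>x = l d \<gamma>\<^sup>2 / M\<close>, while
  \<open>|\<gamma>| \<integral> n u' = - \<integral> M' arcsin \<zeta>\<close> after an integration by parts. As \<open>\<integral> M' \<Phi>(x) = 0\<close> for every
  continuous \<open>\<Phi>\<close>, because \<open>x\<close> is a function of \<open>M\<close>, one may subtract \<open>\<Phi>(x)\<close> for a
  nondecreasing \<open>\<Phi>\<close> that agrees with \<open>arcsin\<close> on the values of \<open>\<zeta>\<close>; the integrand becomes
  a positive multiple of \<open>(x - \<zeta>) (\<Phi>(x) - \<Phi>(\<zeta>)) \<ge> 0\<close>, and it vanishes identically only if \<open>u\<close>,
  and hence \<open>v\<close>, is constant.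

  For \<open>d \<rightarrow> 0\<close>, doubling variables between the classical \<open>w\<close> and any periodic viscosity solution
  \<open>w\<^sub>0\<close> of the limit equation bounds \<open>|Hbar v d p - H\<^sub>0|\<close> by a quantity that tends to \<open>0\<close> and depends on
  \<open>w\<^sub>0\<close> but not on \<open>w\<close> (\<open>vanishing_viscosity_estimate\<close>). So one viscosity solution is enough:
  uniqueness of \<open>H\<^sub>0\<close> follows from uniqueness of limits, and a solution is written
  down explicitly (\<open>viscosity_solution_exists\<close>). For \<open>d \<rightarrow> \<infinity>\<close>, the bound on \<open>u\<close> gives
  \<open>u' = O(1/d)\<close>, so \<open>u - \<mu>\<close> and \<open>w\<close> are \<open>O(1/d)\<close>, and integrating the equation over a period
  identifies the limit of \<open>H\<close>.
\<close>

section \<open>Periodic functions, antiderivatives and a Gronwall estimate\<close>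

lemma periodic_plus_1: "periodic_fun_simple' f \<Longrightarrow> f (x + 1) = f x"
  by (rule periodic_fun_simple'.plus_period)

lemma periodicI: "(\<And>x. f (x + 1) = f x) \<Longrightarrow> periodic_fun_simple' f"
  by (simp add: periodic_fun_simple'_def)

lemma periodic_frac:
  fixes f :: "real \<Rightarrow> 'a"
  assumes "periodic_fun_simple' f"
  shows "f (frac x) = f x"
proof -
  interpret periodic_fun_simple' f by fact
  show ?thesis using minus_of_int[of x "\<lfloor>x\<rfloor>"] by (simp add: frac_def)
qed

lemma periodic_attains_max:
  fixes f :: "real \<Rightarrow> real"
  assumes "periodic_fun_simple' f" "continuous_on UNIV f"
  obtains x where "\<And>y. f y \<le> f x"
proof -
  have "\<exists>x\<in>{0..1}. \<forall>y\<in>{0..1}. f y \<le> f x"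
    using assms(2) by (intro continuous_attains_sup) (auto intro: continuous_on_subset)
  then obtain x where x: "\<forall>y\<in>{0..1}. f y \<le> f x" by blast
  have "f y \<le> f x" for y
    using x periodic_frac[OF assms(1), of y]
    by (metis atLeastAtMost_iff frac_ge_0 frac_lt_1 less_imp_le)
  then show ?thesis by (rule that)
qed

lemma periodic_bounded:
  fixes f :: "real \<Rightarrow> real"
  assumes "periodic_fun_simple' f" "continuous_on UNIV f"
  obtains B where "B \<ge> 0" "\<And>y. \<bar>f y\<bar> \<le> B"
proof -
  have "periodic_fun_simple' (\<lambda>x. \<bar>f x\<bar>)"
    using assms(1) by (intro periodicI) (simp add: periodic_plus_1)
  moreover have "continuous_on UNIV (\<lambda>x. \<bar>f x\<bar>)"
    using assms(2) by (intro continuous_intros)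
  ultimately obtain x where "\<And>y. \<bar>f y\<bar> \<le> \<bar>f x\<bar>"
    using periodic_attains_max[of "\<lambda>x. \<bar>f x\<bar>"] by blast
  then show ?thesis using that[of "\<bar>f x\<bar>"] by simp
qed

lemma DERIV_imp_continuous_on:
  fixes f :: "real \<Rightarrow> real"
  assumes "\<And>x. (f has_real_derivative f' x) (at x)"
  shows "continuous_on A f"
  using assms by (meson DERIV_isCont continuous_at_imp_continuous_on)

lemma antiderivative_exists:
  fixes g :: "real \<Rightarrow> real"
  assumes "continuous_on UNIV g"
  obtains G where "\<And>x. (G has_real_derivative g x) (at x)"
proof -
  have "\<exists>F. \<forall>x. - \<infinity> < ereal x \<longrightarrow> ereal x < \<infinity> \<longrightarrow> (F has_vector_derivative g x) (at x)"
    by (rule einterval_antiderivative)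
       (use assms in \<open>auto simp: continuous_on_eq_continuous_at\<close>)
  then show ?thesis using that by (auto simp: has_real_derivative_iff_has_vector_derivative)
qed

lemma integral_DERIV:
  fixes g :: "real \<Rightarrow> real"
  assumes "\<And>x. (G has_real_derivative g x) (at x)" "a \<le> b"
  shows "(g has_integral (G b - G a)) {a..b}"
  using assms
  by (intro fundamental_theorem_of_calculus)
     (auto simp: has_real_derivative_iff_has_vector_derivative intro: has_vector_derivative_at_within)

lemma integral_DERIV_periodic:
  assumes "\<And>x. (G has_real_derivative g x) (at x)" "periodic_fun_simple' G"
  shows "(g has_integral 0) {0..1::real}"
  using integral_DERIV[OF assms(1), of 0 1] periodic_plus_1[OF assms(2), of 0] by simp

lemma DERIV_periodic_increment:
  fixes G g :: "real \<Rightarrow> real"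
  assumes "\<And>x. (G has_real_derivative g x) (at x)" "periodic_fun_simple' g"
  shows "G (x + 1) - G x = G 1 - G 0"
proof -
  have "\<forall>x. ((\<lambda>x. G (x + 1) - G x) has_real_derivative 0) (at x)"
    by (auto intro!: derivative_eq_intros DERIV_chain'[OF _ assms(1)] assms(1)
        simp: periodic_plus_1[OF assms(2)])
  then show ?thesis using DERIV_isconst_all[of "\<lambda>x. G (x + 1) - G x" x 0] by simp
qed

lemma periodic_antiderivative:
  fixes g :: "real \<Rightarrow> real"
  assumes "continuous_on UNIV g" "periodic_fun_simple' g" "integral {0..1} g = 0"
  obtains G where "\<And>x. (G has_real_derivative g x) (at x)" "periodic_fun_simple' G"
proof -
  obtain G where G: "\<And>x. (G has_real_derivative g x) (at x)"
    using antiderivative_exists[OF assms(1)] by blast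
  have "G 1 - G 0 = 0"
    using integral_unique[OF integral_DERIV[OF G, of 0 1]] assms(3) by simp
  then have "periodic_fun_simple' G"
    using DERIV_periodic_increment[OF G assms(2)] by (intro periodicI) (simp add: algebra_simps)
  with G show ?thesis by (rule that)
qed

lemma DERIV_at_global_max:
  fixes f f' :: "real \<Rightarrow> real"
  assumes "\<And>z. (f has_real_derivative f' z) (at z)" "(f' has_real_derivative D) (at x)"
    and max: "\<And>z. f z \<le> f x"
  shows "f' x = 0" "D \<le> 0"
proof -
  show 0: "f' x = 0"
    using DERIV_local_max[OF assms(1), of 1 x] max by auto
  show "D \<le> 0"
  proof (rule ccontr)
    assume "\<not> D \<le> 0"
    then obtain e where e: "e > 0" "\<And>h. h > 0 \<Longrightarrow> h < e \<Longrightarrow> f' x < f' (x + h)"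
      using DERIV_pos_inc_right[OF assms(2)] by auto
    obtain z where "z > x" "z < x + e/2" "f (x + e/2) - f x = e/2 * f' z"
      using MVT2[of x "x + e/2" f f'] assms(1) e(1) by auto
    moreover have "f' z > 0"
      using e(2)[of "z - x"] 0 calculation e(1) by auto
    ultimately have "f (x + e/2) - f x > 0" using mult_pos_pos[of "e/2" "f' z"] e(1) by linarith
    then show False using max[of "x + e/2"] by simp
  qed
qed

text \<open>The maximum principle in first-order form: take a maximum of the periodic antiderivative of
  \<open>z\<close>. It is used for \<open>z = u - \<mu>\<close>, and for differences of slopes belonging to different data.\<close>
lemma zero_mean_downcrossing:
  fixes z z' :: "real \<Rightarrow> real"
  assumes "\<And>y. (z has_real_derivative z' y) (at y)" "periodic_fun_simple' z" "integral {0..1} z = 0"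
  obtains y where "z y = 0" "z' y \<le> 0"
proof -
  obtain G where G: "\<And>x. (G has_real_derivative z x) (at x)" "periodic_fun_simple' G"
    using periodic_antiderivative[OF DERIV_imp_continuous_on[OF assms(1)] assms(2,3)] by blast
  obtain y where "\<And>x. G x \<le> G y"
    using periodic_attains_max[OF G(2) DERIV_imp_continuous_on[OF G(1)]] by blast
  then show ?thesis
    using DERIV_at_global_max[OF G(1) assms(1)] that by blast
qed

lemma zero_mean_upcrossing:
  fixes z z' :: "real \<Rightarrow> real"
  assumes "\<And>y. (z has_real_derivative z' y) (at y)" "periodic_fun_simple' z" "integral {0..1} z = 0"
  obtains y where "z y = 0" "z' y \<ge> 0"
proof (rule zero_mean_downcrossing[of "\<lambda>y. - z y" "\<lambda>y. - z' y"])
  show "periodic_fun_simple' (\<lambda>y. - z y)"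
    using assms(2) by (intro periodicI) (simp add: periodic_plus_1)
qed (use assms that in \<open>auto intro: DERIV_minus\<close>)

text \<open>The square of \<open>D\<close> is differentiable also at zeros of \<open>D\<close>, unlike \<open>|D|\<close>, and it satisfies
  \<open>(D\<^sup>2)' \<le> (2 L + 1) D\<^sup>2 + \<delta>\<^sup>2\<close>.\<close>
lemma gronwall_square:
  fixes D D' :: "real \<Rightarrow> real"
  assumes "a \<le> b" "\<And>y. (D has_real_derivative D' y) (at y)"
    and bound: "\<And>y. a \<le> y \<Longrightarrow> y \<le> b \<Longrightarrow> \<bar>D' y\<bar> \<le> L * \<bar>D y\<bar> + \<delta>" and "L \<ge> 0"
  shows "(D b)\<^sup>2 \<le> exp ((2*L + 1) * (b - a)) * ((D a)\<^sup>2 + \<delta>\<^sup>2 * (b - a))"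
proof -
  define M where "M = 2*L + 1"
  have M: "M > 0" using \<open>L \<ge> 0\<close> by (simp add: M_def)
  define g where "g y = (D y)\<^sup>2 * exp (- (M * (y - a))) - \<delta>\<^sup>2 * y" for y
  have "g b \<le> g a"
  proof (rule DERIV_nonpos_imp_nonincreasing[OF \<open>a \<le> b\<close>], intro exI conjI)
    fix y assume y: "a \<le> y" "y \<le> b"
    show "(g has_real_derivative
        (2 * D y * D' y - M * (D y)\<^sup>2) * exp (- (M * (y - a))) - \<delta>\<^sup>2) (at y)"
      unfolding g_def by (auto intro!: derivative_eq_intros assms(2) simp: algebra_simps power2_eq_square)
    have "2 * D y * D' y \<le> 2 * (\<bar>D y\<bar> * \<bar>D' y\<bar>)"
      by (metis abs_ge_self abs_mult mult.assoc mult_left_mono zero_le_numeral)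
    also have "\<dots> \<le> 2 * (\<bar>D y\<bar> * (L * \<bar>D y\<bar> + \<delta>))"
      using bound[OF y] by (intro mult_left_mono) auto
    also have "\<dots> \<le> M * (D y)\<^sup>2 + \<delta>\<^sup>2"
    proof -
      have "0 \<le> (\<bar>D y\<bar> - \<delta>)\<^sup>2" by simp
      then show ?thesis by (simp add: M_def power2_eq_square algebra_simps)
    qed
    finally have "2 * D y * D' y - M * (D y)\<^sup>2 \<le> \<delta>\<^sup>2" by simp
    then have "(2 * D y * D' y - M * (D y)\<^sup>2) * exp (- (M * (y - a))) \<le> \<delta>\<^sup>2 * exp (- (M * (y - a)))"
      by (intro mult_right_mono) auto
    also have "\<dots> \<le> \<delta>\<^sup>2 * 1"
      using M y by (intro mult_left_mono) auto
    finally show "(2 * D y * D' y - M * (D y)\<^sup>2) * exp (- (M * (y - a))) - \<delta>\<^sup>2 \<le> 0" by simp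
  qed
  then have "(D b)\<^sup>2 * exp (- (M * (b - a))) \<le> (D a)\<^sup>2 + \<delta>\<^sup>2 * (b - a)"
    by (simp add: g_def algebra_simps)
  then have "(D b)\<^sup>2 * exp (- (M * (b - a))) * exp (M * (b - a))
      \<le> ((D a)\<^sup>2 + \<delta>\<^sup>2 * (b - a)) * exp (M * (b - a))"
    by (intro mult_right_mono) auto
  moreover have "exp (- (M * (b - a))) * exp (M * (b - a)) = 1"
    by (simp flip: exp_add)
  ultimately show ?thesis by (simp add: M_def[symmetric] mult.assoc mult.commute[of "exp (M * (b - a))"])
qed

lemma gronwall_zero:
  fixes D D' :: "real \<Rightarrow> real"
  assumes "\<And>y. (D has_real_derivative D' y) (at y)" "\<And>y. \<bar>D' y\<bar> \<le> L * \<bar>D y\<bar>" "D a = 0" "L \<ge> 0"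
  shows "D y = 0"
proof (cases "a \<le> y")
  case True
  then show ?thesis using gronwall_square[of a y D D' L 0] assms by auto
next
  case False
  have "((\<lambda>y. D (- y)) has_real_derivative - D' (- y)) (at y)" for y
    using assms(1)[of "- y"] by (simp add: DERIV_mirror)
  then show ?thesis
    using gronwall_square[of "-a" "-y" "\<lambda>y. D (- y)" "\<lambda>y. - D' (- y)" L 0] assms False by auto
qed

text \<open>Between two upward crossings there would have to be a downward one: after a first zero \<open>a\<close> the
  function is positive, and at the next zero it would arrive from above.\<close>
lemma increasing_at_zeros_unique:
  fixes D D' :: "real \<Rightarrow> real"
  assumes "\<And>y. (D has_real_derivative D' y) (at y)" "\<And>y. D y = 0 \<Longrightarrow> D' y > 0"
    and "D a = 0" "D b = 0"
  shows "a = b"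
proof (rule ccontr)
  have aux: False if ab: "a < b" "D a = 0" "D b = 0" for a b
  proof -
    obtain e where e: "e > 0" "\<And>h. h > 0 \<Longrightarrow> h < e \<Longrightarrow> D a < D (a + h)"
      using DERIV_pos_inc_right[OF assms(1)[of a]] assms(2) ab by auto
    define c where "c = min (a + e/2) ((a + b)/2)"
    have c: "a < c" "c < b" "\<And>x. a < x \<Longrightarrow> x \<le> c \<Longrightarrow> D x > 0"
    proof -
      show "a < c" "c < b" using e(1) ab(1) by (auto simp: c_def min_def field_simps)
      show "D x > 0" if "a < x" "x \<le> c" for x
        using e(2)[of "x - a"] e(1) ab that by (simp add: c_def)
    qed
    define S where "S = {x\<in>{c..b}. D x = 0}"
    have cont: "continuous_on X D" for X
      using DERIV_imp_continuous_on[OF assms(1)] by blast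
    have "closed S" unfolding S_def
      using continuous_closed_preimage_constant[OF cont closed_real_atLeastAtMost] by simp
    moreover have "b \<in> S" using ab c by (simp add: S_def)
    moreover have bdd: "bdd_below S" by (auto simp: S_def intro!: bdd_belowI[of _ c])
    ultimately have s: "Inf S \<in> S" by (intro closed_contains_Inf) auto
    define s where "s = Inf S"
    have sS: "D s = 0" "c \<le> s" "s \<le> b" using s by (auto simp: s_def S_def)
    obtain e' where e': "e' > 0" "\<And>h. h > 0 \<Longrightarrow> h < e' \<Longrightarrow> D (s - h) < D s"
      using DERIV_pos_inc_left[OF assms(1)[of s]] assms(2) sS by auto
    have "c < s" using sS c(3)[of c] c(1) by (cases "c = s") auto
    define t where "t = max c (s - e'/2)"
    have t: "c \<le> t" "t < s" "D t < 0" 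
      using e'(2)[of "s - t"] e'(1) \<open>c < s\<close> sS(1) by (auto simp: t_def)
    obtain x where x: "c \<le> x" "x \<le> t" "D x = 0"
      using IVT2'[of D t 0 c] t c cont by (metis less_imp_le order_refl)
    then have "x \<in> S" using t sS by (simp add: S_def)
    then have "s \<le> x" unfolding s_def using bdd by (rule cInf_lower)
    then show False using x t by simp
  qed
  assume "a \<noteq> b"
  then show False using aux[of a b] aux[of b a] assms(3,4) by linarith
qed

text \<open>This is the weight with which the linearised equation \<open>z' = B z + f\<close> is tested. With
  \<open>Q = exp (\<integral> B)\<close> a solution is \<open>n(y) = (\<integral>\<^bsub>y\<^esub>\<^bsup>y+1\<^esup> Q) / Q(y)\<close>; it is positive by inspection, and
  \<open>l = Q(1) / Q(0) - 1\<close>. Allowing a constant \<open>l\<close> is what makes a periodic positive solution exist for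
  every \<open>B\<close>; it is harmless because \<open>z\<close> has mean zero.\<close>
lemma adjoint_exists:
  fixes B :: "real \<Rightarrow> real"
  assumes "continuous_on UNIV B" "periodic_fun_simple' B"
  obtains n l where "\<And>y. (n has_real_derivative l - B y * n y) (at y)"
    "periodic_fun_simple' n" "\<And>y. n y > 0"
proof -
  obtain E where E: "\<And>x. (E has_real_derivative B x) (at x)"
    using antiderivative_exists[OF assms(1)] by blast
  define Q where "Q y = exp (E y)" for y
  have "continuous_on UNIV Q" unfolding Q_def
    using DERIV_imp_continuous_on[OF E] by (intro continuous_intros)
  then obtain K where K: "\<And>x. (K has_real_derivative Q x) (at x)"
    using antiderivative_exists by blast
  define q where "q = exp (E 1 - E 0)"
  have Q1: "Q (y + 1) = q * Q y" for y
    using DERIV_periodic_increment[OF E assms(2), of y]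
    by (simp add: Q_def q_def flip: exp_add)
  have "((\<lambda>y. K (y + 1) - q * K y) has_real_derivative 0) (at y)" for y
    by (auto intro!: derivative_eq_intros DERIV_chain'[OF _ K] K simp: Q1)
  then have K1: "K (y + 2) - q * K (y + 1) = K (y + 1) - q * K y" for y
    using DERIV_isconst_all[of "\<lambda>y. K (y + 1) - q * K y" "y + 1" y] by (simp add: add.assoc)
  define n where "n y = (K (y + 1) - K y) / Q y" for y
  have Qpos: "Q y > 0" for y by (simp add: Q_def)
  show ?thesis
  proof (rule that[of n "q - 1"])
    show "(n has_real_derivative (q - 1) - B y * n y) (at y)" for y
    proof -
      have "(Q has_real_derivative Q y * B y) (at y)"
        unfolding Q_def by (auto intro!: derivative_eq_intros E)
      moreover have "((\<lambda>y. K (y + 1)) has_real_derivative Q (y + 1)) (at y)"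
        using K[of "y + 1"] by (simp add: DERIV_shift)
      ultimately have "(n has_real_derivative
          ((Q (y + 1) - Q y) * Q y - (K (y + 1) - K y) * (Q y * B y)) / (Q y * Q y)) (at y)"
        unfolding n_def using Qpos[of y] by (auto intro!: DERIV_divide DERIV_diff K)
      moreover have "((Q (y + 1) - Q y) * Q y - (K (y + 1) - K y) * (Q y * B y)) / (Q y * Q y)
          = (q - 1) - B y * n y"
        using Qpos[of y] unfolding n_def Q1 by (simp add: field_simps)
      ultimately show ?thesis by simp
    qed
    show "periodic_fun_simple' n"
    proof (rule periodicI)
      fix y
      have "K (y + 2) - K (y + 1) = q * (K (y + 1) - K y)"
        using K1[of y] by (simp add: algebra_simps)
      then show "n (y + 1) = n y" by (simp add: n_def Q1 add.assoc q_def)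
    qed
    have "K y < K (y + 1)" for y
      by (rule DERIV_pos_imp_increasing) (use K Qpos in auto)
    then show "n y > 0" for y using Qpos[of y] by (simp add: n_def)
  qed
qed

section \<open>Periodic solutions of scalar equations by shooting\<close>

text \<open>Dividing by the weight \<open>exp (2 L |y|)\<close> turns the Picard operator into a contraction with factor
  \<open>1/2\<close> on bounded continuous functions on the whole line, so that no continuation of local
  solutions is needed. The integral from \<open>0\<close> to \<open>y\<close>, for either sign of \<open>y\<close>, is taken as an
  antiderivative \<open>G z\<close>.\<close>
lemma picard_lindeloef_global:
  fixes f :: "real \<Rightarrow> real \<Rightarrow> real"
  assumes cont: "\<And>z. continuous_on UNIV z \<Longrightarrow> continuous_on UNIV (\<lambda>y. f y (z y))"
    and lip: "\<And>y u v. \<bar>f y u - f y v\<bar> \<le> L * \<bar>u - v\<bar>" and "L > 0"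
    and bdd: "\<And>y u. \<bar>f y u\<bar> \<le> C"
  obtains u where "u 0 = a" "\<And>y. (u has_real_derivative f y (u y)) (at y)"
proof -
  define wt where "wt y = exp (2 * L * \<bar>y\<bar>)" for y
  have wt: "wt y > 0" "wt 0 = 1" for y by (simp_all add: wt_def)
  have wt_cont: "continuous_on UNIV wt" unfolding wt_def by (intro continuous_intros)
  have ex: "\<exists>G. G 0 = a \<and> (\<forall>y. (G has_real_derivative f y (wt y * z y)) (at y))"
    if "continuous_on UNIV z" for z
  proof -
    have "continuous_on UNIV (\<lambda>y. f y (wt y * z y))"
      using that wt_cont by (intro cont continuous_intros)
    then obtain G where "\<And>y. (G has_real_derivative f y (wt y * z y)) (at y)"
      using antiderivative_exists by blast
    then show ?thesis
      by (intro exI[of _ "\<lambda>y. a + (G y - G 0)"]) (auto intro!: derivative_eq_intros)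
  qed
  define G where "G z = (SOME G. G 0 = a \<and> (\<forall>y. (G has_real_derivative f y (wt y * z y)) (at y)))" for z
  have G: "G z 0 = a" "(G z has_real_derivative f y (wt y * z y)) (at y)"
    if "continuous_on UNIV z" for z y
    using someI_ex[OF ex[OF that]] unfolding G_def by auto
  have G_bcont: "(\<lambda>y. G z y / wt y) \<in> bcontfun" if z: "continuous_on UNIV z" for z
    unfolding bcontfun_def
  proof (intro CollectI conjI)
    have "continuous_on UNIV (G z)" using G(2)[OF z] by (rule DERIV_imp_continuous_on)
    then show "continuous_on UNIV (\<lambda>y. G z y / wt y)"
      using wt_cont wt(1) by (intro continuous_intros) (auto simp: less_imp_neq[symmetric])
    have C: "C \<ge> 0" using bdd[of 0 0] by simp
    have "\<bar>G z y / wt y\<bar> \<le> \<bar>a\<bar> + C / L" for y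
    proof -
      have "\<bar>G z y - G z 0\<bar> \<le> C * \<bar>y - 0\<bar>"
        using field_differentiable_bound[of UNIV "G z" "\<lambda>y. f y (wt y * z y)" C 0 y] G(2)[OF z] bdd
        by (auto simp: abs_minus_commute)
      then have "\<bar>G z y\<bar> \<le> \<bar>a\<bar> + C * \<bar>y\<bar>" using G(1)[OF z] by simp
      also have "\<dots> \<le> \<bar>a\<bar> * wt y + C * (wt y / L)"
      proof (intro add_mono mult_left_mono C)
        have "wt y \<ge> 1 + 2 * L * \<bar>y\<bar>" unfolding wt_def by (rule exp_ge_add_one_self)
        moreover have "L * \<bar>y\<bar> \<ge> 0" using \<open>L > 0\<close> by simp
        ultimately have "L * \<bar>y\<bar> \<le> wt y" by linarith
        then show "\<bar>y\<bar> \<le> wt y / L" using \<open>L > 0\<close> by (simp add: field_simps)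
        have "wt y \<ge> 1" using \<open>L > 0\<close> by (simp add: wt_def)
        then show "\<bar>a\<bar> \<le> \<bar>a\<bar> * wt y" using mult_left_mono[of 1 "wt y" "\<bar>a\<bar>"] by simp
      qed
      finally show ?thesis using wt(1)[of y] \<open>L > 0\<close> by (simp add: field_simps)
    qed
    then show "bounded (range (\<lambda>y. G z y / wt y))" by (auto simp: bounded_iff)
  qed
  define T :: "(real \<Rightarrow>\<^sub>C real) \<Rightarrow> (real \<Rightarrow>\<^sub>C real)"
    where "T z = Bcontfun (\<lambda>y. G (apply_bcontfun z) y / wt y)" for z
  have T: "apply_bcontfun (T z) y = G (apply_bcontfun z) y / wt y" for z y
    unfolding T_def by (subst Bcontfun_inverse[OF G_bcont]) auto
  have "dist (T x) (T y) \<le> 1/2 * dist x y" for x y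
  proof (rule dist_bound)
    fix s
    define \<delta> where "\<delta> = dist x y"
    have \<delta>: "\<bar>apply_bcontfun x t - apply_bcontfun y t\<bar> \<le> \<delta>" for t
      using dist_bounded[of x t y] by (simp add: \<delta>_def dist_real_def)
    define D where "D t = G (apply_bcontfun x) t - G (apply_bcontfun y) t" for t
    define D' where "D' t = f t (wt t * apply_bcontfun x t) - f t (wt t * apply_bcontfun y t)" for t
    have D: "(D has_real_derivative D' t) (at t)" "D 0 = 0" for t
      unfolding D_def D'_def by (auto intro!: DERIV_diff G simp: G)
    have D': "\<bar>D' t\<bar> \<le> L * wt t * \<delta>" for t
    proof -
      have "\<bar>D' t\<bar> \<le> L * \<bar>wt t * apply_bcontfun x t - wt t * apply_bcontfun y t\<bar>"
        unfolding D'_def by (rule lip)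
      also have "\<dots> = L * wt t * \<bar>apply_bcontfun x t - apply_bcontfun y t\<bar>"
        using wt(1)[of t] by (simp add: abs_mult flip: right_diff_distrib)
      also have "\<dots> \<le> L * wt t * \<delta>"
        using wt(1)[of t] \<open>L > 0\<close> by (intro mult_left_mono \<delta>) auto
      finally show ?thesis .
    qed
    \<comment> \<open>comparison with the antiderivative of the weight; \<open>c\<close> is the sign of the error, \<open>e\<close> that of the time\<close>
    have main: "c * D (e * t) \<le> \<delta> / 2 * exp (2 * L * t)"
      if "t \<ge> 0" "\<bar>c\<bar> = 1" "\<bar>e\<bar> = 1" for t c e
    proof -
      define g where "g t = c * D (e * t) - \<delta> / 2 * exp (2 * L * t)" for t
      have "g t \<le> g 0"
      proof (rule DERIV_nonpos_imp_nonincreasing[OF that(1)], intro exI conjI)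
        fix r assume r: "0 \<le> r" "r \<le> t"
        have "((\<lambda>r. D (e * r)) has_real_derivative D' (e * r) * e) (at r)"
          using DERIV_chain2[of D "D' (e * r)" "\<lambda>r. e * r" r e UNIV] D(1)
          by (auto intro!: derivative_eq_intros)
        then show "(g has_real_derivative c * (D' (e * r) * e) - \<delta> * L * exp (2 * L * r)) (at r)"
          unfolding g_def by (auto intro!: derivative_eq_intros)
        have "c * (D' (e * r) * e) \<le> \<bar>c * (D' (e * r) * e)\<bar>" by (rule abs_ge_self)
        also have "\<dots> = \<bar>D' (e * r)\<bar>" using that by (simp add: abs_mult)
        also have "\<dots> \<le> L * wt (e * r) * \<delta>" by (rule D')
        also have "wt (e * r) = exp (2 * L * r)" using that r by (simp add: wt_def abs_mult)
        finally show "c * (D' (e * r) * e) - \<delta> * L * exp (2 * L * r) \<le> 0" by (simp add: mult_ac)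
      qed
      moreover have "\<delta> \<ge> 0" by (simp add: \<delta>_def)
      ultimately show ?thesis using D(2) by (simp add: g_def)
    qed
    have "c * D s \<le> \<delta> / 2 * wt s" if "\<bar>c\<bar> = 1" for c
      using main[of "\<bar>s\<bar>" c 1] main[of "\<bar>s\<bar>" c "-1"] that by (cases "s \<ge> 0") (simp_all add: wt_def)
    from this[of 1] this[of "-1"] have "\<bar>D s\<bar> \<le> \<delta> / 2 * wt s" by auto
    then have "\<bar>D s\<bar> / wt s \<le> 1/2 * \<delta>" using wt(1)[of s] by (simp add: field_simps)
    then show "dist (apply_bcontfun (T x) s) (apply_bcontfun (T y) s) \<le> 1/2 * dist x y"
      using wt(1)[of s] by (simp add: T dist_real_def D_def \<delta>_def abs_divide flip: diff_divide_distrib)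
  qed
  then have "\<exists>!z. T z = z" by (intro banach_fix_type[of "1/2"]) auto
  then obtain z where z: "T z = z" by auto
  have "apply_bcontfun z y * wt y = G (apply_bcontfun z) y" for y
    using T[of z y] wt(1)[of y] by (simp add: z)
  then have eq: "wt y * apply_bcontfun z y = G (apply_bcontfun z) y" for y
    by (simp add: mult.commute)
  show ?thesis
    using that[of "G (apply_bcontfun z)"] G[of "apply_bcontfun z"] by (auto simp: eq)
qed


lemma integral_dist_le:
  fixes f g :: "real \<Rightarrow> real"
  assumes "continuous_on {0..1} f" "continuous_on {0..1} g" "\<And>y. 0 \<le> y \<Longrightarrow> y \<le> 1 \<Longrightarrow> \<bar>f y - g y\<bar> \<le> B"
  shows "\<bar>integral {0..1} f - integral {0..1} g\<bar> \<le> B"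
proof -
  have "integral {0..1} f - integral {0..1} g = integral {0..1} (\<lambda>y. f y - g y)"
    using assms(1,2) by (simp add: integral_diff integrable_continuous_real)
  also have "\<bar>\<dots>\<bar> \<le> B * (1 - 0)"
    using integral_bound[of 0 1 "\<lambda>y. f y - g y" B] assms
    by (auto intro!: continuous_intros)
  finally show ?thesis by simp
qed

text \<open>For an initial value \<open>x\<close> let \<open>P x H\<close> be the gap between the solution with parameter \<open>H\<close> at times
  \<open>1\<close> and \<open>0\<close>. It changes sign between \<open>H = a\<close> and \<open>H = b\<close>, and its zero is unique: two solutions with the same
  initial value and different parameters always cross in the same direction. So the closing
  parameter \<open>Hs x\<close> is a continuous function of \<open>x\<close>. A closed solution stays within \<open>C\<close> of its
  initial value, hence so does its mean, which therefore takes every value \<open>\<mu>\<close>.\<close>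
lemma shooting:
  fixes f :: "real \<Rightarrow> real \<Rightarrow> real \<Rightarrow> real"
  assumes cont: "\<And>z H. continuous_on UNIV z \<Longrightarrow> continuous_on UNIV (\<lambda>y. f y (z y) H)"
    and per: "\<And>y u H. f (y + 1) u H = f y u H"
    and lip: "\<And>y u v H. H \<in> {a..b} \<Longrightarrow> \<bar>f y u H - f y v H\<bar> \<le> L * \<bar>u - v\<bar>" and "L > 0"
    and lipH: "\<And>y u H H'. \<bar>f y u H - f y u H'\<bar> \<le> K * \<bar>H - H'\<bar>" and "K \<ge> 0"
    and bdd: "\<And>y u H. H \<in> {a..b} \<Longrightarrow> \<bar>f y u H\<bar> \<le> C"
    and dec: "\<And>y u H H'. H < H' \<Longrightarrow> f y u H' < f y u H"
    and pos: "\<And>y u. f y u a > 0" and neg: "\<And>y u. f y u b < 0" and "a \<le> b"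
  obtains H u where "\<And>y. (u has_real_derivative f y (u y) H) (at y)"
    "periodic_fun_simple' u" "integral {0..1} u = \<mu>"
proof -
  have ex: "\<exists>u. u 0 = x \<and> (\<forall>y. (u has_real_derivative f y (u y) H) (at y))" if H: "H \<in> {a..b}" for x H
  proof (rule picard_lindeloef_global[of "\<lambda>y u. f y u H" L C x])
  qed (use cont lip[OF H] bdd[OF H] \<open>L > 0\<close> in blast)+
  define sol where "sol x H = (SOME u. u 0 = x \<and> (\<forall>y. (u has_real_derivative f y (u y) H) (at y)))"
    for x H
  have sol0: "sol x H 0 = x" and sol: "(sol x H has_real_derivative f y (sol x H y) H) (at y)"
    if "H \<in> {a..b}" for x H y
    using someI_ex[OF ex[OF that]] unfolding sol_def by auto
  define E where "E = sqrt (exp (2 * L + 1))"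
  have E: "E > 0" by (simp add: E_def)
  have dep: "\<bar>sol x H y - sol x' H' y\<bar> \<le> E * (\<bar>x - x'\<bar> + K * \<bar>H - H'\<bar>)"
    if H: "H \<in> {a..b}" "H' \<in> {a..b}" and y: "0 \<le> y" "y \<le> 1" for x x' H H' y
  proof -
    define D where "D y = sol x H y - sol x' H' y" for y
    have "(D y)\<^sup>2 \<le> exp ((2*L + 1) * (y - 0)) * ((D 0)\<^sup>2 + (K * \<bar>H - H'\<bar>)\<^sup>2 * (y - 0))"
    proof (rule gronwall_square[OF y(1)])
      show "(D has_real_derivative f y (sol x H y) H - f y (sol x' H' y) H') (at y)" for y
        unfolding D_def by (intro DERIV_diff sol H)
      show "\<bar>f y (sol x H y) H - f y (sol x' H' y) H'\<bar> \<le> L * \<bar>D y\<bar> + K * \<bar>H - H'\<bar>" for y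
        using lip[OF H(1), of y "sol x H y" "sol x' H' y"] lipH[of y "sol x' H' y" H H']
        unfolding D_def by linarith
    qed (use \<open>L > 0\<close> in auto)
    also have "\<dots> \<le> exp ((2*L + 1) * 1) * ((D 0)\<^sup>2 + (K * \<bar>H - H'\<bar>)\<^sup>2 * 1)"
      using y \<open>L > 0\<close> by (intro mult_mono add_mono mult_left_mono) auto
    also have "D 0 = x - x'" using H by (simp add: D_def sol0)
    also have "exp ((2*L + 1) * 1) * ((x - x')\<^sup>2 + (K * \<bar>H - H'\<bar>)\<^sup>2 * 1)
        \<le> (E * (\<bar>x - x'\<bar> + K * \<bar>H - H'\<bar>))\<^sup>2"
      using \<open>K \<ge> 0\<close> by (simp add: E_def power_mult_distrib power2_sum)
    finally have "\<bar>D y\<bar> \<le> \<bar>E * (\<bar>x - x'\<bar> + K * \<bar>H - H'\<bar>)\<bar>"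
      by (simp only: abs_le_square_iff)
    also have "\<dots> = E * (\<bar>x - x'\<bar> + K * \<bar>H - H'\<bar>)"
      using E \<open>K \<ge> 0\<close> by (intro abs_of_nonneg mult_nonneg_nonneg add_nonneg_nonneg) auto
    finally show ?thesis by (simp add: D_def)
  qed
  define P where "P x H = sol x H 1 - x" for x H
  have P_H: "continuous_on {a..b} (P x)" for x
  proof (rule lipschitz_on_continuous_on[OF lipschitz_onI])
    show "dist (P x H) (P x H') \<le> E * K * dist H H'" if "H \<in> {a..b}" "H' \<in> {a..b}" for H H'
      using dep[OF that, of 1 x x] by (simp add: P_def dist_real_def)
  qed (use E \<open>K \<ge> 0\<close> in auto)
  have P_x: "continuous_on UNIV (\<lambda>x. P x H)" if "H \<in> {a..b}" for H
  proof (rule lipschitz_on_continuous_on[OF lipschitz_onI])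
    show "dist (P x H) (P x' H) \<le> (E + 1) * dist x x'" for x x'
      using dep[OF that that, of 1 x x'] by (simp add: P_def dist_real_def algebra_simps)
  qed (use E in auto)
  have P_a: "P x a > 0" for x
  proof -
    have "sol x a 0 < sol x a 1"
      by (rule DERIV_pos_imp_increasing) (use sol pos \<open>a \<le> b\<close> in force)+
    then show ?thesis using \<open>a \<le> b\<close> by (simp add: P_def sol0)
  qed
  have P_b: "P x b < 0" for x
  proof -
    have "sol x b 0 > sol x b 1"
      by (rule DERIV_neg_imp_decreasing) (use sol neg \<open>a \<le> b\<close> in force)+
    then show ?thesis using \<open>a \<le> b\<close> by (simp add: P_def sol0)
  qed
  have uniq: "H = H'" if "H \<in> {a..b}" "H' \<in> {a..b}" "P x H = 0" "P x H' = 0" for x H H'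
  proof -
    have False if *: "H \<in> {a..b}" "H' \<in> {a..b}" "P x H = 0" "P x H' = 0" "H < H'" for H H'
    proof -
      define D where "D y = sol x H y - sol x H' y" for y
      have "(0::real) = 1"
      proof (rule increasing_at_zeros_unique[of D])
        show "(D has_real_derivative f y (sol x H y) H - f y (sol x H' y) H') (at y)" for y
          unfolding D_def by (intro DERIV_diff sol *)
        show "D y = 0 \<Longrightarrow> f y (sol x H y) H - f y (sol x H' y) H' > 0" for y
          using dec[OF *(5)] by (simp add: D_def)
      qed (use * in \<open>auto simp: D_def P_def sol0\<close>)
      then show False by simp
    qed
    then show ?thesis using that by (meson linorder_neqE_linordered_idom)
  qed
  have root: "\<exists>H\<in>{h..k}. P x H = 0" if "a \<le> h" "k \<le> b" "h \<le> k" "P x h \<ge> 0" "P x k \<le> 0" for x h k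
  proof -
    have "continuous_on {h..k} (P x)" using that by (intro continuous_on_subset[OF P_H]) auto
    then show ?thesis using IVT2'[of "P x" k 0 h] that by auto
  qed
  have "\<exists>H. H \<in> {a..b} \<and> P x H = 0" for x
    using root[of a b x] P_a[of x] P_b[of x] \<open>a \<le> b\<close> by auto
  then obtain Hs where Hs: "\<And>x. Hs x \<in> {a..b}" "\<And>x. P x (Hs x) = 0" by metis
  have Hs_int: "a < Hs x" "Hs x < b" for x
    using Hs[of x] P_a[of x] P_b[of x] by (auto simp: less_le)
  have P_pos: "P x H > 0" if "H \<in> {a..<Hs x}" for x H
  proof (rule ccontr)
    assume "\<not> P x H > 0"
    then have "\<exists>H'\<in>{a..H}. P x H' = 0"
      using that P_a[of x] Hs_int[of x] by (intro root) auto
    then obtain H' where "H' \<in> {a..H}" "P x H' = 0" by blast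
    then show False using uniq[of H' "Hs x" x] Hs[of x] that by auto
  qed
  have P_neg: "P x H < 0" if "H \<in> {Hs x<..b}" for x H
  proof (rule ccontr)
    assume "\<not> P x H < 0"
    then have "\<exists>H'\<in>{H..b}. P x H' = 0"
      using that P_b[of x] Hs_int[of x] by (intro root) auto
    then obtain H' where "H' \<in> {H..b}" "P x H' = 0" by blast
    then show False using uniq[of H' "Hs x" x] Hs[of x] that by auto
  qed
  have Hs_cont: "(Hs \<longlongrightarrow> Hs x) (at x)" for x
  proof (rule order_tendstoI)
    fix c assume c: "c < Hs x"
    define h where "h = max a c"
    have h: "h \<in> {a..<Hs x}" "c \<le> h" using c Hs_int[of x] by (auto simp: h_def)
    have "h \<in> {a..b}" using h Hs_int[of x] by auto
    then have "((\<lambda>z. P z h) \<longlongrightarrow> P x h) (at x)"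
      using P_x by (simp add: continuous_on_def)
    then have "\<forall>\<^sub>F z in at x. P z h > 0" using P_pos[OF h(1)] by (rule order_tendstoD)
    then show "\<forall>\<^sub>F z in at x. c < Hs z"
    proof eventually_elim
      case (elim z)
      then show ?case
        using P_neg[of h z] Hs(2)[of z] h \<open>h \<in> {a..b}\<close> by (cases "Hs z < h"; cases "Hs z = h") auto
    qed
  next
    fix c assume c: "c > Hs x"
    define h where "h = min b c"
    have h: "h \<in> {Hs x<..b}" "c \<ge> h" using c Hs_int[of x] by (auto simp: h_def)
    have "h \<in> {a..b}" using h Hs_int[of x] by auto
    then have "((\<lambda>z. P z h) \<longlongrightarrow> P x h) (at x)"
      using P_x by (simp add: continuous_on_def)
    then have "\<forall>\<^sub>F z in at x. P z h < 0" using P_neg[OF h(1)] by (rule order_tendstoD)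
    then show "\<forall>\<^sub>F z in at x. Hs z < c"
    proof eventually_elim
      case (elim z)
      then show ?case
        using P_pos[of h z] Hs(2)[of z] h \<open>h \<in> {a..b}\<close> by (cases "Hs z > h"; cases "Hs z = h") auto
    qed
  qed
  define U where "U x = sol x (Hs x)" for x
  have U: "(U x has_real_derivative f y (U x y) (Hs x)) (at y)" for x y
    unfolding U_def using sol Hs by blast
  have U_cont: "continuous_on A (U x)" for A x using U by (rule DERIV_imp_continuous_on)
  define I where "I x = integral {0..1} (U x)" for x
  have I_cont: "(I \<longlongrightarrow> I x) (at x)" for x
  proof (rule Lim_null[THEN iffD2], rule Lim_null_comparison)
    show "\<forall>\<^sub>F z in at x. norm (I z - I x) \<le> E * (\<bar>z - x\<bar> + K * \<bar>Hs z - Hs x\<bar>)"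
      unfolding I_def real_norm_def
      by (intro always_eventually allI integral_dist_le U_cont) (auto simp: U_def intro!: dep Hs)
    have "((\<lambda>z. E * (\<bar>z - x\<bar> + K * \<bar>Hs z - Hs x\<bar>)) \<longlongrightarrow> E * (\<bar>x - x\<bar> + K * \<bar>Hs x - Hs x\<bar>)) (at x)"
      by (intro tendsto_intros Hs_cont)
    then show "((\<lambda>z. E * (\<bar>z - x\<bar> + K * \<bar>Hs z - Hs x\<bar>)) \<longlongrightarrow> 0) (at x)" by simp
  qed
  have "C \<ge> 0" using bdd[of a 0 0] \<open>a \<le> b\<close> by auto
  have I_near: "\<bar>I x - x\<bar> \<le> C" for x
  proof -
    have "\<bar>U x y - x\<bar> \<le> C" if "0 \<le> y" "y \<le> 1" for y
    proof -
      have "\<bar>U x y - U x 0\<bar> \<le> C * \<bar>y - 0\<bar>"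
        using field_differentiable_bound[of UNIV "U x" "\<lambda>y. f y (U x y) (Hs x)" C 0 y] U bdd Hs
        by (auto simp: abs_minus_commute)
      also have "\<dots> \<le> C" using that \<open>C \<ge> 0\<close> mult_left_mono[of y 1 C] by simp
      finally show ?thesis using Hs sol0 by (simp add: U_def)
    qed
    then have "\<bar>integral {0..1} (U x) - integral {0..1} (\<lambda>y::real. x)\<bar> \<le> C"
      by (intro integral_dist_le U_cont) auto
    then show ?thesis by (simp add: I_def)
  qed
  have "continuous_on {\<mu> - C..\<mu> + C} I"
    using I_cont by (intro continuous_at_imp_continuous_on) (simp add: isCont_def)
  moreover have "I (\<mu> - C) \<le> \<mu>" "\<mu> \<le> I (\<mu> + C)"
    using I_near[of "\<mu> - C"] I_near[of "\<mu> + C"] by linarith+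
  ultimately obtain x where x: "I x = \<mu>"
    using IVT'[of I "\<mu> - C" \<mu> "\<mu> + C"] \<open>C \<ge> 0\<close> by auto
  show ?thesis
  proof (rule that[of "U x" "Hs x"])
    show "(U x has_real_derivative f y (U x y) (Hs x)) (at y)" for y by (rule U)
    show "periodic_fun_simple' (U x)"
    proof (rule periodicI)
      fix y
      define D where "D y = U x (y + 1) - U x y" for y
      have "D y = 0"
      proof (rule gronwall_zero[of D _ L 0])
        show "(D has_real_derivative f y (U x (y + 1)) (Hs x) - f y (U x y) (Hs x)) (at y)" for y
          unfolding D_def using U[of x "y + 1"] U[of x y]
          by (intro DERIV_diff) (simp_all add: DERIV_shift per)
        show "\<bar>f y (U x (y + 1)) (Hs x) - f y (U x y) (Hs x)\<bar> \<le> L * \<bar>D y\<bar>" for y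
          unfolding D_def using Hs by (intro lip) auto
        show "D 0 = 0" using Hs(2)[of x] Hs(1)[of x] by (simp add: D_def P_def U_def sol0)
      qed (use \<open>L > 0\<close> in auto)
      then show "U x (y + 1) = U x y" by (simp add: D_def)
    qed
    show "integral {0..1} (U x) = \<mu>" using x by (simp add: I_def)
  qed
qed

section \<open>The cell problem as a first-order equation for the slope\<close>

lemma DERIV_periodic:
  fixes f f' :: "real \<Rightarrow> real"
  assumes "\<And>x. (f has_real_derivative f' x) (at x)" "periodic_fun_simple' f"
  shows "periodic_fun_simple' f'"
proof (rule periodicI)
  fix x
  have "((\<lambda>x. f (x + 1)) has_real_derivative f' (x + 1)) (at x)"
    using assms(1)[of "x + 1"] by (simp add: DERIV_shift)
  moreover have "(\<lambda>x. f (x + 1)) = f" using assms(2) by (simp add: periodic_plus_1 fun_eq_iff)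
  ultimately show "f' (x + 1) = f' x" using DERIV_unique[OF _ assms(1)] by simp
qed

lemma Ck_real_2_iff:
  "Ck_real 2 w \<longleftrightarrow> (\<exists>w' w''. (\<forall>x. (w has_real_derivative w' x) (at x))
      \<and> (\<forall>x. (w' has_real_derivative w'' x) (at x)) \<and> continuous_on UNIV w'')"
proof
  assume "Ck_real 2 w"
  then have *: "\<forall>x. (w has_real_derivative deriv w x) (at x)"
    "\<forall>x. (deriv w has_real_derivative deriv (deriv w) x) (at x)" "continuous_on UNIV (deriv (deriv w))"
    by (auto simp: Ck_real_def numeral_2_eq_2 less_Suc_eq DERIV_deriv_iff_real_differentiable)
  then show "\<exists>w' w''. (\<forall>x. (w has_real_derivative w' x) (at x))
      \<and> (\<forall>x. (w' has_real_derivative w'' x) (at x)) \<and> continuous_on UNIV w''" by blast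
next
  assume "\<exists>w' w''. (\<forall>x. (w has_real_derivative w' x) (at x))
      \<and> (\<forall>x. (w' has_real_derivative w'' x) (at x)) \<and> continuous_on UNIV w''"
  then obtain w' w'' where *: "\<And>x. (w has_real_derivative w' x) (at x)"
    "\<And>x. (w' has_real_derivative w'' x) (at x)" "continuous_on UNIV w''" by blast
  then have "deriv w = w'" "deriv w' = w''" by (auto intro!: DERIV_imp_deriv)
  with * show "Ck_real 2 w"
    by (auto simp: Ck_real_def numeral_2_eq_2 less_Suc_eq real_differentiable_def)
qed

lemma Ck_real_2_derivs: 
  assumes "Ck_real 2 w"
  shows "(w has_real_derivative deriv w x) (at x)" "(deriv w has_real_derivative deriv (deriv w) x) (at x)"
  using assms by (auto simp: Ck_real_def numeral_2_eq_2 less_Suc_eq DERIV_deriv_iff_real_differentiable)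

text \<open>The function \<open>\<sigma>\<close> is \<open>S\<close> or a truncation of it, so that the same bounds serve to remove the
  truncation and to estimate true solutions. The first bound is read off where \<open>u = \<mu>\<close> is
  crossed in either direction, the second at a maximum of \<open>u\<^sup>2\<close>.\<close>
lemma slope_apriori:
  fixes u h :: "real \<Rightarrow> real"
  assumes u: "\<And>y. (u has_real_derivative r y * (\<sigma> (u y) + h y - H)) (at y)" and r: "\<And>y. r y > 0"
    and per: "periodic_fun_simple' u" and mean: "integral {0..1} u = \<mu>" and h: "\<And>y. \<bar>h y\<bar> \<le> V"
  shows "\<bar>H - \<sigma> \<mu>\<bar> \<le> V"
    and "\<exists>x. (\<forall>y. \<bar>u y\<bar> \<le> \<bar>u x\<bar>) \<and> (u x = 0 \<or> \<bar>\<sigma> (u x) - H\<bar> \<le> V)"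
proof -
  let ?z = "\<lambda>y. u y - \<mu>" and ?z' = "\<lambda>y. r y * (\<sigma> (u y) + h y - H)"
  have z: "(?z has_real_derivative ?z' y) (at y)" for y
    by (auto intro!: derivative_eq_intros u)
  have zp: "periodic_fun_simple' ?z" using per by (intro periodicI) (simp add: periodic_plus_1)
  have zm: "integral {0..1} ?z = 0"
    using DERIV_imp_continuous_on[OF u] mean
    by (subst integral_diff) (auto intro!: integrable_continuous_real)
  obtain y where y: "u y = \<mu>" "r y * (\<sigma> (u y) + h y - H) \<le> 0"
    using zero_mean_downcrossing[OF z zp zm] by auto
  obtain x where x: "u x = \<mu>" "r x * (\<sigma> (u x) + h x - H) \<ge> 0"
    using zero_mean_upcrossing[OF z zp zm] by auto
  show "\<bar>H - \<sigma> \<mu>\<bar> \<le> V"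
    using x y r[of x] r[of y] h[of x] h[of y] by (auto simp: mult_le_0_iff zero_le_mult_iff)
  let ?q = "\<lambda>y. (u y)\<^sup>2"
  have q: "(?q has_real_derivative 2 * u y * (r y * (\<sigma> (u y) + h y - H))) (at y)" for y
    by (auto intro!: derivative_eq_intros u)
  have "periodic_fun_simple' ?q" using per by (intro periodicI) (simp add: periodic_plus_1)
  then obtain t where t: "\<And>y. ?q y \<le> ?q t"
    using periodic_attains_max[OF _ DERIV_imp_continuous_on[OF q]] by blast
  have "2 * u t * (r t * (\<sigma> (u t) + h t - H)) = 0"
    by (rule DERIV_local_max[OF q, of 1]) (use t in auto)
  then have "u t = 0 \<or> \<sigma> (u t) + h t = H" using r[of t] by auto
  then have "u t = 0 \<or> \<bar>\<sigma> (u t) - H\<bar> \<le> V" using h[of t] by auto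
  moreover have "\<forall>y. \<bar>u y\<bar> \<le> \<bar>u t\<bar>" using t by (simp add: abs_le_square_iff)
  ultimately show "\<exists>x. (\<forall>y. \<bar>u y\<bar> \<le> \<bar>u x\<bar>) \<and> (u x = 0 \<or> \<bar>\<sigma> (u x) - H\<bar> \<le> V)" by blast
qed

locale shear_flow =
  fixes v :: "real \<Rightarrow> real" and \<gamma> :: real
  assumes v_cont: "continuous_on UNIV v" and v_per: "periodic_fun_simple' v" and \<gamma>: "\<gamma> \<noteq> 0"
begin

definition S :: "real \<Rightarrow> real" where "S u = sqrt (\<gamma>\<^sup>2 + u\<^sup>2)"

text \<open>The cell problem solved for \<open>u'\<close>, where \<open>u = \<mu> + w'\<close>.\<close>
definition slope_rhs :: "real \<Rightarrow> real \<Rightarrow> real \<Rightarrow> real \<Rightarrow> real" where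
  "slope_rhs d H y u = (S u)\<^sup>2 / (d * \<gamma>\<^sup>2) * (S u + \<gamma> * v y - H)"

definition slope_solution :: "real \<Rightarrow> real \<Rightarrow> real \<Rightarrow> (real \<Rightarrow> real) \<Rightarrow> bool" where
  "slope_solution d \<mu> H u \<longleftrightarrow> (\<forall>y. (u has_real_derivative slope_rhs d H y (u y)) (at y))
     \<and> periodic_fun_simple' u \<and> integral {0..1} u = \<mu>"

lemma slope_solutionD:
  assumes "slope_solution d \<mu> H u"
  shows "(u has_real_derivative slope_rhs d H y (u y)) (at y)" "periodic_fun_simple' u"
    "integral {0..1} u = \<mu>" "continuous_on A u"
  using assms unfolding slope_solution_def by (auto intro: DERIV_imp_continuous_on)

lemma S_sq: "(S u)\<^sup>2 = \<gamma>\<^sup>2 + u\<^sup>2" by (simp add: S_def)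

lemma S_pos: "S u > 0"
  using \<gamma> by (simp add: S_def add_pos_nonneg)

lemma abs_le_S: "\<bar>u\<bar> \<le> S u" unfolding S_def by (rule real_le_rsqrt) simp

lemma S_mono: "\<bar>u\<bar> \<le> \<bar>w\<bar> \<Longrightarrow> S u \<le> S w"
  by (simp add: S_def abs_le_square_iff)

lemma S_lipschitz: "\<bar>S u - S w\<bar> \<le> \<bar>u - w\<bar>"
  using norm_triangle_ineq3[of "(\<gamma>, u)" "(\<gamma>, w)"] by (simp add: S_def norm_Pair)

definition V where "V = (SOME V. \<forall>y. \<bar>\<gamma> * v y\<bar> \<le> V)"

lemma V: "\<bar>\<gamma> * v y\<bar> \<le> V"
proof -
  have "periodic_fun_simple' (\<lambda>y. \<gamma> * v y)" using v_per by (intro periodicI) (simp add: periodic_plus_1)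
  moreover have "continuous_on UNIV (\<lambda>y. \<gamma> * v y)" using v_cont by (intro continuous_intros)
  ultimately obtain B where "\<forall>y. \<bar>\<gamma> * v y\<bar> \<le> B" using periodic_bounded by metis
  then have "\<forall>y. \<bar>\<gamma> * v y\<bar> \<le> V" unfolding V_def by (rule someI)
  then show ?thesis by simp
qed

lemma V_nonneg: "V \<ge> 0" using V[of 0] by simp

lemma slope_bounds:
  assumes "slope_solution d \<mu> H u" "d > 0"
  shows "\<bar>H - S \<mu>\<bar> \<le> V" "\<bar>u y\<bar> \<le> S \<mu> + 2 * V"
proof -
  note sol = slope_solutionD[OF assms(1)]
  have pos: "(S (u y))\<^sup>2 / (d * \<gamma>\<^sup>2) > 0" for y using S_pos[of "u y"] \<gamma> assms(2) by simp
  note ap = slope_apriori[OF sol(1)[unfolded slope_rhs_def] pos sol(2,3) V]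
  show H: "\<bar>H - S \<mu>\<bar> \<le> V" by (rule ap)
  obtain x where x: "\<And>y. \<bar>u y\<bar> \<le> \<bar>u x\<bar>" "u x = 0 \<or> \<bar>S (u x) - H\<bar> \<le> V" using ap(2) by blast
  have "\<bar>u x\<bar> \<le> S \<mu> + 2 * V" using x(2) abs_le_S[of "u x"] H S_pos[of \<mu>] V_nonneg by auto
  then show "\<bar>u y\<bar> \<le> S \<mu> + 2 * V" using x(1)[of y] by linarith
qed

text \<open>The nonlinearity is frozen outside \<open>[-R, R]\<close> to make it bounded and Lipschitz. Since \<open>R\<close> exceeds
  the a priori bound \<open>S \<mu> + 2 V\<close>, which the truncated equation satisfies too, the solution never reaches
  the region where the truncation acts.\<close>
lemma slope_solution_exists:
  assumes d: "d > 0"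
  shows "\<exists>H u. slope_solution d \<mu> H u"
proof -
  define R where "R = S \<mu> + 2 * V + 1"
  have R: "R > 0" using S_pos[of \<mu>] V_nonneg by (simp add: R_def)
  define c where "c u = max (-R) (min R u)" for u
  have c: "\<bar>c u\<bar> \<le> R" "\<bar>c u - c w\<bar> \<le> \<bar>u - w\<bar>" for u w
    using R by (auto simp: c_def min_def max_def)
  define k where "k = 1 / (d * \<gamma>\<^sup>2)"
  have k: "k > 0" using d \<gamma> by (simp add: k_def)
  define \<rho> where "\<rho> u = k * (S (c u))\<^sup>2" for u
  define b where "b = S R + V + 1"
  define a where "a = - V - 1"
  have SR: "S (c u) \<le> S R" for u using c(1)[of u] R by (intro S_mono) auto
  have \<rho>: "\<rho> u > 0" "\<rho> u \<le> k * (S R)\<^sup>2" for u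
    using k S_pos[of "c u"] SR[of u] by (auto simp: \<rho>_def intro!: power_mono)
  define M where "M = S R + V + b"
  have M: "M > 0" using S_pos[of R] V_nonneg by (simp add: M_def b_def)
  have X: "\<bar>S (c u) + \<gamma> * v y - H\<bar> \<le> M" if "H \<in> {a..b}" for u y H
    using that SR[of u] S_pos[of "c u"] S_pos[of R] V[of y] V_nonneg
    by (auto simp: M_def a_def b_def abs_le_iff)
  obtain H u where u: "\<And>y. (u has_real_derivative \<rho> (u y) * (S (c (u y)) + \<gamma> * v y - H)) (at y)"
      "periodic_fun_simple' u" "integral {0..1} u = \<mu>"
  proof (rule shooting[of "\<lambda>y u H. \<rho> u * (S (c u) + \<gamma> * v y - H)" a b
        "k * (S R)\<^sup>2 + k * (2 * R) * M" "k * (S R)\<^sup>2" "k * (S R)\<^sup>2 * M" \<mu>])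
    fix y u w H H' :: real and z :: "real \<Rightarrow> real"
    show "continuous_on UNIV (\<lambda>y. \<rho> (z y) * (S (c (z y)) + \<gamma> * v y - H))" if "continuous_on UNIV z"
      unfolding \<rho>_def S_def c_def using that v_cont by (intro continuous_intros)
    show "\<rho> u * (S (c u) + \<gamma> * v (y + 1) - H) = \<rho> u * (S (c u) + \<gamma> * v y - H)"
      by (simp add: periodic_plus_1[OF v_per])
    show "k * (S R)\<^sup>2 + k * (2 * R) * M > 0"
      using k S_pos[of R] R M by (intro add_pos_pos mult_pos_pos) auto
    show "k * (S R)\<^sup>2 \<ge> 0" using k by simp
    show "\<bar>\<rho> u * (S (c u) + \<gamma> * v y - H) - \<rho> u * (S (c u) + \<gamma> * v y - H')\<bar> \<le> k * (S R)\<^sup>2 * \<bar>H - H'\<bar>"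
      using \<rho>[of u] by (simp add: abs_mult mult_right_mono abs_minus_commute flip: right_diff_distrib)
    show "\<bar>\<rho> u * (S (c u) + \<gamma> * v y - H)\<bar> \<le> k * (S R)\<^sup>2 * M" if "H \<in> {a..b}"
      unfolding abs_mult using \<rho>[of u] X[OF that] k by (intro mult_mono) auto
    show "\<rho> u * (S (c u) + \<gamma> * v y - H') < \<rho> u * (S (c u) + \<gamma> * v y - H)" if "H < H'"
      using that \<rho>[of u] by (intro mult_strict_left_mono) auto
    show "\<rho> u * (S (c u) + \<gamma> * v y - a) > 0"
      using \<rho>[of u] S_pos[of "c u"] V[of y] by (intro mult_pos_pos) (auto simp: a_def abs_le_iff)
    show "\<rho> u * (S (c u) + \<gamma> * v y - b) < 0"
      using \<rho>[of u] SR[of "u"] V[of y] by (intro mult_pos_neg) (auto simp: b_def abs_le_iff)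
    show "a \<le> b" using S_pos[of R] V_nonneg by (simp add: a_def b_def)
    show "\<bar>\<rho> u * (S (c u) + \<gamma> * v y - H) - \<rho> w * (S (c w) + \<gamma> * v y - H)\<bar>
        \<le> (k * (S R)\<^sup>2 + k * (2 * R) * M) * \<bar>u - w\<bar>" if H: "H \<in> {a..b}"
    proof -
      have "\<rho> u * (S (c u) + \<gamma> * v y - H) - \<rho> w * (S (c w) + \<gamma> * v y - H)
          = \<rho> u * (S (c u) - S (c w)) + (\<rho> u - \<rho> w) * (S (c w) + \<gamma> * v y - H)"
        by (simp add: algebra_simps)
      moreover have "\<bar>\<rho> u * (S (c u) - S (c w))\<bar> \<le> k * (S R)\<^sup>2 * \<bar>u - w\<bar>"
        unfolding abs_mult using \<rho>[of u] S_lipschitz[of "c u" "c w"] c(2)[of u w] k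
        by (intro mult_mono) auto
      moreover have "\<bar>\<rho> u - \<rho> w\<bar> \<le> k * (2 * R) * \<bar>u - w\<bar>"
      proof -
        have "\<rho> u - \<rho> w = k * (c u + c w) * (c u - c w)"
          unfolding \<rho>_def S_sq by (simp add: algebra_simps power2_eq_square)
        then have "\<bar>\<rho> u - \<rho> w\<bar> = k * \<bar>c u + c w\<bar> * \<bar>c u - c w\<bar>" using k by (simp add: abs_mult)
        also have "\<dots> \<le> k * (2 * R) * \<bar>u - w\<bar>"
          using c(1)[of u] c(1)[of w] c(2)[of u w] k R by (intro mult_mono) auto
        finally show ?thesis .
      qed
      then have "\<bar>(\<rho> u - \<rho> w) * (S (c w) + \<gamma> * v y - H)\<bar> \<le> k * (2 * R) * \<bar>u - w\<bar> * M"
        unfolding abs_mult using X[OF H, of w y] k R by (intro mult_mono) auto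
      ultimately show ?thesis by (simp add: algebra_simps)
    qed
  qed (rule that)
  \<comment> \<open>\<open>c\<close> is the identity on the range of \<open>u\<close>: at the maximum of \<open>|u|\<close> the a priori bound gives \<open>|c u| < R\<close>\<close>
  note ap = slope_apriori[where \<sigma> = "\<lambda>u. S (c u)", OF u(1) _ u(2,3) V]
  have "c \<mu> = \<mu>" using abs_le_S[of \<mu>] V_nonneg R by (auto simp: c_def R_def min_def max_def)
  then have H: "\<bar>H - S \<mu>\<bar> \<le> V" using ap(1) \<rho> by simp
  obtain x where x: "\<And>y. \<bar>u y\<bar> \<le> \<bar>u x\<bar>" "u x = 0 \<or> \<bar>S (c (u x)) - H\<bar> \<le> V" using ap(2) \<rho> by blast
  have "u x = 0 \<or> \<bar>c (u x)\<bar> < R" using x(2) abs_le_S[of "c (u x)"] H by (auto simp: R_def)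
  then have "\<bar>u x\<bar> < R" using R by (auto simp: c_def min_def max_def split: if_splits)
  then have "c (u y) = u y" for y using x(1)[of y] by (auto simp: c_def)
  then have "slope_solution d \<mu> H u"
    using u by (simp add: slope_solution_def slope_rhs_def \<rho>_def k_def)
  then show ?thesis by blast
qed

lemma slope_solution_of_cell_solution:
  assumes "cell_solution v d (\<gamma>, \<mu>) H w" "d > 0"
  shows "slope_solution d \<mu> H (\<lambda>y. \<mu> + deriv w y)"
proof -
  have C2: "Ck_real 2 w" and per: "periodic_fun_simple' w"
    and eq: "\<And>y. - (d * \<gamma>\<^sup>2 * deriv (deriv w) y) / (\<gamma>\<^sup>2 + (\<mu> + deriv w y)\<^sup>2)
            + sqrt (\<gamma>\<^sup>2 + (\<mu> + deriv w y)\<^sup>2) + \<gamma> * v y = H"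
    using assms by (auto simp: cell_solution_def)
  note w = Ck_real_2_derivs[OF C2]
  have "deriv (deriv w) y = slope_rhs d H y (\<mu> + deriv w y)" for y
  proof -
    define s where "s = S (\<mu> + deriv w y)"
    have s: "s > 0" "sqrt (\<gamma>\<^sup>2 + (\<mu> + deriv w y)\<^sup>2) = s" "\<gamma>\<^sup>2 + (\<mu> + deriv w y)\<^sup>2 = s\<^sup>2"
      using S_pos by (simp_all add: s_def S_sq) (simp add: S_def)
    have "- (d * \<gamma>\<^sup>2 * deriv (deriv w) y) / s\<^sup>2 + s + \<gamma> * v y = H" using eq[of y] s by simp
    then show ?thesis
      unfolding slope_rhs_def s_def[symmetric] using s(1) \<gamma> assms(2) by (simp add: field_simps)
  qed
  then have "((\<lambda>y. \<mu> + deriv w y) has_real_derivative slope_rhs d H y (\<mu> + deriv w y)) (at y)" for y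
    using w(2)[of y] by (auto intro!: derivative_eq_intros)
  moreover have "periodic_fun_simple' (\<lambda>y. \<mu> + deriv w y)"
    using DERIV_periodic[OF w(1) per] by (intro periodicI) (simp add: periodic_plus_1)
  moreover have "integral {0..1} (\<lambda>y. \<mu> + deriv w y) = \<mu>"
    using integral_DERIV_periodic[OF w(1) per] DERIV_imp_continuous_on[OF w(2)]
    by (subst integral_add) (auto intro!: integrable_continuous_real simp: integral_unique)
  ultimately show ?thesis by (simp add: slope_solution_def)
qed

lemma cell_solution_of_slope_solution:
  assumes "slope_solution d \<mu> H u" "d > 0"
  obtains w where "cell_solution v d (\<gamma>, \<mu>) H w" "w 0 = 0"
proof -
  note u = slope_solutionD[OF assms(1)]
  have "integral {0..1} (\<lambda>y. u y - \<mu>) = 0"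
    using u(3,4) by (subst integral_diff) (auto intro!: integrable_continuous_real)
  moreover have "continuous_on UNIV (\<lambda>y. u y - \<mu>)" using u(4) by (intro continuous_intros)
  moreover have "periodic_fun_simple' (\<lambda>y. u y - \<mu>)"
    using u(2) by (intro periodicI) (simp add: periodic_plus_1)
  ultimately obtain G where G: "\<And>y. (G has_real_derivative u y - \<mu>) (at y)" "periodic_fun_simple' G"
    using periodic_antiderivative by metis
  define w where "w y = G y - G 0" for y
  have w: "(w has_real_derivative u y - \<mu>) (at y)" for y
    unfolding w_def using G(1)[of y] by (auto intro!: derivative_eq_intros)
  have w': "((\<lambda>y. u y - \<mu>) has_real_derivative slope_rhs d H y (u y)) (at y)" for y
    using u(1)[of y] by (auto intro!: derivative_eq_intros)
  have "continuous_on UNIV (\<lambda>y. slope_rhs d H y (u y))"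
    unfolding slope_rhs_def S_def using u(4) v_cont assms(2) \<gamma> by (intro continuous_intros) auto
  then have "Ck_real 2 w" unfolding Ck_real_2_iff
    by (intro exI[of _ "\<lambda>y. u y - \<mu>"] exI[of _ "\<lambda>y. slope_rhs d H y (u y)"] conjI allI w w')
  moreover have "periodic_fun_simple' w" using G(2) by (intro periodicI) (simp add: w_def periodic_plus_1)
  moreover have "deriv w = (\<lambda>y. u y - \<mu>)" using w by (auto intro!: DERIV_imp_deriv)
  moreover have "deriv (\<lambda>y. u y - \<mu>) = (\<lambda>y. slope_rhs d H y (u y))" using w' by (auto intro!: DERIV_imp_deriv)
  moreover have "- (d * \<gamma>\<^sup>2 * slope_rhs d H y (u y)) / (\<gamma>\<^sup>2 + (u y)\<^sup>2) + sqrt (\<gamma>\<^sup>2 + (u y)\<^sup>2) + \<gamma> * v y = H" for y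
    unfolding S_sq[symmetric] S_def[symmetric] slope_rhs_def using S_pos[of "u y"] \<gamma> assms(2)
    by (simp add: field_simps)
  ultimately have "cell_solution v d (\<gamma>, \<mu>) H w" by (simp add: cell_solution_def)
  then show ?thesis by (rule that) (simp add: w_def)
qed


lemma slope_difference:
  assumes "slope_solution d\<^sub>1 \<mu> H\<^sub>1 u\<^sub>1" "slope_solution d\<^sub>2 \<mu> H\<^sub>2 u\<^sub>2"
  defines "z \<equiv> \<lambda>y. u\<^sub>2 y - u\<^sub>1 y"
    and "z' \<equiv> \<lambda>y. slope_rhs d\<^sub>2 H\<^sub>2 y (u\<^sub>2 y) - slope_rhs d\<^sub>1 H\<^sub>1 y (u\<^sub>1 y)"
  shows "(z has_real_derivative z' y) (at y)" "periodic_fun_simple' z" "integral {0..1} z = 0"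
proof -
  note u1 = slope_solutionD[OF assms(1)] and u2 = slope_solutionD[OF assms(2)]
  show "(z has_real_derivative z' y) (at y)"
    unfolding z_def z'_def by (intro DERIV_diff u1 u2)
  show "periodic_fun_simple' z"
    using u1(2) u2(2) by (intro periodicI) (simp add: z_def periodic_plus_1)
  show "integral {0..1} z = 0"
    unfolding z_def using u1(3,4) u2(3,4)
    by (subst integral_diff) (auto intro!: integrable_continuous_real)
qed

lemma nonlinearity_bound:
  assumes "slope_solution d \<mu> H u" "d > 0"
  defines "K \<equiv> S \<mu> + 2 * V"
  shows "\<bar>S (u y) + \<gamma> * v y - H\<bar> \<le> S K + S \<mu> + 2 * V" "S (u y) \<le> S K"
proof -
  have "K \<ge> 0" using S_pos[of \<mu>] V_nonneg by (simp add: K_def)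
  then show "S (u y) \<le> S K"
    using slope_bounds(2)[OF assms(1,2), of y] by (intro S_mono) (simp add: K_def)
  then show "\<bar>S (u y) + \<gamma> * v y - H\<bar> \<le> S K + S \<mu> + 2 * V"
    using slope_bounds(1)[OF assms(1,2)] S_pos[of "u y"] S_pos[of \<mu>] S_pos[of K] V[of y] by linarith
qed

text \<open>Compare the two equations where the slopes cross: there the nonlinear terms agree, and the sign of
  the difference of the derivatives, upward or downward, gives one of the two inequalities.\<close>
lemma H_lipschitz:
  assumes sol: "slope_solution d\<^sub>1 \<mu> H\<^sub>1 u\<^sub>1" "slope_solution d\<^sub>2 \<mu> H\<^sub>2 u\<^sub>2" and d: "d\<^sub>1 > 0" "d\<^sub>2 > 0"
  shows "\<bar>H\<^sub>2 - H\<^sub>1\<bar> \<le> \<bar>d\<^sub>2 - d\<^sub>1\<bar> / d\<^sub>1 * (S (S \<mu> + 2 * V) + S \<mu> + 2 * V)"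
proof -
  define Q where "Q = S (S \<mu> + 2 * V) + S \<mu> + 2 * V"
  define q where "q y = S (u\<^sub>1 y) + \<gamma> * v y - H\<^sub>1" for y
  have q: "\<bar>q y\<bar> \<le> Q" for y
    using nonlinearity_bound(1)[OF sol(1) d(1)] by (simp add: Q_def q_def)
  have q2: "\<bar>(d\<^sub>1 - d\<^sub>2) / d\<^sub>1 * q y\<bar> \<le> \<bar>d\<^sub>2 - d\<^sub>1\<bar> / d\<^sub>1 * Q" for y
    unfolding abs_mult using q[of y] d by (intro mult_mono) (auto simp: abs_minus_commute)
  have key: "(d\<^sub>1 - d\<^sub>2) / d\<^sub>1 * q y - (H\<^sub>2 - H\<^sub>1) = (slope_rhs d\<^sub>2 H\<^sub>2 y (u\<^sub>2 y) - slope_rhs d\<^sub>1 H\<^sub>1 y (u\<^sub>1 y))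
      * (d\<^sub>2 * \<gamma>\<^sup>2 / (S (u\<^sub>1 y))\<^sup>2)" if "u\<^sub>2 y = u\<^sub>1 y" for y
    using d \<gamma> S_pos[of "u\<^sub>1 y"] by (simp add: slope_rhs_def that q_def divide_simps) algebra
  have pos: "d\<^sub>2 * \<gamma>\<^sup>2 / (S (u\<^sub>1 y))\<^sup>2 \<ge> 0" for y using d by simp
  obtain y where "u\<^sub>2 y = u\<^sub>1 y" "slope_rhs d\<^sub>2 H\<^sub>2 y (u\<^sub>2 y) - slope_rhs d\<^sub>1 H\<^sub>1 y (u\<^sub>1 y) \<le> 0"
    using zero_mean_downcrossing[OF slope_difference[OF sol]] by auto
  then have "(d\<^sub>1 - d\<^sub>2) / d\<^sub>1 * q y \<le> H\<^sub>2 - H\<^sub>1"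
    using key[of y] pos[of y] mult_nonpos_nonneg by (metis diff_le_0_iff_le)
  moreover obtain x where "u\<^sub>2 x = u\<^sub>1 x" "slope_rhs d\<^sub>2 H\<^sub>2 x (u\<^sub>2 x) - slope_rhs d\<^sub>1 H\<^sub>1 x (u\<^sub>1 x) \<ge> 0"
    using zero_mean_upcrossing[OF slope_difference[OF sol]] by auto
  then have "(d\<^sub>1 - d\<^sub>2) / d\<^sub>1 * q x \<ge> H\<^sub>2 - H\<^sub>1"
    using key[of x] pos[of x] mult_nonneg_nonneg by (metis diff_ge_0_iff_ge)
  ultimately show ?thesis
    using q2[of x] q2[of y] unfolding Q_def[symmetric] by linarith
qed

text \<open>The difference \<open>z\<close> of the slopes vanishes somewhere, since its mean is zero, and it satisfies a linear differential
  inequality with an error of order \<open>|d\<^sub>2 - d\<^sub>1|\<close>; Gronwall over one period does the rest. The constant may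
  depend on \<open>d\<^sub>1\<close>, and \<open>d\<^sub>2\<close> is kept away from \<open>0\<close>. For \<open>d\<^sub>2 = d\<^sub>1\<close> this is uniqueness.\<close>
lemma slope_lipschitz:
  assumes d1: "d\<^sub>1 > 0"
  obtains C where "C \<ge> 0"
    "\<And>d\<^sub>2 H\<^sub>1 u\<^sub>1 H\<^sub>2 u\<^sub>2 y. slope_solution d\<^sub>1 \<mu> H\<^sub>1 u\<^sub>1 \<Longrightarrow> slope_solution d\<^sub>2 \<mu> H\<^sub>2 u\<^sub>2 \<Longrightarrow> d\<^sub>2 \<ge> d\<^sub>1 / 2 \<Longrightarrow>
       \<bar>u\<^sub>2 y - u\<^sub>1 y\<bar> \<le> C * \<bar>d\<^sub>2 - d\<^sub>1\<bar>
       \<and> \<bar>slope_rhs d\<^sub>2 H\<^sub>2 y (u\<^sub>2 y) - slope_rhs d\<^sub>1 H\<^sub>1 y (u\<^sub>1 y)\<bar> \<le> C * \<bar>d\<^sub>2 - d\<^sub>1\<bar>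
       \<and> \<bar>H\<^sub>2 - H\<^sub>1\<bar> \<le> C * \<bar>d\<^sub>2 - d\<^sub>1\<bar>"
proof -
  define K where "K = S \<mu> + 2 * V"
  have K: "K > 0" using S_pos[of \<mu>] V_nonneg by (simp add: K_def)
  define Q where "Q = S K + S \<mu> + 2 * V"
  have Q: "Q > 0" using S_pos[of \<mu>] S_pos[of K] V_nonneg by (simp add: Q_def)
  define k where "k = 1 / (d\<^sub>1 * \<gamma>\<^sup>2)"
  have k: "k > 0" using d1 \<gamma> by (simp add: k_def)
  define L where "L = k * (2 * K * Q + (S K)\<^sup>2)"
  define C1 where "C1 = 3 * (S K)\<^sup>2 * Q * k / d\<^sub>1"
  define E where "E = sqrt (exp (2 * L + 1))"
  define C where "C = max (E * C1) (max (L * (E * C1) + C1) (Q / d\<^sub>1))"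
  have L: "L \<ge> 0" and C1: "C1 \<ge> 0" and E: "E \<ge> 0" using K Q k d1 by (auto simp: L_def C1_def E_def)
  show ?thesis
  proof (rule that[of C])
    show "C \<ge> 0" using E C1 by (simp add: C_def le_max_iff_disj)
    fix d\<^sub>2 H\<^sub>1 u\<^sub>1 H\<^sub>2 u\<^sub>2 y
    assume sol: "slope_solution d\<^sub>1 \<mu> H\<^sub>1 u\<^sub>1" "slope_solution d\<^sub>2 \<mu> H\<^sub>2 u\<^sub>2" and d2: "d\<^sub>2 \<ge> d\<^sub>1 / 2"
    have d2': "d\<^sub>2 > 0" using d1 d2 by simp
    define \<delta> where "\<delta> = \<bar>d\<^sub>2 - d\<^sub>1\<bar>"
    note u1 = slope_solutionD[OF sol(1)] and u2 = slope_solutionD[OF sol(2)]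
    have H: "\<bar>H\<^sub>2 - H\<^sub>1\<bar> \<le> \<delta> / d\<^sub>1 * Q"
      using H_lipschitz[OF sol d1 d2'] by (simp add: \<delta>_def Q_def K_def)
    define z where "z y = u\<^sub>2 y - u\<^sub>1 y" for y
    define z' where "z' y = slope_rhs d\<^sub>2 H\<^sub>2 y (u\<^sub>2 y) - slope_rhs d\<^sub>1 H\<^sub>1 y (u\<^sub>1 y)" for y
    note zz = slope_difference[OF sol, folded z_def z'_def]
    have z': "\<bar>z' y\<bar> \<le> L * \<bar>z y\<bar> + C1 * \<delta>" for y
    proof -
      define q1 where "q1 = S (u\<^sub>1 y) + \<gamma> * v y - H\<^sub>1"
      define q2 where "q2 = S (u\<^sub>2 y) + \<gamma> * v y - H\<^sub>2"
      have q: "\<bar>q1\<bar> \<le> Q" "\<bar>q2\<bar> \<le> Q" and SK: "S (u\<^sub>1 y) \<le> S K" "S (u\<^sub>2 y) \<le> S K"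
        using nonlinearity_bound[OF sol(1) d1] nonlinearity_bound[OF sol(2) d2']
        by (auto simp: q1_def q2_def K_def Q_def)
      have sq: "(S (u\<^sub>1 y))\<^sup>2 \<le> (S K)\<^sup>2" "(S (u\<^sub>2 y))\<^sup>2 \<le> (S K)\<^sup>2"
        using SK S_pos[THEN less_imp_le] by (simp_all add: power_mono)
      have uK: "\<bar>u\<^sub>1 y\<bar> \<le> K" "\<bar>u\<^sub>2 y\<bar> \<le> K"
        using slope_bounds(2)[OF sol(1) d1] slope_bounds(2)[OF sol(2) d2'] by (auto simp: K_def)
      have eq: "z' y = k * ((u\<^sub>2 y + u\<^sub>1 y) * z y * q2 + (S (u\<^sub>1 y))\<^sup>2 * (q2 - q1))
          + (S (u\<^sub>2 y))\<^sup>2 * q2 * (k * ((d\<^sub>1 - d\<^sub>2) / d\<^sub>2))"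
      proof -
        have "(u\<^sub>2 y + u\<^sub>1 y) * z y = (S (u\<^sub>2 y))\<^sup>2 - (S (u\<^sub>1 y))\<^sup>2"
          unfolding S_sq by (simp add: z_def power2_eq_square algebra_simps)
        then show ?thesis
          unfolding z'_def slope_rhs_def q1_def[symmetric] q2_def[symmetric] k_def
          using d1 d2' \<gamma> by (simp add: divide_simps) (simp add: algebra_simps)
      qed
      have a: "\<bar>(u\<^sub>2 y + u\<^sub>1 y) * z y * q2\<bar> \<le> 2 * K * \<bar>z y\<bar> * Q"
        unfolding abs_mult using q uK K by (intro mult_mono) auto
      have "\<bar>q2 - q1\<bar> \<le> \<bar>z y\<bar> + \<delta> / d\<^sub>1 * Q"
        using S_lipschitz[of "u\<^sub>2 y" "u\<^sub>1 y"] H by (simp add: q1_def q2_def z_def)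
      then have b: "\<bar>(S (u\<^sub>1 y))\<^sup>2 * (q2 - q1)\<bar> \<le> (S K)\<^sup>2 * (\<bar>z y\<bar> + \<delta> / d\<^sub>1 * Q)"
        unfolding abs_mult using sq by (intro mult_mono) auto
      have "\<bar>(d\<^sub>1 - d\<^sub>2) / d\<^sub>2\<bar> = \<delta> / d\<^sub>2" using d2' by (simp add: \<delta>_def abs_minus_commute)
      also have "\<dots> \<le> \<delta> / (d\<^sub>1 / 2)" using d1 d2 by (intro divide_left_mono) (auto simp: \<delta>_def)
      finally have c0: "\<bar>(d\<^sub>1 - d\<^sub>2) / d\<^sub>2\<bar> \<le> 2 * \<delta> / d\<^sub>1" by (simp add: mult.commute)
      have c: "\<bar>(S (u\<^sub>2 y))\<^sup>2 * q2 * (k * ((d\<^sub>1 - d\<^sub>2) / d\<^sub>2))\<bar> \<le> (S K)\<^sup>2 * Q * (k * (2 * \<delta> / d\<^sub>1))"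
        unfolding abs_mult[of k] abs_mult[of _ "k * _"] abs_mult[of _ q2]
        using q sq k Q by (intro mult_mono c0) auto
      have "\<bar>k * ((u\<^sub>2 y + u\<^sub>1 y) * z y * q2 + (S (u\<^sub>1 y))\<^sup>2 * (q2 - q1))\<bar>
          \<le> k * (2 * K * \<bar>z y\<bar> * Q + (S K)\<^sup>2 * (\<bar>z y\<bar> + \<delta> / d\<^sub>1 * Q))"
        unfolding abs_mult[of k] using k a b by (intro mult_mono) auto
      then have "\<bar>z' y\<bar> \<le> k * (2 * K * \<bar>z y\<bar> * Q + (S K)\<^sup>2 * (\<bar>z y\<bar> + \<delta> / d\<^sub>1 * Q))
          + (S K)\<^sup>2 * Q * (k * (2 * \<delta> / d\<^sub>1))"
        using c unfolding eq by linarith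
      also have "\<dots> = L * \<bar>z y\<bar> + C1 * \<delta>" using d1 by (simp add: L_def C1_def field_simps)
      finally show ?thesis .
    qed
    have z: "\<bar>z y\<bar> \<le> E * C1 * \<delta>" for y
    proof -
      obtain x where x: "z x = 0" using zero_mean_downcrossing[OF zz] by auto
      define t where "t = frac (y - x)"
      have t: "0 \<le> t" "t \<le> 1" using frac_lt_1[of "y - x"] by (auto simp: t_def less_imp_le)
      have "z y = z (x + t)"
      proof -
        have "periodic_fun_simple' (\<lambda>s. z (x + s))"
          using periodic_plus_1[OF zz(2)] by (intro periodicI) (simp add: add.assoc[symmetric])
        then show ?thesis using periodic_frac[of "\<lambda>s. z (x + s)" "y - x"] by (simp add: t_def)
      qed
      have "(z (x + t))\<^sup>2 \<le> exp ((2 * L + 1) * (x + t - x)) * ((z x)\<^sup>2 + (C1 * \<delta>)\<^sup>2 * (x + t - x))"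
        by (rule gronwall_square[OF _ zz(1) z' L]) (use t in auto)
      also have "\<dots> \<le> exp ((2 * L + 1) * 1) * (0 + (C1 * \<delta>)\<^sup>2 * 1)"
        using t L x by (intro mult_mono add_mono mult_left_mono) auto
      also have "\<dots> = (E * C1 * \<delta>)\<^sup>2" by (simp add: E_def power_mult_distrib)
      finally have "\<bar>z (x + t)\<bar> \<le> \<bar>E * C1 * \<delta>\<bar>" by (simp only: abs_le_square_iff)
      then show ?thesis using \<open>z y = z (x + t)\<close> E C1 by (simp add: \<delta>_def abs_mult)
    qed
    have \<delta>: "\<delta> \<ge> 0" by (simp add: \<delta>_def)
    have "E * C1 * \<delta> \<le> C * \<delta>" using \<delta> by (intro mult_right_mono) (auto simp: C_def)
    moreover have "(L * (E * C1) + C1) * \<delta> \<le> C * \<delta>" using \<delta> by (intro mult_right_mono) (auto simp: C_def)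
    moreover have "Q / d\<^sub>1 * \<delta> \<le> C * \<delta>" using \<delta> by (intro mult_right_mono) (auto simp: C_def)
    moreover have "L * \<bar>z y\<bar> \<le> L * (E * C1 * \<delta>)" using z L by (intro mult_left_mono)
    then have "\<bar>z' y\<bar> \<le> (L * (E * C1) + C1) * \<delta>" using z'[of y] by (simp add: algebra_simps)
    ultimately show "\<bar>u\<^sub>2 y - u\<^sub>1 y\<bar> \<le> C * \<bar>d\<^sub>2 - d\<^sub>1\<bar>
       \<and> \<bar>slope_rhs d\<^sub>2 H\<^sub>2 y (u\<^sub>2 y) - slope_rhs d\<^sub>1 H\<^sub>1 y (u\<^sub>1 y)\<bar> \<le> C * \<bar>d\<^sub>2 - d\<^sub>1\<bar>
       \<and> \<bar>H\<^sub>2 - H\<^sub>1\<bar> \<le> C * \<bar>d\<^sub>2 - d\<^sub>1\<bar>"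
      using z[of y] H unfolding z_def[symmetric] z'_def[symmetric] \<delta>_def[symmetric] by (simp add: mult.commute)
  qed
qed

lemma slope_solution_unique:
  assumes "slope_solution d \<mu> H\<^sub>1 u\<^sub>1" "slope_solution d \<mu> H\<^sub>2 u\<^sub>2" "d > 0"
  shows "H\<^sub>1 = H\<^sub>2" "u\<^sub>1 = u\<^sub>2"
proof -
  obtain C where "\<bar>u\<^sub>2 y - u\<^sub>1 y\<bar> \<le> C * \<bar>d - d\<bar> \<and> \<bar>H\<^sub>2 - H\<^sub>1\<bar> \<le> C * \<bar>d - d\<bar>" for y
    using slope_lipschitz[OF assms(3), of \<mu>] assms by (metis field_sum_of_halves le_add_same_cancel1 less_imp_le half_gt_zero)
  then show "H\<^sub>1 = H\<^sub>2" "u\<^sub>1 = u\<^sub>2" by auto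
qed

lemma Hbar_eq:
  assumes "d > 0" "slope_solution d \<mu> H u"
  shows "Hbar v d (\<gamma>, \<mu>) = H"
  unfolding Hbar_def
proof (rule the_equality)
  show "\<exists>w. cell_solution v d (\<gamma>, \<mu>) H w"
    using cell_solution_of_slope_solution[OF assms(2,1)] by blast
  show "H' = H" if "\<exists>w. cell_solution v d (\<gamma>, \<mu>) H' w" for H'
    using that slope_solution_of_cell_solution[OF _ assms(1)] slope_solution_unique(1)[OF _ assms(2,1)] by blast
qed

definition slope :: "real \<Rightarrow> real \<Rightarrow> real \<Rightarrow> real" where
  "slope d \<mu> = (SOME u. slope_solution d \<mu> (Hbar v d (\<gamma>, \<mu>)) u)"

lemma slope: "d > 0 \<Longrightarrow> slope_solution d \<mu> (Hbar v d (\<gamma>, \<mu>)) (slope d \<mu>)"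
  unfolding slope_def using slope_solution_exists[of d \<mu>] Hbar_eq by (metis someI)

lemma corrector:
  assumes "d > 0"
  shows "cell_solution v d (\<gamma>, \<mu>) (Hbar v d (\<gamma>, \<mu>)) (corrector v d (\<gamma>, \<mu>))"
    and "corrector v d (\<gamma>, \<mu>) 0 = 0"
proof -
  let ?P = "\<lambda>w. cell_solution v d (\<gamma>, \<mu>) (Hbar v d (\<gamma>, \<mu>)) w \<and> w 0 = 0"
  have "\<exists>!w. ?P w"
  proof (rule ex_ex1I)
    show "\<exists>w. ?P w" using cell_solution_of_slope_solution[OF slope[OF assms] assms] by metis
    fix w\<^sub>1 w\<^sub>2 assume w: "?P w\<^sub>1" "?P w\<^sub>2"
    have "(\<lambda>y. \<mu> + deriv w\<^sub>1 y) = (\<lambda>y. \<mu> + deriv w\<^sub>2 y)"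
      using w slope_solution_unique(2) slope_solution_of_cell_solution assms by blast
    then have "deriv w\<^sub>1 = deriv w\<^sub>2" by (simp add: fun_eq_iff)
    moreover have "Ck_real 2 w\<^sub>1" "Ck_real 2 w\<^sub>2" using w by (auto simp: cell_solution_def)
    ultimately have "\<forall>x. ((\<lambda>x. w\<^sub>1 x - w\<^sub>2 x) has_real_derivative 0) (at x)"
      using Ck_real_2_derivs(1) by (metis DERIV_diff cancel_comm_monoid_add_class.diff_cancel)
    then have "w\<^sub>1 x - w\<^sub>2 x = w\<^sub>1 0 - w\<^sub>2 0" for x by (rule DERIV_isconst_all)
    then show "w\<^sub>1 = w\<^sub>2" using w by (simp add: fun_eq_iff)
  qed
  from theI'[OF this] show "cell_solution v d (\<gamma>, \<mu>) (Hbar v d (\<gamma>, \<mu>)) (corrector v d (\<gamma>, \<mu>))"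
    "corrector v d (\<gamma>, \<mu>) 0 = 0"
    unfolding corrector_def by blast+
qed

end

section \<open>The derivative of the effective Hamiltonian in d\<close>

context shear_flow begin

text \<open>The first-order Taylor estimate for \<open>S\<^sup>3\<close>, whose derivative is \<open>3 u S(u)\<close>. It is obtained by
  algebra from \<open>S(w)\<^sup>2 - S(u)\<^sup>2 = 2 u z + z\<^sup>2\<close> and \<open>2 S(u) (S(w) - S(u)) = 2 u z + z\<^sup>2 - (S(w) - S(u))\<^sup>2\<close>.\<close>
lemma S_cube_quadratic:
  fixes u w :: real
  defines "z \<equiv> w - u"
  assumes "\<bar>u\<bar> \<le> K" "\<bar>w\<bar> \<le> K"
  shows "\<bar>(S w)^3 - (S u)^3 - 3 * u * S u * z\<bar> \<le> (2 * K + 2 * S K) * z\<^sup>2"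
proof -
  define \<sigma> where "\<sigma> = S w - S u"
  have K: "S u \<le> S K" "S w \<le> S K" using assms by (auto intro!: S_mono)
  have \<sigma>: "\<bar>\<sigma>\<bar> \<le> \<bar>z\<bar>" unfolding \<sigma>_def z_def by (rule S_lipschitz)
  have w: "w = u + z" by (simp add: z_def)
  have sq: "(S w)\<^sup>2 = (S u)\<^sup>2 + 2 * u * z + z\<^sup>2"
    unfolding S_sq w by (simp add: power2_eq_square algebra_simps)
  have Sw: "S w = S u + \<sigma>" by (simp add: \<sigma>_def)
  have half: "S u * \<sigma> = u * z + z\<^sup>2 / 2 - \<sigma>\<^sup>2 / 2"
    using sq unfolding Sw by (simp add: power2_eq_square algebra_simps)
  have "(S w)^3 = (S w)\<^sup>2 * S w" by (simp add: power2_eq_square power3_eq_cube)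
  also have "\<dots> = ((S u)\<^sup>2 + 2 * u * z + z\<^sup>2) * (S u + \<sigma>)" by (simp only: sq) (simp only: Sw)
  finally have "(S w)^3 - (S u)^3 - 3 * u * S u * z
      = S u * (S u * \<sigma>) - u * S u * z + 2 * u * z * \<sigma> + z\<^sup>2 * S w"
    unfolding Sw by (simp add: power2_eq_square power3_eq_cube algebra_simps)
  also have "\<dots> = S u * (z\<^sup>2 / 2 - \<sigma>\<^sup>2 / 2) + 2 * u * z * \<sigma> + z\<^sup>2 * S w"
    unfolding half by (simp add: algebra_simps)
  finally have eq: "(S w)^3 - (S u)^3 - 3 * u * S u * z
      = S u * (z\<^sup>2 / 2 - \<sigma>\<^sup>2 / 2) + 2 * u * z * \<sigma> + z\<^sup>2 * S w" .
  have s2: "\<sigma>\<^sup>2 \<le> z\<^sup>2" using \<sigma> by (simp add: abs_le_square_iff)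
  have s3: "z\<^sup>2 / 2 - \<sigma>\<^sup>2 / 2 \<le> z\<^sup>2"
    using zero_le_power2[of z] zero_le_power2[of \<sigma>] by linarith
  have a: "\<bar>S u * (z\<^sup>2 / 2 - \<sigma>\<^sup>2 / 2)\<bar> \<le> S K * z\<^sup>2"
    unfolding abs_mult using K S_pos[of u] s2 s3 by (intro mult_mono) auto
  have "\<bar>u * (z * \<sigma>)\<bar> \<le> K * (\<bar>z\<bar> * \<bar>z\<bar>)"
    unfolding abs_mult using assms \<sigma> by (intro mult_mono) auto
  then have b: "\<bar>2 * u * z * \<sigma>\<bar> \<le> 2 * K * z\<^sup>2"
    by (simp add: power2_eq_square abs_mult mult_ac)
  have c: "\<bar>z\<^sup>2 * S w\<bar> \<le> S K * z\<^sup>2"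
    unfolding abs_mult using mult_left_mono[OF K(2) zero_le_power2[of z]] S_pos[of w] by (simp add: mult.commute)
  show ?thesis unfolding eq using a b c by (simp add: algebra_simps)
qed

text \<open>The derivative of \<open>slope_rhs d H y\<close> at \<open>u y\<close>, using \<open>S' = u / S\<close>.\<close>
definition linearised_rhs :: "real \<Rightarrow> real \<Rightarrow> (real \<Rightarrow> real) \<Rightarrow> real \<Rightarrow> real" where
  "linearised_rhs d H u y = (3 * u y * S (u y) + 2 * u y * (\<gamma> * v y - H)) / (d * \<gamma>\<^sup>2)"

lemma slope_rhs_cont:
  assumes "continuous_on A u" "d > 0"
  shows "continuous_on A (\<lambda>y. slope_rhs d H y (u y))"
  unfolding slope_rhs_def S_def using assms \<gamma> continuous_on_subset[OF v_cont, of A]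
  by (intro continuous_intros) auto

lemma weight_exists:
  assumes "slope_solution d \<mu> H u" "d > 0"
  obtains n l where "\<And>y. (n has_real_derivative l - linearised_rhs d H u y * n y) (at y)"
    "periodic_fun_simple' n" "\<And>y. n y > 0"
proof -
  note u = slope_solutionD[OF assms(1)]
  have "continuous_on UNIV (linearised_rhs d H u)"
    unfolding linearised_rhs_def S_def using u(4) v_cont assms(2) \<gamma> by (intro continuous_intros) auto
  moreover have "periodic_fun_simple' (linearised_rhs d H u)"
    using u(2) v_per by (intro periodicI) (simp add: linearised_rhs_def periodic_plus_1)
  ultimately show ?thesis using adjoint_exists that by blast
qed

text \<open>The difference \<open>z\<close> of the two slopes solves the equation linearised at \<open>u\<close> up to a remainder \<open>R\<close>
  that is quadratic in \<open>z\<close>, \<open>z'\<close>, \<open>H\<^sub>2 - H\<close> and \<open>d\<^sub>2 - d\<close>, each of which is \<open>O(|d\<^sub>2 - d|)\<close>.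
  Multiplied by \<open>n\<close>, the linear part is \<open>(n z)' - l z\<close> and integrates to zero, because \<open>z\<close> has mean zero.\<close>
lemma Hbar_expansion:
  assumes d: "d > 0" and sol: "slope_solution d \<mu> H u"
    and n: "\<And>y. (n has_real_derivative l - linearised_rhs d H u y * n y) (at y)"
    and n_per: "periodic_fun_simple' n"
  obtains C where "\<And>d\<^sub>2 H\<^sub>2 u\<^sub>2. slope_solution d\<^sub>2 \<mu> H\<^sub>2 u\<^sub>2 \<Longrightarrow> d\<^sub>2 \<ge> d / 2 \<Longrightarrow>
     \<bar>(H\<^sub>2 - H) * integral {0..1} (\<lambda>y. n y * (S (u y))\<^sup>2)
       + (d\<^sub>2 - d) * (\<gamma>\<^sup>2 * integral {0..1} (\<lambda>y. n y * slope_rhs d H y (u y)))\<bar> \<le> C * (d\<^sub>2 - d)\<^sup>2"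
proof -
  note u = slope_solutionD[OF sol]
  have n_cont: "continuous_on A n" for A using n by (rule DERIV_imp_continuous_on)
  obtain C0 where C0: "C0 \<ge> 0"
    "\<And>d\<^sub>2 H\<^sub>2 u\<^sub>2 y. slope_solution d\<^sub>2 \<mu> H\<^sub>2 u\<^sub>2 \<Longrightarrow> d\<^sub>2 \<ge> d / 2 \<Longrightarrow>
       \<bar>u\<^sub>2 y - u y\<bar> \<le> C0 * \<bar>d\<^sub>2 - d\<bar>
       \<and> \<bar>slope_rhs d\<^sub>2 H\<^sub>2 y (u\<^sub>2 y) - slope_rhs d H y (u y)\<bar> \<le> C0 * \<bar>d\<^sub>2 - d\<bar>
       \<and> \<bar>H\<^sub>2 - H\<bar> \<le> C0 * \<bar>d\<^sub>2 - d\<bar>"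
    using slope_lipschitz[OF d, of \<mu>] sol by metis
  obtain Nmax where Nmax: "\<And>y. \<bar>n y\<bar> \<le> Nmax" using periodic_bounded[OF n_per n_cont] by blast
  define K where "K = S \<mu> + 2 * V"
  have K: "K > 0" using S_pos[of \<mu>] V_nonneg by (simp add: K_def)
  define C where "C = (2 * K + 2 * S K) * C0\<^sup>2 + K * C0\<^sup>2 + C0 * (2 * K * C0) + \<gamma>\<^sup>2 * C0"
  show ?thesis
  proof (rule that[of "Nmax * C"])
    fix d\<^sub>2 H\<^sub>2 u\<^sub>2 assume sol2: "slope_solution d\<^sub>2 \<mu> H\<^sub>2 u\<^sub>2" and d2: "d\<^sub>2 \<ge> d / 2"
    have d2': "d\<^sub>2 > 0" using d d2 by simp
    note u2 = slope_solutionD[OF sol2]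
    define \<delta> where "\<delta> = \<bar>d\<^sub>2 - d\<bar>"
    have \<delta>: "\<delta> \<ge> 0" by (simp add: \<delta>_def)
    define z where "z y = u\<^sub>2 y - u y" for y
    define z' where "z' y = slope_rhs d\<^sub>2 H\<^sub>2 y (u\<^sub>2 y) - slope_rhs d H y (u y)" for y
    note zz = slope_difference[OF sol sol2, folded z_def z'_def]
    have bound: "\<bar>z y\<bar> \<le> C0 * \<delta>" "\<bar>z' y\<bar> \<le> C0 * \<delta>" "\<bar>H\<^sub>2 - H\<bar> \<le> C0 * \<delta>" for y
      using C0(2)[OF sol2 d2, of y] by (auto simp: z_def z'_def \<delta>_def)
    define R where "R y = d * \<gamma>\<^sup>2 * (z' y - linearised_rhs d H u y * z y) + (H\<^sub>2 - H) * (S (u y))\<^sup>2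
        + (d\<^sub>2 - d) * \<gamma>\<^sup>2 * slope_rhs d H y (u y)" for y
    have R_eq: "R y = ((S (u\<^sub>2 y))^3 - (S (u y))^3 - 3 * u y * S (u y) * z y) + (\<gamma> * v y - H) * (z y)\<^sup>2
        - (H\<^sub>2 - H) * ((u\<^sub>2 y + u y) * z y) - (d\<^sub>2 - d) * (\<gamma>\<^sup>2 * z' y)" for y
    proof -
      have 1: "d * \<gamma>\<^sup>2 * linearised_rhs d H u y = 3 * u y * S (u y) + 2 * u y * (\<gamma> * v y - H)"
        using d \<gamma> by (simp add: linearised_rhs_def)
      have 2: "d * \<gamma>\<^sup>2 * slope_rhs d H y (u y) = (S (u y))\<^sup>2 * (S (u y) + \<gamma> * v y - H)"
        using d \<gamma> by (simp add: slope_rhs_def)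
      have 3: "d\<^sub>2 * \<gamma>\<^sup>2 * slope_rhs d\<^sub>2 H\<^sub>2 y (u\<^sub>2 y) = (S (u\<^sub>2 y))\<^sup>2 * (S (u\<^sub>2 y) + \<gamma> * v y - H\<^sub>2)"
        using d2' \<gamma> by (simp add: slope_rhs_def)
      have 4: "(S (u\<^sub>2 y))\<^sup>2 = (S (u y))\<^sup>2 + 2 * u y * z y + (z y)\<^sup>2"
        unfolding S_sq z_def by (simp add: power2_eq_square algebra_simps)
      have 5: "(u\<^sub>2 y + u y) * z y = 2 * u y * z y + (z y)\<^sup>2"
        unfolding z_def by (simp add: power2_eq_square algebra_simps)
      have "R y + (d\<^sub>2 - d) * (\<gamma>\<^sup>2 * z' y) = d\<^sub>2 * \<gamma>\<^sup>2 * slope_rhs d\<^sub>2 H\<^sub>2 y (u\<^sub>2 y) - d * \<gamma>\<^sup>2 * slope_rhs d H y (u y)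
          - d * \<gamma>\<^sup>2 * linearised_rhs d H u y * z y + (H\<^sub>2 - H) * (S (u y))\<^sup>2"
        unfolding R_def z'_def by (simp add: algebra_simps)
      also have "\<dots> = (S (u\<^sub>2 y))\<^sup>2 * S (u\<^sub>2 y) + (S (u\<^sub>2 y))\<^sup>2 * (\<gamma> * v y - H\<^sub>2)
          - (S (u y))\<^sup>2 * (S (u y) + \<gamma> * v y - H)
          - (3 * u y * S (u y) + 2 * u y * (\<gamma> * v y - H)) * z y + (H\<^sub>2 - H) * (S (u y))\<^sup>2"
        unfolding 1 2 3 by (simp add: algebra_simps)
      also have "\<dots> = (S (u\<^sub>2 y))^3 + ((S (u y))\<^sup>2 + 2 * u y * z y + (z y)\<^sup>2) * (\<gamma> * v y - H\<^sub>2)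
          - (S (u y))\<^sup>2 * (S (u y) + \<gamma> * v y - H)
          - (3 * u y * S (u y) + 2 * u y * (\<gamma> * v y - H)) * z y + (H\<^sub>2 - H) * (S (u y))\<^sup>2"
        unfolding 4[symmetric] by (simp add: power2_eq_square power3_eq_cube)
      finally show ?thesis unfolding 5
        by (simp add: algebra_simps power2_eq_square power3_eq_cube)
    qed
    have R: "\<bar>R y\<bar> \<le> C * \<delta>\<^sup>2" for y
    proof -
      have uK: "\<bar>u y\<bar> \<le> K" "\<bar>u\<^sub>2 y\<bar> \<le> K"
        using slope_bounds(2)[OF sol d] slope_bounds(2)[OF sol2 d2'] by (auto simp: K_def)
      have hK: "\<bar>\<gamma> * v y - H\<bar> \<le> K"
        using slope_bounds(1)[OF sol d] V[of y] S_pos[of \<mu>] by (auto simp: K_def abs_le_iff)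
      have z2: "(z y)\<^sup>2 \<le> C0\<^sup>2 * \<delta>\<^sup>2"
        using power_mono[OF bound(1)[of y], of 2] by (simp add: power_mult_distrib)
      have "\<bar>(S (u\<^sub>2 y))^3 - (S (u y))^3 - 3 * u y * S (u y) * z y\<bar> \<le> (2 * K + 2 * S K) * (z y)\<^sup>2"
        unfolding z_def by (rule S_cube_quadratic[OF uK])
      also have "\<dots> \<le> (2 * K + 2 * S K) * (C0\<^sup>2 * \<delta>\<^sup>2)"
        using z2 K S_pos[of K] by (intro mult_left_mono) auto
      finally have a: "\<bar>(S (u\<^sub>2 y))^3 - (S (u y))^3 - 3 * u y * S (u y) * z y\<bar> \<le> (2 * K + 2 * S K) * (C0\<^sup>2 * \<delta>\<^sup>2)" .
      have b: "\<bar>(\<gamma> * v y - H) * (z y)\<^sup>2\<bar> \<le> K * (C0\<^sup>2 * \<delta>\<^sup>2)"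
        unfolding abs_mult using hK z2 K by (intro mult_mono) auto
      have c: "\<bar>(H\<^sub>2 - H) * ((u\<^sub>2 y + u y) * z y)\<bar> \<le> C0 * \<delta> * (2 * K * (C0 * \<delta>))"
        unfolding abs_mult using bound(1,2)[of y] bound(3) uK K C0(1) \<delta> by (intro mult_mono) auto
      have e: "\<bar>(d\<^sub>2 - d) * (\<gamma>\<^sup>2 * z' y)\<bar> \<le> \<delta> * (\<gamma>\<^sup>2 * (C0 * \<delta>))"
        unfolding abs_mult using bound(1,2)[of y] bound(3) by (intro mult_mono) (auto simp: \<delta>_def)
      have "\<bar>R y\<bar> \<le> (2 * K + 2 * S K) * (C0\<^sup>2 * \<delta>\<^sup>2) + K * (C0\<^sup>2 * \<delta>\<^sup>2) + C0 * \<delta> * (2 * K * (C0 * \<delta>))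
          + \<delta> * (\<gamma>\<^sup>2 * (C0 * \<delta>))"
        unfolding R_eq using a b c e by linarith
      also have "\<dots> = C * \<delta>\<^sup>2" by (simp add: C_def power2_eq_square algebra_simps)
      finally show ?thesis .
    qed
    \<comment> \<open>testing with \<open>n\<close>: \<open>(n z)' = n (z' - B z) + l z\<close>, and both \<open>(n z)'\<close> and \<open>z\<close> have integral zero\<close>
    have z'_cont: "continuous_on A z'" for A
      unfolding z'_def using u(4) u2(4) d d2' by (intro continuous_intros slope_rhs_cont)
    have z_cont: "continuous_on A z" for A using zz(1) by (rule DERIV_imp_continuous_on)
    have linearised_cont: "continuous_on A (linearised_rhs d H u)" for A
      unfolding linearised_rhs_def S_def using u(4) continuous_on_subset[OF v_cont] d \<gamma> by (intro continuous_intros) auto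
    have S_u_cont: "continuous_on A (\<lambda>y. S (u y))" for A
      unfolding S_def using u(4) by (intro continuous_intros)
    have "((\<lambda>y. n y * z y) has_real_derivative n y * (z' y - linearised_rhs d H u y * z y) + l * z y) (at y)" for y
      by (auto intro!: derivative_eq_intros n zz(1) simp: algebra_simps)
    moreover have "periodic_fun_simple' (\<lambda>y. n y * z y)"
      using n_per zz(2) by (intro periodicI) (simp add: periodic_plus_1)
    ultimately have "((\<lambda>y. n y * (z' y - linearised_rhs d H u y * z y) + l * z y) has_integral 0) {0..1}"
      by (rule integral_DERIV_periodic)
    then have nz: "((\<lambda>y. n y * (z' y - linearised_rhs d H u y * z y) + l * z y) has_integral 0) {0..1}" .
    have "(z has_integral 0) {0..1}"
      using integrable_integral[OF integrable_continuous_real[OF z_cont], of 0 1] unfolding zz(3) .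
    from has_integral_diff[OF nz has_integral_mult_right[OF this, of l]]
    have 0: "((\<lambda>y. n y * (z' y - linearised_rhs d H u y * z y)) has_integral 0) {0..1}" by simp
    have 1: "((\<lambda>y. n y * (S (u y))\<^sup>2) has_integral integral {0..1} (\<lambda>y. n y * (S (u y))\<^sup>2)) {0..1}"
      by (intro integrable_integral integrable_continuous_real continuous_intros n_cont S_u_cont)
    have 2: "((\<lambda>y. n y * slope_rhs d H y (u y)) has_integral integral {0..1} (\<lambda>y. n y * slope_rhs d H y (u y))) {0..1}"
      by (intro integrable_integral integrable_continuous_real continuous_intros n_cont slope_rhs_cont u(4) d)
    have "((\<lambda>y. n y * R y) has_integral d * \<gamma>\<^sup>2 * 0 + (H\<^sub>2 - H) * integral {0..1} (\<lambda>y. n y * (S (u y))\<^sup>2)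
       + (d\<^sub>2 - d) * \<gamma>\<^sup>2 * integral {0..1} (\<lambda>y. n y * slope_rhs d H y (u y))) {0..1}"
      by (rule has_integral_eq[OF _ has_integral_add[OF has_integral_add[OF
            has_integral_mult_right[OF 0] has_integral_mult_right[OF 1]] has_integral_mult_right[OF 2]]])
         (simp add: R_def algebra_simps)
    then have int: "((\<lambda>y. n y * R y) has_integral (H\<^sub>2 - H) * integral {0..1} (\<lambda>y. n y * (S (u y))\<^sup>2)
       + (d\<^sub>2 - d) * (\<gamma>\<^sup>2 * integral {0..1} (\<lambda>y. n y * slope_rhs d H y (u y)))) {0..1}"
      by (simp add: mult.assoc)
    have nR: "norm (n y * R y) \<le> Nmax * (C * \<delta>\<^sup>2)" for y
      unfolding real_norm_def abs_mult using Nmax[of y] R[of y] by (intro mult_mono) auto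
    have "Nmax * (C * \<delta>\<^sup>2) \<ge> 0" using nR[of 0] by (meson norm_ge_zero order_trans)
    have "norm ((H\<^sub>2 - H) * integral {0..1} (\<lambda>y. n y * (S (u y))\<^sup>2)
       + (d\<^sub>2 - d) * (\<gamma>\<^sup>2 * integral {0..1} (\<lambda>y. n y * slope_rhs d H y (u y))))
       \<le> Nmax * (C * \<delta>\<^sup>2) * measure lborel {0..1::real}"
      by (rule has_integral_bound_real[OF \<open>Nmax * (C * \<delta>\<^sup>2) \<ge> 0\<close> _ int, of "{}"]) (use nR in auto)
    then show "\<bar>(H\<^sub>2 - H) * integral {0..1} (\<lambda>y. n y * (S (u y))\<^sup>2)
       + (d\<^sub>2 - d) * (\<gamma>\<^sup>2 * integral {0..1} (\<lambda>y. n y * slope_rhs d H y (u y)))\<bar> \<le> Nmax * C * (d\<^sub>2 - d)\<^sup>2"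
      by (simp add: \<delta>_def mult.assoc)
  qed
qed

text \<open>With \<open>u = |\<gamma>| tan \<theta>\<close> the quotient \<open>u / S(u)\<close> is \<open>sin \<theta>\<close>. The angle \<open>\<theta>\<close> linearises the
  second-order term, since \<open>\<gamma>\<^sup>2 u' / S(u)\<^sup>2 = |\<gamma>| \<theta>'\<close>.\<close>
lemma arcsin_S: "arcsin (u / S u) = arctan (u / \<bar>\<gamma>\<bar>)"
proof -
  have "1 + (u / \<bar>\<gamma>\<bar>)\<^sup>2 = (S u / \<bar>\<gamma>\<bar>)\<^sup>2" using \<gamma> by (simp add: S_sq power_divide field_simps)
  then have "sqrt (1 + (u / \<bar>\<gamma>\<bar>)\<^sup>2) = S u / \<bar>\<gamma>\<bar>"
    using S_pos[of u] by (simp del: power_divide)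
  then have "sin (arctan (u / \<bar>\<gamma>\<bar>)) = u / S u" using \<gamma> by (simp add: sin_arctan)
  then show ?thesis
    using arcsin_sin[of "arctan (u / \<bar>\<gamma>\<bar>)"] arctan_bounded[of "u / \<bar>\<gamma>\<bar>"] by simp
qed

text \<open>The strict sign of the derivative. Here \<open>M = n S(u)\<^sup>2\<close> satisfies \<open>M' = k S(u)\<^sup>2 M (x - \<zeta>)\<close> with
  \<open>k = 1 / (d \<gamma>\<^sup>2)\<close>, \<open>\<zeta> = u / S(u)\<close> and \<open>x = l / (k M)\<close>. Integration by parts gives
  \<open>|\<gamma>| \<integral> n u' = - \<integral> M' \<Phi>(\<zeta>)\<close>, where \<open>\<Phi>\<close> is \<open>arcsin\<close>, and \<open>\<integral> M' \<Phi>(x) = 0\<close> because \<open>M' \<Phi>(x)\<close> is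
  the derivative of a function of the periodic \<open>M\<close>. Adding the two leaves the integral of
  \<open>k S(u)\<^sup>2 M (x - \<zeta>) (\<Phi>(x) - \<Phi>(\<zeta>))\<close>, which is nonnegative by monotonicity. If it is zero then \<open>x = \<zeta>\<close>, so
  \<open>M' = 0\<close>, and successively \<open>M\<close>, \<open>\<zeta>\<close>, \<open>u\<close> and \<open>v\<close> are constant.\<close>
lemma weighted_slope_integral_pos:
  assumes d: "d > 0" and sol: "slope_solution d \<mu> H u"
    and n: "\<And>y. (n has_real_derivative l - linearised_rhs d H u y * n y) (at y)"
    and n_per: "periodic_fun_simple' n" and n_pos: "\<And>y. n y > 0"
    and nonconst: "\<not> v constant_on UNIV"
  shows "integral {0..1} (\<lambda>y. n y * slope_rhs d H y (u y)) > 0"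
proof -
  note u = slope_solutionD[OF sol]
  have n_cont: "continuous_on A n" for A using n by (rule DERIV_imp_continuous_on)
  define \<zeta> where "\<zeta> y = u y / S (u y)" for y
  define M where "M y = n y * (S (u y))\<^sup>2" for y
  define k where "k = 1 / (d * \<gamma>\<^sup>2)"
  have k: "k > 0" using d \<gamma> by (simp add: k_def)
  define x where "x y = l / (k * M y)" for y
  have M_pos: "M y > 0" for y using n_pos[of y] S_pos[of "u y"] by (simp add: M_def)
  define M' where "M' y = (S (u y))\<^sup>2 * (k * M y) * (x y - \<zeta> y)" for y
  have S_u_cont: "continuous_on A (\<lambda>y. S (u y))" for A
    unfolding S_def using u(4) by (intro continuous_intros)
  have M: "(M has_real_derivative M' y) (at y)" for y
  proof -
    have "((\<lambda>y. n y * (\<gamma>\<^sup>2 + (u y)\<^sup>2)) has_real_derivative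
       (l - linearised_rhs d H u y * n y) * (\<gamma>\<^sup>2 + (u y)\<^sup>2) + n y * (2 * u y * slope_rhs d H y (u y))) (at y)"
      by (auto intro!: derivative_eq_intros n u(1))
    moreover have "(\<lambda>y. n y * (\<gamma>\<^sup>2 + (u y)\<^sup>2)) = M" by (simp add: M_def S_sq fun_eq_iff)
    moreover have "(l - linearised_rhs d H u y * n y) * (\<gamma>\<^sup>2 + (u y)\<^sup>2) + n y * (2 * u y * slope_rhs d H y (u y)) = M' y"
    proof -
      have "M' y = (S (u y))\<^sup>2 * l - k * u y * S (u y) * M y"
        using k M_pos[of y] S_pos[of "u y"] unfolding M'_def x_def \<zeta>_def
        by (simp add: field_simps power2_eq_square)
      moreover have "linearised_rhs d H u y = k * (3 * u y * S (u y) + 2 * u y * (\<gamma> * v y - H))"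
        "slope_rhs d H y (u y) = k * ((S (u y))\<^sup>2 * (S (u y) + (\<gamma> * v y - H)))"
        by (simp_all add: linearised_rhs_def slope_rhs_def k_def)
      ultimately show ?thesis
        unfolding M_def S_sq[symmetric] by (simp only:) (simp add: algebra_simps power2_eq_square)
    qed
    ultimately show ?thesis by simp
  qed
  have M_cont: "continuous_on A M" for A using M by (rule DERIV_imp_continuous_on)
  have M_per: "periodic_fun_simple' M"
    using n_per u(2) by (intro periodicI) (simp add: M_def periodic_plus_1)
  have \<zeta>_cont: "continuous_on A \<zeta>" for A
    unfolding \<zeta>_def using u(4) S_u_cont S_pos by (intro continuous_intros) (auto simp: less_imp_neq[symmetric])
  have \<zeta>1: "\<bar>\<zeta> y\<bar> < 1" for y
  proof -
    have "\<bar>u y\<bar>\<^sup>2 < (S (u y))\<^sup>2" using \<gamma> by (simp add: S_sq)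
    then have "\<bar>u y\<bar> < S (u y)" by (rule power2_less_imp_less[OF _ less_imp_le[OF S_pos]])
    then show ?thesis using S_pos[of "u y"] by (simp add: \<zeta>_def)
  qed
  obtain y0 where y0: "\<And>y. \<bar>\<zeta> y\<bar> \<le> \<bar>\<zeta> y0\<bar>"
  proof (rule periodic_attains_max[of "\<lambda>y. \<bar>\<zeta> y\<bar>"])
    show "periodic_fun_simple' (\<lambda>y. \<bar>\<zeta> y\<bar>)"
      using u(2) by (intro periodicI) (simp add: \<zeta>_def periodic_plus_1)
    show "continuous_on UNIV (\<lambda>y. \<bar>\<zeta> y\<bar>)" by (intro continuous_intros \<zeta>_cont)
  qed (rule that)
  \<comment> \<open>\<open>x\<close> may leave \<open>[-1, 1]\<close>, so \<open>arcsin\<close> is clamped at a level \<open>r\<close>; \<open>r\<close> lies strictly above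
      \<open>|\<zeta>|\<close>, so that \<open>\<Phi>\<close> still separates every value of \<open>\<zeta>\<close> from all other numbers\<close>
  define r where "r = (1 + \<bar>\<zeta> y0\<bar>) / 2"
  have r: "0 < r" "r < 1" "\<bar>\<zeta> y\<bar> < r" for y
    using \<zeta>1[of y0] y0[of y] by (auto simp: r_def field_simps)
  define \<Phi> where "\<Phi> t = arcsin (max (-r) (min r t))" for t
  have \<Phi>_cont: "continuous_on UNIV \<Phi>"
    unfolding \<Phi>_def using r(1,2) by (intro continuous_intros) (auto simp: min_def max_def)
  have \<Phi>_sgn: "(t - \<zeta> y) * (\<Phi> t - \<Phi> (\<zeta> y)) \<ge> 0"
    and \<Phi>_eq: "(t - \<zeta> y) * (\<Phi> t - \<Phi> (\<zeta> y)) = 0 \<Longrightarrow> t = \<zeta> y" for t y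
  proof -
    have c: "max (-r) (min r (\<zeta> y)) = \<zeta> y" using r(3)[of y] by (auto simp: min_def max_def)
    have b: "- 1 \<le> \<zeta> y" "\<zeta> y \<le> 1" "- 1 \<le> max (-r) (min r t)" "max (-r) (min r t) \<le> 1"
      using r(1,2) r(3)[of y] by auto
    consider "t < \<zeta> y" | "t = \<zeta> y" | "t > \<zeta> y" by linarith
    then have "(t - \<zeta> y) * (\<Phi> t - \<Phi> (\<zeta> y)) > 0 \<or> t = \<zeta> y"
    proof cases
      case 1
      then have "max (-r) (min r t) < \<zeta> y" using r(3)[of y] by (auto simp: min_def max_def)
      then have "\<Phi> t < \<Phi> (\<zeta> y)"
        unfolding \<Phi>_def c using b by (intro arcsin_less_arcsin)
      then show ?thesis using 1 by (simp add: mult_neg_neg)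
    next
      case 3
      then have "max (-r) (min r t) > \<zeta> y" using r(3)[of y] by (auto simp: min_def max_def)
      then have "\<Phi> t > \<Phi> (\<zeta> y)"
        unfolding \<Phi>_def c using b by (intro arcsin_less_arcsin)
      then show ?thesis using 3 by simp
    qed simp
    then show "(t - \<zeta> y) * (\<Phi> t - \<Phi> (\<zeta> y)) \<ge> 0"
      "(t - \<zeta> y) * (\<Phi> t - \<Phi> (\<zeta> y)) = 0 \<Longrightarrow> t = \<zeta> y" by auto
  qed
  have \<Phi>_\<zeta>: "\<Phi> (\<zeta> y) = arctan (u y / \<bar>\<gamma>\<bar>)" for y
  proof -
    have "max (-r) (min r (\<zeta> y)) = \<zeta> y" using r(3)[of y] by (auto simp: min_def max_def)
    then show ?thesis unfolding \<Phi>_def by (simp add: \<zeta>_def arcsin_S)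
  qed
  have "((\<lambda>y. M y * \<Phi> (\<zeta> y)) has_real_derivative
      M' y * \<Phi> (\<zeta> y) + \<bar>\<gamma>\<bar> * (n y * slope_rhs d H y (u y))) (at y)" for y
  proof -
    have "((\<lambda>y. M y * arctan (u y / \<bar>\<gamma>\<bar>)) has_real_derivative
        M' y * arctan (u y / \<bar>\<gamma>\<bar>) + M y * (inverse (1 + (u y / \<bar>\<gamma>\<bar>)\<^sup>2) * (slope_rhs d H y (u y) / \<bar>\<gamma>\<bar>))) (at y)"
      by (rule DERIV_cong[OF DERIV_mult[OF M DERIV_chain2[OF DERIV_arctan DERIV_cdivide[OF u(1)]]]])
         (simp only: mult_ac)
    moreover have "M y * (inverse (1 + (u y / \<bar>\<gamma>\<bar>)\<^sup>2) * (slope_rhs d H y (u y) / \<bar>\<gamma>\<bar>))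
        = \<bar>\<gamma>\<bar> * (n y * slope_rhs d H y (u y))"
    proof -
      have "1 + (u y / \<bar>\<gamma>\<bar>)\<^sup>2 = (S (u y))\<^sup>2 / \<bar>\<gamma>\<bar>\<^sup>2" using \<gamma> by (simp add: S_sq power_divide field_simps)
      then show ?thesis
        using \<gamma> S_pos[of "u y"] unfolding M_def by (simp add: power2_eq_square del: abs_mult_self_eq)
    qed
    ultimately show ?thesis by (simp add: \<Phi>_\<zeta>)
  qed
  moreover have "periodic_fun_simple' (\<lambda>y. M y * \<Phi> (\<zeta> y))"
    using M_per u(2) by (intro periodicI) (simp add: \<zeta>_def periodic_plus_1)
  ultimately have int1: "((\<lambda>y. M' y * \<Phi> (\<zeta> y) + \<bar>\<gamma>\<bar> * (n y * slope_rhs d H y (u y))) has_integral 0) {0..1}"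
    by (rule integral_DERIV_periodic)
  \<comment> \<open>\<open>m0\<close> keeps the integrand of \<open>\<Gamma>\<close> away from its singularity at \<open>0\<close> without changing it on the range of \<open>M\<close>\<close>
  obtain m0 where m0: "m0 > 0" "\<And>y. m0 \<le> M y"
  proof -
    obtain y where "\<And>t. - M t \<le> - M y"
    proof (rule periodic_attains_max[of "\<lambda>y. - M y"])
      show "periodic_fun_simple' (\<lambda>y. - M y)" using M_per by (intro periodicI) (simp add: periodic_plus_1)
      show "continuous_on UNIV (\<lambda>y. - M y)" by (intro continuous_intros M_cont)
    qed (rule that)
    then show ?thesis using that[of "M y"] M_pos[of y] by auto
  qed
  have "continuous_on UNIV (\<lambda>t. \<Phi> (l / (k * max m0 t)))"
    using m0(1) k by (intro continuous_on_compose2[OF \<Phi>_cont] continuous_intros) (auto simp: max_def)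
  then obtain \<Gamma> where \<Gamma>: "\<And>t. (\<Gamma> has_real_derivative \<Phi> (l / (k * max m0 t))) (at t)"
    using antiderivative_exists by blast
  have "((\<lambda>y. \<Gamma> (M y)) has_real_derivative M' y * \<Phi> (x y)) (at y)" for y
  proof -
    have "max m0 (M y) = M y" using m0(2)[of y] by simp
    then show ?thesis using DERIV_chain2[OF \<Gamma> M, of y] by (simp add: x_def mult.commute)
  qed
  moreover have "periodic_fun_simple' (\<lambda>y. \<Gamma> (M y))"
    using M_per by (intro periodicI) (simp add: periodic_plus_1)
  ultimately have int2: "((\<lambda>y. M' y * \<Phi> (x y)) has_integral 0) {0..1}"
    by (rule integral_DERIV_periodic)
  define f where "f y = (S (u y))\<^sup>2 * (k * M y) * ((x y - \<zeta> y) * (\<Phi> (x y) - \<Phi> (\<zeta> y)))" for y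
  have f_nonneg: "f y \<ge> 0" for y
    unfolding f_def using k M_pos[of y]
    by (intro mult_nonneg_nonneg[OF mult_nonneg_nonneg \<Phi>_sgn]) auto
  have x_cont: "continuous_on A x" for A
    unfolding x_def using M_cont M_pos k by (intro continuous_intros) (auto simp: less_imp_neq[symmetric])
  have f_cont: "continuous_on A f" for A
    unfolding f_def
    by (intro continuous_intros S_u_cont M_cont x_cont \<zeta>_cont continuous_on_compose2[OF \<Phi>_cont]) auto
  define N where "N = integral {0..1} (\<lambda>y. n y * slope_rhs d H y (u y))"
  have "((\<lambda>y. n y * slope_rhs d H y (u y)) has_integral N) {0..1}" unfolding N_def
    by (intro integrable_integral integrable_continuous_real continuous_intros n_cont slope_rhs_cont u(4) d)
  then have int3: "((\<lambda>y. \<bar>\<gamma>\<bar> * (n y * slope_rhs d H y (u y))) has_integral \<bar>\<gamma>\<bar> * N) {0..1}"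
    by (rule has_integral_mult_right)
  have "(f has_integral \<bar>\<gamma>\<bar> * N + 0 - 0) {0..1}"
    by (rule has_integral_eq[OF _ has_integral_diff[OF has_integral_add[OF int3 int2] int1]])
       (simp add: f_def M'_def algebra_simps)
  then have f_int: "integral {0..1} f = \<bar>\<gamma>\<bar> * N" by (simp add: integral_unique)
  have "integral {0..1} f \<ge> 0"
    by (intro integral_nonneg integrable_continuous_real f_cont f_nonneg)
  moreover have "integral {0..1} f \<noteq> 0"
  proof
    assume "integral {0..1} f = 0"
    then have f0: "f y = 0" if "y \<in> {0..1}" for y
      using integral_eq_0_iff[OF f_cont, of 0 1] f_nonneg that by auto
    have xz: "x y = \<zeta> y" if "y \<in> {0..1}" for y
      using f0[OF that] \<Phi>_eq[of "x y" y] k M_pos[of y] S_pos[of "u y"] unfolding f_def by (metis mult_eq_0_iff mult_pos_pos order_less_irrefl zero_less_power)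
    have "periodic_fun_simple' (\<lambda>y. x y - \<zeta> y)"
      using M_per u(2) by (intro periodicI) (simp add: x_def \<zeta>_def periodic_plus_1)
    from periodic_frac[OF this] have "x (frac y) - \<zeta> (frac y) = x y - \<zeta> y" for y .
    moreover have "x (frac y) = \<zeta> (frac y)" for y
      using frac_lt_1[of y] by (intro xz) (auto simp: less_imp_le)
    ultimately have "x y = \<zeta> y" for y by (metis eq_iff_diff_eq_0)
    then have xz: "\<And>y. x y = \<zeta> y" by blast
    then have "\<forall>y. (M has_real_derivative 0) (at y)" using M by (simp add: M'_def)
    then have "M y = M 0" for y by (rule DERIV_isconst_all)
    then have "\<zeta> y = \<zeta> 0" for y by (metis x_def xz)
    then have "arctan (u y / \<bar>\<gamma>\<bar>) = arctan (u 0 / \<bar>\<gamma>\<bar>)" for y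
      by (metis \<Phi>_\<zeta>)
    then have uc: "u y = u 0" for y using \<gamma> by (simp add: arctan_eq_iff)
    then have "u = (\<lambda>y. u 0)" by (simp add: fun_eq_iff)
    then have "(u has_real_derivative 0) (at y)" for y by (metis DERIV_const)
    then have "slope_rhs d H y (u y) = 0" for y using DERIV_unique u(1) by blast
    then have "S (u y) + \<gamma> * v y - H = 0" for y
      using S_pos[of "u y"] d \<gamma> unfolding slope_rhs_def by (metis divide_eq_0_iff mult_eq_0_iff order_less_irrefl power_eq_0_iff)
    then have "S (u 0) + \<gamma> * v y - H = 0" for y using uc by metis
    then have "v y = (H - S (u 0)) / \<gamma>" for y using \<gamma> by (simp add: field_simps)
    then have "v constant_on UNIV" unfolding constant_on_def by blast
    then show False using nonconst by blast
  qed
  ultimately have "\<bar>\<gamma>\<bar> * N > 0" using f_int by linarith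
  then show ?thesis using \<gamma> by (simp add: N_def zero_less_mult_iff)
qed

theorem Hbar_derivative_neg:
  assumes d: "d > 0" and nonconst: "\<not> v constant_on UNIV"
  shows "\<exists>D<0. ((\<lambda>d. Hbar v d (\<gamma>, \<mu>)) has_real_derivative D) (at d)"
proof -
  define H where "H d = Hbar v d (\<gamma>, \<mu>)" for d
  define u where "u = slope d \<mu>"
  have sol: "slope_solution d \<mu> (H d) u" using slope[OF d] by (simp add: H_def u_def)
  note us = slope_solutionD[OF sol]
  obtain n l where n: "\<And>y. (n has_real_derivative l - linearised_rhs d (H d) u y * n y) (at y)"
    "periodic_fun_simple' n" "\<And>y. n y > 0"
    using weight_exists[OF sol d] by blast
  define m where "m = integral {0..1} (\<lambda>y. n y * (S (u y))\<^sup>2)"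
  define N where "N = integral {0..1} (\<lambda>y. n y * slope_rhs d (H d) y (u y))"
  have N: "N > 0" unfolding N_def by (rule weighted_slope_integral_pos[OF d sol n nonconst])
  have m: "m > 0"
  proof -
    have cont: "continuous_on {0..1} (\<lambda>y. n y * (S (u y))\<^sup>2)"
      unfolding S_def using us(4) DERIV_imp_continuous_on[OF n(1)] by (intro continuous_intros)
    have pos: "n y * (S (u y))\<^sup>2 > 0" for y using n(3)[of y] S_pos[of "u y"] by simp
    have "m \<ge> 0" unfolding m_def
      by (intro integral_nonneg integrable_continuous_real cont less_imp_le[OF pos])
    moreover have "m \<noteq> 0"
    proof
      assume "m = 0"
      then have "\<forall>y\<in>{0..1}. n y * (S (u y))\<^sup>2 = 0"
        unfolding m_def by (subst (asm) integral_eq_0_iff[OF cont]) (use less_imp_le[OF pos] in simp_all)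
      then have "n 0 * (S (u 0))\<^sup>2 = 0" by (rule bspec) simp
      then show False using pos[of 0] by linarith
    qed
    ultimately show ?thesis by simp
  qed
  obtain C where C: "\<And>d\<^sub>2 H\<^sub>2 u\<^sub>2. slope_solution d\<^sub>2 \<mu> H\<^sub>2 u\<^sub>2 \<Longrightarrow> d\<^sub>2 \<ge> d / 2 \<Longrightarrow>
     \<bar>(H\<^sub>2 - H d) * m + (d\<^sub>2 - d) * (\<gamma>\<^sup>2 * N)\<bar> \<le> C * (d\<^sub>2 - d)\<^sup>2"
    using Hbar_expansion[OF d sol n(1,2), folded m_def N_def] by blast
  define D where "D = - (\<gamma>\<^sup>2 * N / m)"
  have "((\<lambda>e. (H e - H d) / (e - d)) \<longlongrightarrow> D) (at d)"
  proof (rule Lim_null[THEN iffD2], rule Lim_null_comparison)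
    have "\<forall>\<^sub>F e in at d. e > d / 2"
      using order_tendstoD(1)[OF tendsto_ident_at, of "d/2" d UNIV] d by simp
    moreover have "\<forall>\<^sub>F e in at d. e \<noteq> d" by (simp add: eventually_at_filter)
    ultimately show "\<forall>\<^sub>F e in at d. norm ((H e - H d) / (e - d) - D) \<le> C / m * \<bar>e - d\<bar>"
    proof eventually_elim
      case (elim e)
      have "slope_solution e \<mu> (H e) (slope e \<mu>)" using slope[of e] elim d by (simp add: H_def)
      then have *: "\<bar>(H e - H d) * m + (e - d) * (\<gamma>\<^sup>2 * N)\<bar> \<le> C * (e - d)\<^sup>2" using C elim by simp
      have "(H e - H d) / (e - d) - D = ((H e - H d) * m + (e - d) * (\<gamma>\<^sup>2 * N)) / ((e - d) * m)"
        using elim m by (simp add: D_def field_simps)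
      then have "norm ((H e - H d) / (e - d) - D) = \<bar>(H e - H d) * m + (e - d) * (\<gamma>\<^sup>2 * N)\<bar> / (\<bar>e - d\<bar> * m)"
        using m by (simp add: abs_mult)
      also have "\<dots> \<le> C * (e - d)\<^sup>2 / (\<bar>e - d\<bar> * m)"
        using * m by (intro divide_right_mono) auto
      also have "\<dots> = C / m * \<bar>e - d\<bar>"
      proof -
        define r where "r = \<bar>e - d\<bar>"
        have "(e - d)\<^sup>2 = r * r" by (simp add: r_def power2_eq_square)
        moreover have "r \<noteq> 0" using elim by (simp add: r_def)
        ultimately show ?thesis unfolding r_def[symmetric] using m by simp
      qed
      finally show ?case .
    qed
    have "((\<lambda>e. C / m * \<bar>e - d\<bar>) \<longlongrightarrow> C / m * \<bar>d - d\<bar>) (at d)" by (intro tendsto_intros)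
    then show "((\<lambda>e. C / m * \<bar>e - d\<bar>) \<longlongrightarrow> 0) (at d)" by simp
  qed
  then have "((\<lambda>d. Hbar v d (\<gamma>, \<mu>)) has_real_derivative D) (at d)"
    unfolding has_field_derivative_iff H_def .
  moreover have "D < 0" using N m \<gamma> by (simp add: D_def)
  ultimately show ?thesis by blast
qed

end

section \<open>Vanishing d and viscosity solutions\<close>

lemma Ck_real_1_iff:
  "Ck_real 1 f \<longleftrightarrow> (\<forall>x. (f has_real_derivative deriv f x) (at x)) \<and> continuous_on UNIV (deriv f)"
  by (auto simp: Ck_real_def DERIV_deriv_iff_real_differentiable)

lemma Ck_real_1I:
  assumes "\<And>x. (f has_real_derivative f' x) (at x)" "continuous_on UNIV f'"
  shows "Ck_real 1 f" "deriv f = f'"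
proof -
  show "deriv f = f'" using assms(1) by (auto intro!: DERIV_imp_deriv)
  then show "Ck_real 1 f" using assms unfolding Ck_real_1_iff by blast
qed

lemma DERIV_eventually_max:
  fixes f :: "real \<Rightarrow> real"
  assumes "(f has_real_derivative l) (at y)" "\<forall>\<^sub>F z in nhds y. f z \<le> f y"
  shows "l = 0"
proof -
  obtain e where "e > 0" "\<And>z. dist z y < e \<Longrightarrow> f z \<le> f y"
    using assms(2) by (auto simp: eventually_nhds_metric)
  then show ?thesis
    using DERIV_local_max[OF assms(1), of e] by (auto simp: dist_real_def abs_minus_commute)
qed

lemma DERIV_eventually_min:
  fixes f :: "real \<Rightarrow> real"
  assumes "(f has_real_derivative l) (at y)" "\<forall>\<^sub>F z in nhds y. f z \<ge> f y"
  shows "l = 0"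
  using DERIV_eventually_max[OF DERIV_minus[OF assms(1)]] assms(2) by simp

lemma DERIV_right_min_nonneg:
  fixes f :: "real \<Rightarrow> real"
  assumes "(f has_real_derivative l) (at y)" "\<forall>\<^sub>F z in nhds y. z \<ge> y \<longrightarrow> f z \<ge> f y"
  shows "l \<ge> 0"
proof (rule ccontr)
  assume "\<not> l \<ge> 0"
  then obtain d where d: "d > 0" "\<And>h. h > 0 \<Longrightarrow> h < d \<Longrightarrow> f y > f (y + h)"
    using DERIV_neg_dec_right[OF assms(1)] by auto
  obtain e where e: "e > 0" "\<And>z. dist z y < e \<Longrightarrow> z \<ge> y \<Longrightarrow> f z \<ge> f y"
    using assms(2) by (auto simp: eventually_nhds_metric)
  define h where "h = min d e / 2"
  have "h > 0" "h < d" "h < e" using d(1) e(1) by (auto simp: h_def min_def)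
  then show False using d(2)[of h] e(2)[of "y + h"] by (simp add: dist_real_def)
qed

lemma DERIV_left_min_nonpos:
  fixes f :: "real \<Rightarrow> real"
  assumes "(f has_real_derivative l) (at y)" "\<forall>\<^sub>F z in nhds y. z \<le> y \<longrightarrow> f z \<ge> f y"
  shows "l \<le> 0"
proof (rule ccontr)
  assume "\<not> l \<le> 0"
  then obtain d where d: "d > 0" "\<And>h. h > 0 \<Longrightarrow> h < d \<Longrightarrow> f (y - h) < f y"
    using DERIV_pos_inc_left[OF assms(1)] by auto
  obtain e where e: "e > 0" "\<And>z. dist z y < e \<Longrightarrow> z \<le> y \<Longrightarrow> f z \<ge> f y"
    using assms(2) by (auto simp: eventually_nhds_metric)
  define h where "h = min d e / 2"
  have "h > 0" "h < d" "h < e" using d(1) e(1) by (auto simp: h_def min_def)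
  then show False using d(2)[of h] e(2)[of "y - h"] by (simp add: dist_real_def)
qed

lemma classical_imp_viscosity:
  assumes "\<And>y. (w has_real_derivative w' y) (at y)" "\<And>y. F y (w' y) = c"
  shows "viscosity_solution F c w"
proof -
  have "w' y = deriv \<phi> y" if "Ck_real 1 \<phi>"
    "(\<forall>\<^sub>F z in nhds y. w z - \<phi> z \<le> w y - \<phi> y) \<or> (\<forall>\<^sub>F z in nhds y. w z - \<phi> z \<ge> w y - \<phi> y)" for \<phi> y
  proof -
    have "((\<lambda>z. w z - \<phi> z) has_real_derivative w' y - deriv \<phi> y) (at y)"
      using that(1) assms(1) unfolding Ck_real_1_iff by (intro DERIV_diff) blast+
    then have "w' y - deriv \<phi> y = 0"
      using that(2) DERIV_eventually_max DERIV_eventually_min by blast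
    then show ?thesis by simp
  qed
  then show ?thesis
    using DERIV_imp_continuous_on[OF assms(1)] assms(2)
    unfolding viscosity_solution_def viscosity_subsolution_def viscosity_supersolution_def
    by (metis order_refl)
qed

text \<open>Comparing a point \<open>(x', y')\<close> with the diagonal point \<open>(x', x')\<close> shows that the penalty
  \<open>(x' - y')\<^sup>2 / (2 \<epsilon>)\<close> may be assumed to be at most the oscillation \<open>B\<close> of \<open>q\<close>, and periodicity confines
  \<open>x'\<close> to \<open>[0, 1]\<close>, so a maximum exists. The resulting bound on \<open>x - y\<close> does not involve \<open>p\<close>.\<close>
lemma doubling_max:
  fixes p q :: "real \<Rightarrow> real"
  assumes p: "periodic_fun_simple' p" "continuous_on UNIV p"
    and q: "periodic_fun_simple' q" "continuous_on UNIV q"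
    and "\<epsilon> > 0" and osc: "\<And>a b. q a - q b \<le> B"
  obtains x y where "(x - y)\<^sup>2 \<le> 2 * \<epsilon> * B"
    "\<And>x' y'. p x' - q y' - (x' - y')\<^sup>2 / (2 * \<epsilon>) \<le> p x - q y - (x - y)\<^sup>2 / (2 * \<epsilon>)"
proof -
  have "B \<ge> 0" using osc[of 0 0] by simp
  define R where "R = sqrt (2 * \<epsilon> * B)"
  have R: "R \<ge> 0" "R\<^sup>2 = 2 * \<epsilon> * B" using \<open>\<epsilon> > 0\<close> \<open>B \<ge> 0\<close> by (auto simp: R_def)
  define g where "g = (\<lambda>(x, t). p x - q (x + t) - t\<^sup>2 / (2 * \<epsilon>))"
  have "continuous_on ({0..1} \<times> {-R..R}) g"
    unfolding g_def split_beta using \<open>\<epsilon> > 0\<close>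
    by (intro continuous_intros continuous_on_compose2[OF p(2)] continuous_on_compose2[OF q(2)]) auto
  moreover have "compact ({0..1::real} \<times> {-R..R})" by (intro compact_Times) auto
  moreover have "({0..1::real} \<times> {-R..R}) \<noteq> {}" using R(1) by auto
  ultimately obtain m where m: "m \<in> {0..1} \<times> {-R..R}" "\<And>n. n \<in> {0..1} \<times> {-R..R} \<Longrightarrow> g n \<le> g m"
    using continuous_attains_sup by metis
  obtain x t where xt: "m = (x, t)" by (cases m)
  have max: "p x' - q y' - (x' - y')\<^sup>2 / (2 * \<epsilon>) \<le> p x - q (x + t) - t\<^sup>2 / (2 * \<epsilon>)" for x' y'
  proof -
    define s where "s = y' - x'"
    have per: "p (frac x') = p x'" "q (frac x' + r) = q (x' + r)" for r
    proof -
      show "p (frac x') = p x'" by (rule periodic_frac[OF p(1)])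
      interpret periodic_fun_simple' q by fact
      show "q (frac x' + r) = q (x' + r)"
        using minus_of_int[of "x' + r" "\<lfloor>x'\<rfloor>"] by (simp add: frac_def algebra_simps)
    qed
    have fr: "frac x' \<in> {0..1}" using frac_lt_1[of x'] by (auto intro: less_imp_le)
    have eq: "p x' - q (x' + r) - r\<^sup>2 / (2 * \<epsilon>) = g (frac x', r)" for r
      by (simp add: g_def per)
    have "p x' - q (x' + s) - s\<^sup>2 / (2 * \<epsilon>) \<le> g m"
    proof (cases "\<bar>s\<bar> \<le> R")
      case True
      then show ?thesis unfolding eq using fr by (intro m(2)) auto
    next
      case False
      then have "R\<^sup>2 \<le> s\<^sup>2" using R(1) abs_le_square_iff[of R s] by simp
      then have "B \<le> s\<^sup>2 / (2 * \<epsilon>)" using \<open>\<epsilon> > 0\<close> R(2) by (simp add: field_simps)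
      then have "p x' - q (x' + s) - s\<^sup>2 / (2 * \<epsilon>) \<le> p x' - q (x' + 0) - 0\<^sup>2 / (2 * \<epsilon>)"
        using osc[of x' "x' + s"] by simp
      also have "\<dots> \<le> g m" unfolding eq using fr R(1) by (intro m(2)) auto
      finally show ?thesis .
    qed
    moreover have "(x' - y')\<^sup>2 = s\<^sup>2" by (simp add: s_def power2_commute)
    ultimately show ?thesis by (simp add: s_def g_def xt)
  qed
  show ?thesis
  proof (rule that[of x "x + t"])
    have "\<bar>t\<bar> \<le> \<bar>R\<bar>" using m(1) R(1) by (auto simp: xt)
    then have "t\<^sup>2 \<le> R\<^sup>2" by (simp only: abs_le_square_iff)
    then show "(x - (x + t))\<^sup>2 \<le> 2 * \<epsilon> * B" using R(2) by simp
  qed (use max in simp)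
qed

text \<open>At a maximum of \<open>w(x) - w\<^sub>0(y) - (x - y)\<^sup>2 / (2 \<epsilon>)\<close> both functions see the same slope \<open>(x - y) / \<epsilon>\<close>,
  the classical solution has \<open>w'' \<le> 1 / \<epsilon>\<close>, and \<open>w\<^sub>0\<close> is touched from below by a parabola. The
  two equations differ only by the curvature term, at most \<open>d / \<epsilon>\<close>, and by the shift of the argument
  of \<open>v\<close>. Exchanging the roles, by passing to \<open>-w\<close> and \<open>-w\<^sub>0\<close>, gives the other inequality.\<close>
lemma vanishing_viscosity_estimate:
  fixes v w w\<^sub>0 :: "real \<Rightarrow> real" and \<gamma> \<mu> :: real
  defines "F \<equiv> \<lambda>y q. sqrt (\<gamma>\<^sup>2 + (\<mu> + q)\<^sup>2) + \<gamma> * v y"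
  assumes w: "cell_solution v d (\<gamma>, \<mu>) H w"
    and w0: "periodic_fun_simple' w\<^sub>0" "viscosity_solution F H\<^sub>0 w\<^sub>0"
    and lip: "\<And>x y. \<bar>v x - v y\<bar> \<le> L * \<bar>x - y\<bar>" and osc: "\<And>a b. w\<^sub>0 a - w\<^sub>0 b \<le> B"
    and "\<epsilon> > 0" "d \<ge> 0"
  shows "\<bar>H - H\<^sub>0\<bar> \<le> d / \<epsilon> + \<bar>\<gamma>\<bar> * (L * sqrt (2 * \<epsilon> * B))"
proof -
  have C2: "Ck_real 2 w" and per: "periodic_fun_simple' w"
    and eq: "\<And>y. - (d * \<gamma>\<^sup>2 * deriv (deriv w) y) / (\<gamma>\<^sup>2 + (\<mu> + deriv w y)\<^sup>2) + F y (deriv w y) = H"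
    using w unfolding cell_solution_def F_def prod.case by (simp_all only: add.assoc simp_thms)
  note dw = Ck_real_2_derivs[OF C2]
  have w_cont: "continuous_on UNIV w" using dw(1) by (rule DERIV_imp_continuous_on)
  have w0_cont: "continuous_on UNIV w\<^sub>0"
    and sub: "\<And>\<phi> y. Ck_real 1 \<phi> \<Longrightarrow> (\<forall>\<^sub>F z in nhds y. w\<^sub>0 z - \<phi> z \<le> w\<^sub>0 y - \<phi> y) \<Longrightarrow> F y (deriv \<phi> y) \<le> H\<^sub>0"
    and super: "\<And>\<phi> y. Ck_real 1 \<phi> \<Longrightarrow> (\<forall>\<^sub>F z in nhds y. w\<^sub>0 z - \<phi> z \<ge> w\<^sub>0 y - \<phi> y) \<Longrightarrow> F y (deriv \<phi> y) \<ge> H\<^sub>0"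
    using w0(2) by (auto simp: viscosity_solution_def viscosity_subsolution_def viscosity_supersolution_def)
  have "L \<ge> 0" using lip[of 0 1] by simp
  \<comment> \<open>for \<open>\<gamma> = a = 0\<close> the quotient is \<open>0 / 0 = 0\<close>\<close>
  have curv: "d * \<gamma>\<^sup>2 * D / (\<gamma>\<^sup>2 + a\<^sup>2) \<le> d / \<epsilon>" if "D \<le> 1 / \<epsilon>" for D a
  proof -
    have "\<gamma>\<^sup>2 / (\<gamma>\<^sup>2 + a\<^sup>2) \<ge> 0" by simp
    moreover have "\<gamma>\<^sup>2 / (\<gamma>\<^sup>2 + a\<^sup>2) \<le> 1"
      unfolding divide_le_eq_1 using zero_le_power2[of \<gamma>] zero_le_power2[of a] by linarith
    ultimately have "d * \<gamma>\<^sup>2 / (\<gamma>\<^sup>2 + a\<^sup>2) \<le> d" "d * \<gamma>\<^sup>2 / (\<gamma>\<^sup>2 + a\<^sup>2) \<ge> 0"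
      using \<open>d \<ge> 0\<close> mult_left_mono[of "\<gamma>\<^sup>2 / (\<gamma>\<^sup>2 + a\<^sup>2)" 1 d] by auto
    then have "d * \<gamma>\<^sup>2 / (\<gamma>\<^sup>2 + a\<^sup>2) * D \<le> d * (1 / \<epsilon>)"
      using that \<open>\<epsilon> > 0\<close> \<open>d \<ge> 0\<close> by (meson mult_left_mono mult_right_mono order_trans zero_le_divide_1_iff less_imp_le)
    then show ?thesis by simp
  qed
  have shift: "\<bar>\<gamma> * v x - \<gamma> * v y\<bar> \<le> \<bar>\<gamma>\<bar> * (L * sqrt (2 * \<epsilon> * B))" if "(x - y)\<^sup>2 \<le> 2 * \<epsilon> * B" for x y
  proof -
    have "\<bar>x - y\<bar> \<le> sqrt (2 * \<epsilon> * B)" using that by (simp add: real_le_rsqrt)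
    then have "\<bar>v x - v y\<bar> \<le> L * sqrt (2 * \<epsilon> * B)"
      using lip[of x y] \<open>L \<ge> 0\<close> by (meson mult_left_mono order_trans)
    then show ?thesis by (simp add: abs_mult mult_left_mono flip: right_diff_distrib)
  qed
  have parab: "((\<lambda>t. c * ((t - s)\<^sup>2 / (2 * \<epsilon>))) has_real_derivative c * ((t - s) / \<epsilon>)) (at t)" for c s t
    using \<open>\<epsilon> > 0\<close> by (auto intro!: derivative_eq_intros simp: field_simps)
  have parab_C1: "Ck_real 1 (\<lambda>t. c * ((t - s)\<^sup>2 / (2 * \<epsilon>)))"
    "deriv (\<lambda>t. c * ((t - s)\<^sup>2 / (2 * \<epsilon>))) = (\<lambda>t. c * ((t - s) / \<epsilon>))" for c s
  proof -
    have "continuous_on UNIV (\<lambda>t. c * ((t - s) / \<epsilon>))"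
      using \<open>\<epsilon> > 0\<close> by (intro continuous_intros) simp
    note C1 = Ck_real_1I[OF parab this]
    show "Ck_real 1 (\<lambda>t. c * ((t - s)\<^sup>2 / (2 * \<epsilon>)))"
      "deriv (\<lambda>t. c * ((t - s)\<^sup>2 / (2 * \<epsilon>))) = (\<lambda>t. c * ((t - s) / \<epsilon>))" by (rule C1)+
  qed
  have "H\<^sub>0 - H \<le> d / \<epsilon> + \<bar>\<gamma>\<bar> * (L * sqrt (2 * \<epsilon> * B))"
  proof -
    obtain x y where xy: "(x - y)\<^sup>2 \<le> 2 * \<epsilon> * B"
      "\<And>x' y'. w x' - w\<^sub>0 y' - (x' - y')\<^sup>2 / (2 * \<epsilon>) \<le> w x - w\<^sub>0 y - (x - y)\<^sup>2 / (2 * \<epsilon>)"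
      using doubling_max[OF per w_cont w0(1) w0_cont \<open>\<epsilon> > 0\<close> osc] by blast
    have d1: "((\<lambda>t. w t - 1 * ((t - y)\<^sup>2 / (2 * \<epsilon>))) has_real_derivative deriv w t - 1 * ((t - y) / \<epsilon>)) (at t)" for t
      by (intro DERIV_diff dw parab)
    have d2: "((\<lambda>t. deriv w t - 1 * ((t - y) / \<epsilon>)) has_real_derivative deriv (deriv w) x - 1 / \<epsilon>) (at x)"
      using \<open>\<epsilon> > 0\<close> by (auto intro!: derivative_eq_intros dw)
    have "deriv w x - 1 * ((x - y) / \<epsilon>) = 0" "deriv (deriv w) x - 1 / \<epsilon> \<le> 0"
      using DERIV_at_global_max[OF d1 d2] xy(2)[of _ y] by simp_all
    then have q: "deriv w x = (x - y) / \<epsilon>" "deriv (deriv w) x \<le> 1 / \<epsilon>" by simp_all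
    have "F y (deriv (\<lambda>t. (-1) * ((t - x)\<^sup>2 / (2 * \<epsilon>))) y) \<ge> H\<^sub>0"
    proof (rule super[OF parab_C1(1)])
      show "\<forall>\<^sub>F z in nhds y. w\<^sub>0 z - - 1 * ((z - x)\<^sup>2 / (2 * \<epsilon>)) \<ge> w\<^sub>0 y - - 1 * ((y - x)\<^sup>2 / (2 * \<epsilon>))"
        using xy(2)[of x] by (intro always_eventually allI) (simp add: power2_commute[of _ x] algebra_simps)
    qed
    moreover have "(-1) * ((y - x) / \<epsilon>) = (x - y) / \<epsilon>" by (simp add: diff_divide_distrib)
    ultimately have "F y ((x - y) / \<epsilon>) \<ge> H\<^sub>0" by (simp only: parab_C1(2))
    moreover have "H \<ge> F x ((x - y) / \<epsilon>) - d / \<epsilon>"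
      using eq[of x] curv[OF q(2), of "\<mu> + deriv w x"] by (simp add: q(1))
    ultimately show ?thesis using shift[OF xy(1)] by (simp add: F_def)
  qed
  moreover have "H - H\<^sub>0 \<le> d / \<epsilon> + \<bar>\<gamma>\<bar> * (L * sqrt (2 * \<epsilon> * B))"
  proof -
    have neg: "periodic_fun_simple' (\<lambda>y. - w y)" "periodic_fun_simple' (\<lambda>y. - w\<^sub>0 y)"
      "continuous_on UNIV (\<lambda>y. - w y)" "continuous_on UNIV (\<lambda>y. - w\<^sub>0 y)"
      using per w0(1) w_cont w0_cont by (auto intro!: periodicI continuous_intros simp: periodic_plus_1)
    have osc': "- w\<^sub>0 a - - w\<^sub>0 b \<le> B" for a b using osc[of b a] by simp
    obtain x y where xy: "(x - y)\<^sup>2 \<le> 2 * \<epsilon> * B"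
      "\<And>x' y'. - w x' - - w\<^sub>0 y' - (x' - y')\<^sup>2 / (2 * \<epsilon>) \<le> - w x - - w\<^sub>0 y - (x - y)\<^sup>2 / (2 * \<epsilon>)"
      using doubling_max[OF neg(1,3,2,4) \<open>\<epsilon> > 0\<close> osc'] by blast
    have d1: "((\<lambda>t. - w t - 1 * ((t - y)\<^sup>2 / (2 * \<epsilon>))) has_real_derivative - deriv w t - 1 * ((t - y) / \<epsilon>)) (at t)" for t
      by (intro DERIV_diff DERIV_minus dw parab)
    have d2: "((\<lambda>t. - deriv w t - 1 * ((t - y) / \<epsilon>)) has_real_derivative - deriv (deriv w) x - 1 / \<epsilon>) (at x)"
      using \<open>\<epsilon> > 0\<close> by (auto intro!: derivative_eq_intros dw)
    have "- deriv w x - 1 * ((x - y) / \<epsilon>) = 0" "- deriv (deriv w) x - 1 / \<epsilon> \<le> 0"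
      using DERIV_at_global_max[OF d1 d2] xy(2)[of _ y] by simp_all
    then have q: "deriv w x = (y - x) / \<epsilon>" "- deriv (deriv w) x \<le> 1 / \<epsilon>" by (simp_all add: diff_divide_distrib)
    have "F y (deriv (\<lambda>t. 1 * ((t - x)\<^sup>2 / (2 * \<epsilon>))) y) \<le> H\<^sub>0"
    proof (rule sub[OF parab_C1(1)])
      show "\<forall>\<^sub>F z in nhds y. w\<^sub>0 z - 1 * ((z - x)\<^sup>2 / (2 * \<epsilon>)) \<le> w\<^sub>0 y - 1 * ((y - x)\<^sup>2 / (2 * \<epsilon>))"
        using xy(2)[of x] by (intro always_eventually allI) (simp add: power2_commute[of _ x] algebra_simps)
    qed
    then have "F y ((y - x) / \<epsilon>) \<le> H\<^sub>0" by (simp only: parab_C1(2)) simp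
    moreover have "H \<le> F x ((y - x) / \<epsilon>) + d / \<epsilon>"
      using eq[of x] curv[OF q(2), of "\<mu> + deriv w x"] by (simp add: q(1))
    ultimately show ?thesis using shift[OF xy(1)] by (simp add: F_def)
  qed
  ultimately show ?thesis by linarith
qed

text \<open>The choice \<open>\<epsilon> = sqrt d\<close> makes both error terms of the estimate tend to zero.\<close>
lemma Hbar_tendsto_viscosity_constant:
  fixes v w\<^sub>0 :: "real \<Rightarrow> real"
  assumes cell: "\<And>d. d > 0 \<Longrightarrow> \<exists>w. cell_solution v d (\<gamma>, \<mu>) (Hbar v d (\<gamma>, \<mu>)) w"
    and w0: "periodic_fun_simple' w\<^sub>0"
      "viscosity_solution (\<lambda>y q. sqrt (\<gamma>\<^sup>2 + (\<mu> + q)\<^sup>2) + \<gamma> * v y) H\<^sub>0 w\<^sub>0"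
    and lip: "\<And>x y. \<bar>v x - v y\<bar> \<le> L * \<bar>x - y\<bar>"
  shows "((\<lambda>d. Hbar v d (\<gamma>, \<mu>)) \<longlongrightarrow> H\<^sub>0) (at_right 0)"
proof -
  have "continuous_on UNIV w\<^sub>0"
    using w0(2) by (simp add: viscosity_solution_def viscosity_subsolution_def)
  then obtain b where b: "\<And>y. \<bar>w\<^sub>0 y\<bar> \<le> b" using periodic_bounded[OF w0(1)] by blast
  have osc: "w\<^sub>0 x - w\<^sub>0 y \<le> 2 * b" for x y using b[of x] b[of y] by linarith
  have "\<bar>Hbar v d (\<gamma>, \<mu>) - H\<^sub>0\<bar> \<le> sqrt d + \<bar>\<gamma>\<bar> * (L * sqrt (2 * sqrt d * (2 * b)))" if "d > 0" for d
  proof -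
    obtain w where "cell_solution v d (\<gamma>, \<mu>) (Hbar v d (\<gamma>, \<mu>)) w" using cell[OF \<open>d > 0\<close>] by blast
    from vanishing_viscosity_estimate[OF this w0 lip osc, of "sqrt d"] that
    show ?thesis by (simp add: real_div_sqrt)
  qed
  then have ev: "\<forall>\<^sub>F d in at_right 0. norm (Hbar v d (\<gamma>, \<mu>) - H\<^sub>0)
      \<le> sqrt d + \<bar>\<gamma>\<bar> * (L * sqrt (2 * sqrt d * (2 * b)))"
    by (auto simp: eventually_at_filter)
  have "((\<lambda>d. sqrt d + \<bar>\<gamma>\<bar> * (L * sqrt (2 * sqrt d * (2 * b)))) \<longlongrightarrow>
      sqrt 0 + \<bar>\<gamma>\<bar> * (L * sqrt (2 * sqrt 0 * (2 * b)))) (at_right 0)"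
    by (intro tendsto_intros)
  then have "((\<lambda>d. sqrt d + \<bar>\<gamma>\<bar> * (L * sqrt (2 * sqrt d * (2 * b)))) \<longlongrightarrow> 0) (at_right 0)" by simp
  from Lim_null_comparison[OF ev this] show ?thesis by (rule Lim_null[THEN iffD2])
qed

text \<open>Let \<open>h = \<gamma> v\<close>, let \<open>y0\<close> be a maximum point of \<open>h\<close>, and let \<open>Hm = h(y0) + |\<gamma>|\<close>, the smallest \<open>H\<close> for which the
  equation \<open>|\<mu> + w'| = g\<^sub>H\<close>, \<open>g\<^sub>H = sqrt ((H - h)\<^sup>2 - \<gamma>\<^sup>2)\<close>, makes sense at every point. If \<open>|\<mu>|\<close> is at least the
  integral of \<open>g\<^bsub>Hm\<^esub>\<close>, some \<open>H \<ge> Hm\<close> makes the integral of \<open>g\<^sub>H\<close> equal to \<open>|\<mu>|\<close>, and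
  \<open>w' = \<plusminus> g\<^sub>H - \<mu>\<close> is a classical periodic solution. Otherwise \<open>H = Hm\<close>, and with \<open>G' = g = g\<^bsub>Hm\<^esub>\<close> and
  \<open>I = G(y + 1) - G(y)\<close> the solution is
  \<open>w(y) = min\<^sub>k (|G(y) - G(y0 + k)| + \<mu> k) - \<mu> y\<close> over integers \<open>k\<close>: the weighted distance to the points
  \<open>y0 + k\<close>, at which \<open>g\<close> vanishes, with the entry cost \<open>\<mu> k\<close>. The minimum is attained since \<open>|\<mu>| < I\<close>.
  The function \<open>w(y) + \<mu> y\<close> varies no faster than \<open>G\<close>, which is the subsolution property, and
  touching the minimum from below means touching a minimiser from below, which is a
  classical solution away from the point of distance zero.\<close>
lemma viscosity_solution_exists:
  fixes v :: "real \<Rightarrow> real" and \<gamma> \<mu> :: real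
  assumes v: "continuous_on UNIV v" "periodic_fun_simple' v"
  obtains H w where "periodic_fun_simple' w"
    "viscosity_solution (\<lambda>y q. sqrt (\<gamma>\<^sup>2 + (\<mu> + q)\<^sup>2) + \<gamma> * v y) H w"
proof -
  define h where "h y = \<gamma> * v y" for y
  define F where "F = (\<lambda>y q. sqrt (\<gamma>\<^sup>2 + (\<mu> + q)\<^sup>2) + h y)"
  have h_cont: "continuous_on A h" for A
    unfolding h_def using continuous_on_subset[OF v(1)] by (intro continuous_intros) auto
  have h_per: "periodic_fun_simple' h" using v(2) by (intro periodicI) (simp add: h_def periodic_plus_1)
  obtain y0 where y0: "\<And>y. h y \<le> h y0" using periodic_attains_max[OF h_per h_cont] by blast
  define Hm where "Hm = h y0 + \<bar>\<gamma>\<bar>"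
  define g where "g H y = sqrt ((H - h y)\<^sup>2 - \<gamma>\<^sup>2)" for H y
  have above: "H - h y \<ge> \<bar>\<gamma>\<bar>" if "H \<ge> Hm" for H y using y0[of y] that by (simp add: Hm_def)
  have g_sq: "(g H y)\<^sup>2 = (H - h y)\<^sup>2 - \<gamma>\<^sup>2" and g_nonneg: "g H y \<ge> 0" if "H \<ge> Hm" for H y
  proof -
    have "\<gamma>\<^sup>2 \<le> (H - h y)\<^sup>2" using above[OF that, of y] by (metis abs_le_square_iff abs_of_nonneg abs_ge_zero order_trans)
    then show "(g H y)\<^sup>2 = (H - h y)\<^sup>2 - \<gamma>\<^sup>2" "g H y \<ge> 0" by (auto simp: g_def)
  qed
  have F_eq: "F y q = H" if "H \<ge> Hm" "\<bar>\<mu> + q\<bar> = g H y" for H y q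
  proof -
    have "(\<mu> + q)\<^sup>2 = (g H y)\<^sup>2" using that(2) by (metis power2_abs)
    then have "\<gamma>\<^sup>2 + (\<mu> + q)\<^sup>2 = (H - h y)\<^sup>2" using g_sq[OF that(1), of y] by simp
    then show ?thesis using above[OF that(1), of y] by (simp add: F_def)
  qed
  have g_cont: "continuous_on A (g H)" for A H unfolding g_def by (intro continuous_intros h_cont)
  have g_per: "periodic_fun_simple' (g H)" for H using h_per by (intro periodicI) (simp add: g_def periodic_plus_1)
  have "\<exists>H w. periodic_fun_simple' w \<and> viscosity_solution F H w"
  proof (cases "\<bar>\<mu>\<bar> \<ge> integral {0..1} (g Hm)")
    case True
    define J where "J H = integral {0..1} (g H)" for H
    have "continuous_on {Hm..Hm + \<bar>\<mu>\<bar>} J"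
    proof -
      have "continuous_on ({Hm..Hm + \<bar>\<mu>\<bar>} \<times> cbox 0 1) (\<lambda>(H, y). g H y)"
        unfolding g_def split_beta
        by (intro continuous_intros continuous_on_compose2[OF h_cont[of UNIV]]) auto
      from integral_continuous_on_param[OF this] show ?thesis by (simp add: J_def)
    qed
    moreover have "J (Hm + \<bar>\<mu>\<bar>) \<ge> \<bar>\<mu>\<bar>"
    proof -
      have "g (Hm + \<bar>\<mu>\<bar>) y \<ge> \<bar>\<mu>\<bar>" for y
      proof -
        define a where "a = Hm - h y"
        have a: "a \<ge> \<bar>\<gamma>\<bar>" using above[of Hm y] by (simp add: a_def)
        then have "\<gamma>\<^sup>2 \<le> a\<^sup>2" by (metis abs_le_square_iff abs_of_nonneg abs_ge_zero order_trans)
        moreover have "a * \<bar>\<mu>\<bar> \<ge> 0" using a by simp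
        moreover have "Hm + \<bar>\<mu>\<bar> - h y = a + \<bar>\<mu>\<bar>" by (simp add: a_def)
        ultimately have "\<bar>\<mu>\<bar>\<^sup>2 \<le> (Hm + \<bar>\<mu>\<bar> - h y)\<^sup>2 - \<gamma>\<^sup>2" by (simp only: power2_sum)
        then show ?thesis unfolding g_def by (rule real_le_rsqrt)
      qed
      then have "integral {0..1} (\<lambda>y::real. \<bar>\<mu>\<bar>) \<le> J (Hm + \<bar>\<mu>\<bar>)"
        unfolding J_def by (intro integral_le integrable_continuous_real g_cont) auto
      then show ?thesis by simp
    qed
    ultimately obtain H where H: "H \<ge> Hm" "J H = \<bar>\<mu>\<bar>"
      using IVT'[of J Hm "\<bar>\<mu>\<bar>" "Hm + \<bar>\<mu>\<bar>"] True by (auto simp: J_def)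
    define s :: real where "s = (if \<mu> \<ge> 0 then 1 else - 1)"
    have s: "\<bar>s\<bar> = 1" "s * \<bar>\<mu>\<bar> = \<mu>" by (auto simp: s_def)
    have "integral {0..1} (\<lambda>y. s * g H y - \<mu>) = s * J H - \<mu>"
      unfolding J_def using g_cont
      by (subst integral_diff) (auto intro!: integrable_continuous_real continuous_intros)
    then have "integral {0..1} (\<lambda>y. s * g H y - \<mu>) = 0" using H s by simp
    moreover have "continuous_on UNIV (\<lambda>y. s * g H y - \<mu>)" by (intro continuous_intros g_cont)
    moreover have "periodic_fun_simple' (\<lambda>y. s * g H y - \<mu>)"
      using g_per by (intro periodicI) (simp add: periodic_plus_1)
    ultimately obtain w where w: "\<And>y. (w has_real_derivative s * g H y - \<mu>) (at y)" "periodic_fun_simple' w"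
      using periodic_antiderivative by metis
    have "viscosity_solution F H w"
      by (rule classical_imp_viscosity[OF w(1)], rule F_eq[OF H(1)])
         (use g_nonneg[OF H(1)] s(1) in \<open>simp add: abs_mult\<close>)
    then show ?thesis using w(2) by blast
  next
    case False
    define I where "I = integral {0..1} (g Hm)"
    have I: "\<bar>\<mu>\<bar> < I" using False by (simp add: I_def)
    define gm where "gm = g Hm"
    have gm: "gm y \<ge> 0" "(gm y)\<^sup>2 = (Hm - h y)\<^sup>2 - \<gamma>\<^sup>2" for y
      using g_nonneg[of Hm] g_sq[of Hm] by (auto simp: gm_def)
    have gm_y0: "gm y0 = 0" by (simp add: gm_def g_def Hm_def)
    obtain G where G: "\<And>y. (G has_real_derivative gm y) (at y)"
      using antiderivative_exists[OF g_cont[of UNIV Hm]] by (auto simp: gm_def)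
    have G1: "G (y + 1) = G y + I" for y
      using DERIV_periodic_increment[OF G g_per[of Hm, folded gm_def], of y]
        integral_unique[OF integral_DERIV[OF G, of 0 1]] by (simp add: I_def gm_def)
    have G_mono: "x \<le> y \<Longrightarrow> G x \<le> G y" for x y
      by (rule DERIV_nonneg_imp_nondecreasing) (use G gm(1) in auto)
    have G_nat: "G (y + of_nat k) = G y + of_nat k * I" for k y
    proof (induction k)
      case (Suc k)
      then show ?case using G1[of "y + of_nat k"] by (simp add: algebra_simps)
    qed simp
    have G_int: "G (y + of_int k) = G y + of_int k * I" for k y
    proof (cases k)
      case (nonneg n)
      then show ?thesis using G_nat[of y n] by simp
    next
      case (neg n)
      then have k: "of_int k = - real (Suc n)" by simp
      have "G (y + of_int k + of_nat (Suc n)) = G (y + of_int k) + of_nat (Suc n) * I" by (rule G_nat)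
      moreover have "y + of_int k + of_nat (Suc n) = y" unfolding k by simp
      ultimately have "G y = G (y + of_int k) + of_nat (Suc n) * I" by (simp only:)
      then show ?thesis unfolding k by (simp add: algebra_simps)
    qed
    \<comment> \<open>\<open>G(y0 + k) = G(y0) + k I\<close>\<close>
    define E where "E k y = \<bar>G y - G y0 - of_int k * I\<bar> + \<mu> * of_int k" for k :: int and y
    have "\<exists>k. \<forall>j. E k y \<le> E j y" for y
    proof -
      define b where "b = (\<bar>G y - G y0\<bar> + E 0 y) / (I - \<bar>\<mu>\<bar>)"
      define T where "T = {j. E j y \<le> E 0 y}"
      have "T \<subseteq> {- \<lceil>b\<rceil>..\<lceil>b\<rceil>}"
      proof
        fix j assume "j \<in> T"
        then have "E j y \<le> E 0 y" by (simp add: T_def)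
        moreover have "E j y \<ge> \<bar>of_int j\<bar> * I - \<bar>G y - G y0\<bar> - \<bar>\<mu>\<bar> * \<bar>of_int j\<bar>"
        proof -
          have "\<bar>of_int j * I\<bar> = \<bar>of_int j\<bar> * I" using I by (simp add: abs_mult)
          moreover have "\<mu> * of_int j \<ge> - (\<bar>\<mu>\<bar> * \<bar>of_int j\<bar>)"
            by (metis abs_ge_minus_self abs_mult minus_le_iff)
          ultimately show ?thesis unfolding E_def by linarith
        qed
        ultimately have "\<bar>of_int j\<bar> * (I - \<bar>\<mu>\<bar>) \<le> \<bar>G y - G y0\<bar> + E 0 y" by (simp add: algebra_simps)
        then have "\<bar>of_int j\<bar> \<le> b" using I by (simp add: b_def field_simps)
        then have "\<bar>j\<bar> \<le> \<lceil>b\<rceil>" by linarith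
        then show "j \<in> {- \<lceil>b\<rceil>..\<lceil>b\<rceil>}" by auto
      qed
      then have "finite T" using finite_subset by blast
      moreover have "0 \<in> T" by (simp add: T_def)
      ultimately obtain k where "is_arg_min (\<lambda>j. E j y) (\<lambda>j. j \<in> T) k"
        using ex_is_arg_min_if_finite by blast
      then have k: "k \<in> T" "\<And>j. j \<in> T \<Longrightarrow> E k y \<le> E j y" by (auto simp: is_arg_min_linorder)
      have "E k y \<le> E j y" for j
        using k(2)[of j] k(1) by (cases "j \<in> T") (auto simp: T_def)
      then show ?thesis by blast
    qed
    then obtain \<kappa> where \<kappa>: "\<And>y j. E (\<kappa> y) y \<le> E j y" by metis
    define U where "U y = E (\<kappa> y) y" for y
    have U_le: "U y \<le> E j y" for y j using \<kappa> by (simp add: U_def)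
    have U_lip: "\<bar>U z - U y\<bar> \<le> \<bar>G z - G y\<bar>" for y z
    proof -
      have "U z - U y \<le> \<bar>G z - G y\<bar>" for y z
        using U_le[of z "\<kappa> y"] unfolding U_def[of y] E_def by linarith
      from this[of z y] this[of y z] show ?thesis by linarith
    qed
    define w where "w y = U y - \<mu> * y" for y
    have G_tendsto: "(G \<longlongrightarrow> G y) (at y)" for y using DERIV_isCont[OF G] by (simp add: isCont_def)
    have "(U \<longlongrightarrow> U y) (at y)" for y
    proof (rule Lim_null[THEN iffD2], rule Lim_null_comparison)
      show "\<forall>\<^sub>F z in at y. norm (U z - U y) \<le> \<bar>G z - G y\<bar>" using U_lip by simp
      have "((\<lambda>z. \<bar>G z - G y\<bar>) \<longlongrightarrow> \<bar>G y - G y\<bar>) (at y)" by (intro tendsto_intros G_tendsto)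
      then show "((\<lambda>z. \<bar>G z - G y\<bar>) \<longlongrightarrow> 0) (at y)" by simp
    qed
    then have "continuous_on UNIV U" by (intro continuous_at_imp_continuous_on) (simp add: isCont_def)
    then have w_cont: "continuous_on UNIV w" unfolding w_def by (intro continuous_intros)
    have w_per: "periodic_fun_simple' w"
    proof (rule periodicI)
      fix y
      have shift: "E (j + 1) (y + 1) = E j y + \<mu>" for j unfolding E_def G1 by (simp add: algebra_simps)
      have "U (y + 1) \<le> U y + \<mu>" using U_le[of "y + 1" "\<kappa> y + 1"] shift by (simp add: U_def)
      moreover have "U y \<le> U (y + 1) - \<mu>"
        using U_le[of y "\<kappa> (y + 1) - 1"] shift[of "\<kappa> (y + 1) - 1"] by (simp add: U_def)
      ultimately show "w (y + 1) = w y" by (simp add: w_def algebra_simps)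
    qed
    have sub: "F y (deriv \<phi> y) \<le> Hm"
      if C1: "Ck_real 1 \<phi>" and touch: "\<forall>\<^sub>F z in nhds y. w z - \<phi> z \<le> w y - \<phi> y" for \<phi> y
    proof -
      have \<phi>: "(\<phi> has_real_derivative deriv \<phi> y) (at y)" using C1 unfolding Ck_real_1_iff by blast
      have "((\<lambda>z. \<phi> z + \<mu> * z + G z) has_real_derivative deriv \<phi> y + \<mu> + gm y) (at y)"
        by (auto intro!: derivative_eq_intros \<phi> G)
      moreover have "\<forall>\<^sub>F z in nhds y. z \<ge> y \<longrightarrow> \<phi> z + \<mu> * z + G z \<ge> \<phi> y + \<mu> * y + G y"
        using touch
      proof eventually_elim
        case (elim z)
        show ?case
        proof
          assume "y \<le> z"
          then have "G y \<le> G z" by (rule G_mono)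
          then show "\<phi> z + \<mu> * z + G z \<ge> \<phi> y + \<mu> * y + G y"
            using elim U_lip[of z y] by (simp add: w_def)
        qed
      qed
      ultimately have 1: "deriv \<phi> y + \<mu> + gm y \<ge> 0" by (rule DERIV_right_min_nonneg)
      have "((\<lambda>z. \<phi> z + \<mu> * z - G z) has_real_derivative deriv \<phi> y + \<mu> - gm y) (at y)"
        by (auto intro!: derivative_eq_intros \<phi> G)
      moreover have "\<forall>\<^sub>F z in nhds y. z \<le> y \<longrightarrow> \<phi> z + \<mu> * z - G z \<ge> \<phi> y + \<mu> * y - G y"
        using touch
      proof eventually_elim
        case (elim z)
        show ?case
        proof
          assume "z \<le> y"
          then have "G z \<le> G y" by (rule G_mono)
          then show "\<phi> z + \<mu> * z - G z \<ge> \<phi> y + \<mu> * y - G y"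
            using elim U_lip[of z y] by (simp add: w_def)
        qed
      qed
      ultimately have "deriv \<phi> y + \<mu> - gm y \<le> 0" by (rule DERIV_left_min_nonpos)
      with 1 have "\<bar>\<mu> + deriv \<phi> y\<bar> \<le> \<bar>gm y\<bar>" by linarith
      then have "(\<mu> + deriv \<phi> y)\<^sup>2 \<le> (gm y)\<^sup>2" by (simp only: abs_le_square_iff)
      then have "sqrt (\<gamma>\<^sup>2 + (\<mu> + deriv \<phi> y)\<^sup>2) \<le> sqrt ((Hm - h y)\<^sup>2)"
        using gm(2)[of y] by (intro real_sqrt_le_mono) simp
      then show ?thesis using above[of Hm y] by (simp add: F_def)
    qed
    have super: "F y (deriv \<phi> y) \<ge> Hm"
      if C1: "Ck_real 1 \<phi>" and touch: "\<forall>\<^sub>F z in nhds y. w z - \<phi> z \<ge> w y - \<phi> y" for \<phi> y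
    proof -
      have \<phi>: "(\<phi> has_real_derivative deriv \<phi> y) (at y)" using C1 unfolding Ck_real_1_iff by blast
      define k where "k = \<kappa> y"
      define c where "c = G y0 + of_int k * I"
      show ?thesis
      proof (cases "G y = c")
        case True
        \<comment> \<open>at zero distance \<open>g\<close> vanishes, so \<open>Hm = |\<gamma>| + h y\<close> and every slope satisfies the inequality\<close>
        have "gm y = 0"
        proof (rule ccontr)
          assume "gm y \<noteq> 0"
          then have pos: "gm y > 0" using gm(1)[of y] by simp
          define z0 where "z0 = y0 + of_int k"
          interpret gm: periodic_fun_simple' gm using g_per[of Hm] by (simp add: gm_def)
          have "gm z0 = 0" unfolding z0_def using gm.plus_of_int[of y0 k] gm_y0 by simp
          then have "z0 \<noteq> y" using pos by auto
          have "G z0 = G y" using True G_int[of y0 k] by (simp add: z0_def c_def)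
          obtain e1 where e1: "e1 > 0" "\<And>h. h > 0 \<Longrightarrow> h < e1 \<Longrightarrow> G y < G (y + h)"
            using DERIV_pos_inc_right[OF G pos] by auto
          obtain e2 where e2: "e2 > 0" "\<And>h. h > 0 \<Longrightarrow> h < e2 \<Longrightarrow> G (y - h) < G y"
            using DERIV_pos_inc_left[OF G pos] by auto
          show False
          proof (cases "z0 > y")
            case True
            define h where "h = min (e1 / 2) (z0 - y)"
            have "h > 0" "h < e1" "y + h \<le> z0" using True e1(1) by (auto simp: h_def min_def)
            then show False using e1(2)[of h] G_mono[of "y + h" z0] \<open>G z0 = G y\<close> by simp
          next
            case False
            define h where "h = min (e2 / 2) (y - z0)"
            have "h > 0" "h < e2" "y - h \<ge> z0" using False \<open>z0 \<noteq> y\<close> e2(1) by (auto simp: h_def min_def)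
            then show False using e2(2)[of h] G_mono[of z0 "y - h"] \<open>G z0 = G y\<close> by simp
          qed
        qed
        then have "(Hm - h y)\<^sup>2 = \<bar>\<gamma>\<bar>\<^sup>2" using gm(2)[of y] by simp
        then have "Hm - h y = \<bar>\<gamma>\<bar>"
          by (rule power2_eq_imp_eq) (use above[of Hm y] in auto)
        moreover have "\<bar>\<gamma>\<bar> \<le> sqrt (\<gamma>\<^sup>2 + (\<mu> + deriv \<phi> y)\<^sup>2)" by (rule real_le_rsqrt) simp
        ultimately show ?thesis unfolding F_def by linarith
      next
        case False
        define s :: real where "s = (if G y > c then 1 else - 1)"
        have "\<forall>\<^sub>F z in nhds y. \<bar>G z - c\<bar> = s * (G z - c)"
        proof (cases "G y > c")
          case True
          have "\<forall>\<^sub>F z in nhds y. G z > c"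
            using order_tendstoD(1)[OF tendsto_at_iff_tendsto_nhds[THEN iffD1, OF G_tendsto] True] .
          then show ?thesis by eventually_elim (use True in \<open>simp add: s_def\<close>)
        next
          case F: False
          then have less: "G y < c" using False by simp
          have "\<forall>\<^sub>F z in nhds y. G z < c"
            using order_tendstoD(2)[OF tendsto_at_iff_tendsto_nhds[THEN iffD1, OF G_tendsto] less] .
          then show ?thesis by eventually_elim (use less in \<open>simp add: s_def\<close>)
        qed
        then have "\<forall>\<^sub>F z in nhds y. s * (G z - c) - \<mu> * z - \<phi> z \<ge> s * (G y - c) - \<mu> * y - \<phi> y"
          using touch
        proof eventually_elim
          case (elim z)
          have "s * (G y - c) = \<bar>G y - c\<bar>" using False by (simp add: s_def)
          moreover have "w y = \<bar>G y - c\<bar> + \<mu> * of_int k - \<mu> * y"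
            by (simp add: w_def U_def E_def k_def c_def diff_diff_eq)
          moreover have "w z \<le> \<bar>G z - c\<bar> + \<mu> * of_int k - \<mu> * z"
            using U_le[of z k] by (simp add: w_def E_def c_def diff_diff_eq)
          ultimately show ?case using elim by linarith
        qed
        moreover have "((\<lambda>z. s * (G z - c) - \<mu> * z - \<phi> z) has_real_derivative s * gm y - \<mu> - deriv \<phi> y) (at y)"
          by (auto intro!: derivative_eq_intros \<phi> G)
        ultimately have "s * gm y - \<mu> - deriv \<phi> y = 0" by (intro DERIV_eventually_min)
        then have "\<mu> + deriv \<phi> y = s * gm y" by simp
        moreover have "\<bar>s\<bar> = 1" by (simp add: s_def)
        ultimately have "\<bar>\<mu> + deriv \<phi> y\<bar> = gm y" using gm(1)[of y] by (simp add: abs_mult)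
        then show ?thesis using F_eq[of Hm "deriv \<phi> y" y] by (simp add: gm_def)
      qed
    qed
    have "viscosity_solution F Hm w"
      unfolding viscosity_solution_def viscosity_subsolution_def viscosity_supersolution_def
      using w_cont sub super by blast
    then show ?thesis using w_per by blast
  qed
  then show ?thesis using that by (auto simp: F_def h_def)
qed

lemma Hbar_tendsto_Hbar0:
  fixes v :: "real \<Rightarrow> real"
  assumes cell: "\<And>d. d > 0 \<Longrightarrow> \<exists>w. cell_solution v d (\<gamma>, \<mu>) (Hbar v d (\<gamma>, \<mu>)) w"
    and v: "continuous_on UNIV v" "periodic_fun_simple' v"
    and lip: "\<And>x y. \<bar>v x - v y\<bar> \<le> L * \<bar>x - y\<bar>"
  shows "((\<lambda>d. Hbar v d (\<gamma>, \<mu>)) \<longlongrightarrow> Hbar0 v (\<gamma>, \<mu>)) (at_right 0)"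
proof -
  let ?sol = "\<lambda>H w. periodic_fun_simple' w \<and>
      viscosity_solution (\<lambda>y q. sqrt (\<gamma>\<^sup>2 + (\<mu> + q)\<^sup>2) + \<gamma> * v y) H w"
  have lim: "((\<lambda>d. Hbar v d (\<gamma>, \<mu>)) \<longlongrightarrow> H) (at_right 0)" if "?sol H w" for H w
    using Hbar_tendsto_viscosity_constant[OF cell _ _ lip] that by blast
  obtain H w where sol: "?sol H w" using viscosity_solution_exists[OF v, of \<gamma> \<mu>] by blast
  have "Hbar0 v (\<gamma>, \<mu>) = H"
    unfolding Hbar0_def prod.case
  proof (rule the_equality)
    show "\<exists>w. ?sol H w" using sol by blast
    show "H' = H" if "\<exists>w. ?sol H' w" for H'
      using that lim tendsto_unique[OF trivial_limit_at_right_real] sol by blast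
  qed
  then show ?thesis using lim[OF sol] by simp
qed

section \<open>Large d, the degenerate direction, and the theorem\<close>

context shear_flow begin

text \<open>The bounds on \<open>u\<close> and \<open>H\<close> are independent of \<open>d\<close>, so the equation makes \<open>u'\<close> of order \<open>1 / d\<close>; and \<open>u\<close>
  takes the value \<open>\<mu>\<close> in every period.\<close>
lemma slope_near_mean:
  assumes "slope_solution d \<mu> H u" "d > 0"
  defines "K \<equiv> S \<mu> + 2 * V"
  shows "\<bar>u y - \<mu>\<bar> \<le> (S K)\<^sup>2 / \<gamma>\<^sup>2 * (S K + S \<mu> + 2 * V) / d"
proof -
  define C where "C = (S K)\<^sup>2 / \<gamma>\<^sup>2 * (S K + S \<mu> + 2 * V) / d"
  note u = slope_solutionD[OF assms(1)]
  have K: "S K + S \<mu> + 2 * V \<ge> 0" using S_pos[of K] S_pos[of \<mu>] V_nonneg by simp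
  have C: "C \<ge> 0" using K assms(2) by (simp add: C_def)
  have rhs: "\<bar>slope_rhs d H t (u t)\<bar> \<le> C" for t
  proof -
    have "(S (u t))\<^sup>2 \<le> (S K)\<^sup>2"
      using nonlinearity_bound(2)[OF assms(1,2), of t] S_pos[of "u t"] by (simp add: K_def power_mono)
    then have "(S (u t))\<^sup>2 / (d * \<gamma>\<^sup>2) \<le> (S K)\<^sup>2 / (d * \<gamma>\<^sup>2)"
      using assms(2) by (intro divide_right_mono) auto
    then have "\<bar>slope_rhs d H t (u t)\<bar> \<le> (S K)\<^sup>2 / (d * \<gamma>\<^sup>2) * (S K + S \<mu> + 2 * V)"
      unfolding slope_rhs_def abs_mult using nonlinearity_bound(1)[OF assms(1,2), of t] assms(2)
      by (intro mult_mono) (auto simp: K_def)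
    then show ?thesis by (simp add: C_def mult.commute)
  qed
  have z: "((\<lambda>y. u y - \<mu>) has_real_derivative slope_rhs d H t (u t)) (at t)" for t
    using u(1)[of t] by (auto intro!: derivative_eq_intros)
  have per: "periodic_fun_simple' (\<lambda>y. u y - \<mu>)"
    using u(2) by (intro periodicI) (simp add: periodic_plus_1)
  have "integral {0..1} (\<lambda>y. u y - \<mu>) = 0"
    using u(3,4) by (subst integral_diff) (auto intro!: integrable_continuous_real)
  then obtain x where x: "u x = \<mu>" using zero_mean_downcrossing[OF z per] by auto
  define t where "t = frac (y - x)"
  have t: "0 \<le> t" "t \<le> 1" using frac_lt_1[of "y - x"] by (auto simp: t_def less_imp_le)
  have "u y = u (x + t)"
  proof -
    have "periodic_fun_simple' (\<lambda>s. u (x + s))"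
      using periodic_plus_1[OF u(2)] by (intro periodicI) (simp add: add.assoc[symmetric])
    then show ?thesis using periodic_frac[of "\<lambda>s. u (x + s)" "y - x"] by (simp add: t_def)
  qed
  moreover have "\<bar>u (x + t) - u x\<bar> \<le> C * \<bar>x + t - x\<bar>"
    using field_differentiable_bound[of UNIV u "\<lambda>y. slope_rhs d H y (u y)" C x "x + t"] u(1) rhs
    by (auto simp: abs_minus_commute)
  moreover have "C * \<bar>x + t - x\<bar> \<le> C" using t C mult_left_mono[of t 1 C] by simp
  ultimately show ?thesis using x by (simp add: C_def)
qed

text \<open>The second-order term is the derivative of \<open>d |\<gamma>| arctan (u / |\<gamma>|)\<close>, so it disappears on integrating over a
  period, which leaves \<open>H = \<integral> S(u) + \<gamma> \<integral> v\<close>.\<close>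
lemma Hbar_large_d_estimate:
  assumes "slope_solution d \<mu> H u" "d > 0" "\<And>y. \<bar>u y - \<mu>\<bar> \<le> \<eta>"
  shows "\<bar>H - (S \<mu> + \<gamma> * integral {0..1} v)\<bar> \<le> \<eta>"
proof -
  note u = slope_solutionD[OF assms(1)]
  have "((\<lambda>y. d * (\<bar>\<gamma>\<bar> * arctan (u y / \<bar>\<gamma>\<bar>))) has_real_derivative S (u y) + \<gamma> * v y - H) (at y)" for y
  proof -
    have "1 + (u y / \<bar>\<gamma>\<bar>)\<^sup>2 = (S (u y))\<^sup>2 / \<gamma>\<^sup>2" using \<gamma> by (simp add: S_sq power_divide field_simps)
    then have "d * (\<bar>\<gamma>\<bar> * (inverse (1 + (u y / \<bar>\<gamma>\<bar>)\<^sup>2) * (slope_rhs d H y (u y) / \<bar>\<gamma>\<bar>))) = S (u y) + \<gamma> * v y - H"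
      using \<gamma> S_pos[of "u y"] assms(2) by (simp add: slope_rhs_def)
    moreover have "((\<lambda>y. d * (\<bar>\<gamma>\<bar> * arctan (u y / \<bar>\<gamma>\<bar>))) has_real_derivative
        d * (\<bar>\<gamma>\<bar> * (inverse (1 + (u y / \<bar>\<gamma>\<bar>)\<^sup>2) * (slope_rhs d H y (u y) / \<bar>\<gamma>\<bar>)))) (at y)"
      by (intro DERIV_cmult DERIV_chain2[OF DERIV_arctan] DERIV_cdivide u(1))
    ultimately show ?thesis by simp
  qed
  moreover have "periodic_fun_simple' (\<lambda>y. d * (\<bar>\<gamma>\<bar> * arctan (u y / \<bar>\<gamma>\<bar>)))"
    using u(2) by (intro periodicI) (simp add: periodic_plus_1)
  ultimately have "((\<lambda>y. S (u y) + \<gamma> * v y - H) has_integral 0) {0..1}"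
    by (rule integral_DERIV_periodic)
  moreover have S_u: "continuous_on A (\<lambda>y. S (u y))" for A
    unfolding S_def using u(4) by (intro continuous_intros)
  have v: "continuous_on A v" for A using v_cont by (rule continuous_on_subset) simp
  have "((\<lambda>y. S (u y) + \<gamma> * v y - H) has_integral
      integral {0..1} (\<lambda>y. S (u y)) + \<gamma> * integral {0..1} v - H) {0..1}"
    using has_integral_const_real[of H 0 1]
    by (intro has_integral_diff has_integral_add has_integral_mult_right integrable_integral
        integrable_continuous_real S_u v) auto
  ultimately have "integral {0..1} (\<lambda>y. S (u y)) + \<gamma> * integral {0..1} v - H = 0"
    by (rule has_integral_unique[rotated])
  moreover have "\<bar>integral {0..1} (\<lambda>y. S (u y)) - integral {0..1} (\<lambda>y::real. S \<mu>)\<bar> \<le> \<eta>"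
    by (rule integral_dist_le[OF S_u]) (use S_lipschitz assms(3) order_trans in \<open>auto intro: order_trans\<close>)
  ultimately show ?thesis by simp
qed

lemma corrector_bound:
  assumes "d > 0" "\<And>y. \<bar>slope d \<mu> y - \<mu>\<bar> \<le> \<eta>"
  shows "\<bar>corrector v d (\<gamma>, \<mu>) y\<bar> \<le> \<eta>"
proof -
  let ?w = "corrector v d (\<gamma>, \<mu>)"
  note w = corrector[OF assms(1), of \<mu>]
  have C2: "Ck_real 2 ?w" and per: "periodic_fun_simple' ?w" using w(1) by (auto simp: cell_solution_def)
  have "(\<lambda>y. \<mu> + deriv ?w y) = slope d \<mu>"
    using slope_solution_unique(2)[OF slope_solution_of_cell_solution[OF w(1) assms(1)] slope assms(1)] assms(1) .
  then have "deriv ?w t = slope d \<mu> t - \<mu>" for t by (metis add_diff_cancel_left')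
  then have "\<bar>deriv ?w t\<bar> \<le> \<eta>" for t using assms(2) by simp
  then have "\<bar>?w 0 - ?w (frac y)\<bar> \<le> \<eta> * \<bar>0 - frac y\<bar>"
    using field_differentiable_bound[of UNIV ?w "deriv ?w" \<eta> "frac y" 0] Ck_real_2_derivs(1)[OF C2] by auto
  moreover have "\<eta> * frac y \<le> \<eta>"
    using mult_left_mono[of "frac y" 1 \<eta>] frac_lt_1[of y] assms(2)[of 0] by (auto simp: less_imp_le)
  ultimately show ?thesis using w(2) periodic_frac[OF per] by simp
qed

lemma Hbar_corrector_large_d:
  shows "((\<lambda>d. Hbar v d (\<gamma>, \<mu>)) \<longlongrightarrow> S \<mu> + \<gamma> * integral {0..1} v) at_top"
    and "uniform_limit UNIV (\<lambda>d. corrector v d (\<gamma>, \<mu>)) (\<lambda>y. 0) at_top"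
proof -
  define C where "C = (S (S \<mu> + 2 * V))\<^sup>2 / \<gamma>\<^sup>2 * (S (S \<mu> + 2 * V) + S \<mu> + 2 * V)"
  have near: "\<bar>slope d \<mu> y - \<mu>\<bar> \<le> C / d" if "d > 0" for d y
    using slope_near_mean[OF slope[OF that] that] by (simp add: C_def)
  have lim: "((\<lambda>d. C / d) \<longlongrightarrow> 0) at_top" by (intro tendsto_divide_0[OF tendsto_const] filterlim_at_top_imp_at_infinity filterlim_ident)
  show "((\<lambda>d. Hbar v d (\<gamma>, \<mu>)) \<longlongrightarrow> S \<mu> + \<gamma> * integral {0..1} v) at_top"
  proof (rule Lim_null[THEN iffD2], rule Lim_null_comparison[OF _ lim])
    show "\<forall>\<^sub>F d in at_top. norm (Hbar v d (\<gamma>, \<mu>) - (S \<mu> + \<gamma> * integral {0..1} v)) \<le> C / d"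
      using eventually_gt_at_top[of 0]
    proof eventually_elim
      case (elim d)
      show ?case using Hbar_large_d_estimate[OF slope[OF elim] elim near[OF elim]] by simp
    qed
  qed
  show "uniform_limit UNIV (\<lambda>d. corrector v d (\<gamma>, \<mu>)) (\<lambda>y. 0) at_top"
  proof (rule uniform_limitI)
    fix e :: real assume "e > 0"
    then have "\<forall>\<^sub>F d in at_top. C / d < e" using lim by (rule order_tendstoD(2)[rotated])
    then show "\<forall>\<^sub>F d in at_top. \<forall>y\<in>UNIV. dist (corrector v d (\<gamma>, \<mu>) y) 0 < e"
      using eventually_gt_at_top[of 0]
    proof eventually_elim
      case (elim d)
      show ?case using corrector_bound[OF elim(2) near[OF elim(2)]] elim(1) by (auto intro: le_less_trans)
    qed
  qed
qed

end

lemma cell_solution_gamma_0: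
  assumes "cell_solution v d (0, \<mu>) H w"
  shows "H = \<bar>\<mu>\<bar>" "w y = w 0"
proof -
  have C2: "Ck_real 2 w" and per: "periodic_fun_simple' w" and eq: "\<And>y. \<bar>\<mu> + deriv w y\<bar> = H"
    using assms by (auto simp: cell_solution_def)
  note dw = Ck_real_2_derivs[OF C2]
  \<comment> \<open>differentiating \<open>(\<mu> + w')\<^sup>2 = H\<^sup>2\<close> shows that \<open>w'\<close> is constant, and its mean is zero\<close>
  have "((\<lambda>y. (\<mu> + deriv w y)\<^sup>2) has_real_derivative 2 * (\<mu> + deriv w y) * deriv (deriv w) y) (at y)" for y
    by (auto intro!: derivative_eq_intros dw)
  moreover have "(\<lambda>y. (\<mu> + deriv w y)\<^sup>2) = (\<lambda>y. H\<^sup>2)" using eq by (metis power2_abs)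
  ultimately have "2 * (\<mu> + deriv w y) * deriv (deriv w) y = 0" for y
    by (metis DERIV_const DERIV_unique)
  have w'': "deriv (deriv w) y = 0" for y
  proof (cases "H = 0")
    case True
    have "deriv w t = - \<mu>" for t using eq[of t] True by simp
    then have "deriv w = (\<lambda>y. - \<mu>)" by (rule ext)
    then show ?thesis by simp
  next
    case False
    then have "\<mu> + deriv w y \<noteq> 0" using eq[of y] by auto
    then show ?thesis using \<open>2 * (\<mu> + deriv w y) * deriv (deriv w) y = 0\<close> by simp
  qed
  then have c: "deriv w y = deriv w 0" for y using DERIV_isconst_all[of "deriv w" y 0] dw(2) by simp
  have "((\<lambda>y. deriv w y) has_integral 0) {0..1}" by (rule integral_DERIV_periodic[OF dw(1) per])
  moreover have "((\<lambda>y::real. deriv w 0) has_integral deriv w 0) {0..1}"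
    using has_integral_const_real[of "deriv w 0" 0 1] by simp
  ultimately have "deriv w 0 = 0" using c by (metis (mono_tags, lifting) has_integral_cong has_integral_unique)
  then have 0: "deriv w y = 0" for y using c[of y] by simp
  show "H = \<bar>\<mu>\<bar>" using eq[of 0] 0 by simp
  show "w y = w 0" using DERIV_isconst_all[of w y 0] dw(1) 0 by simp
qed

lemma cell_solution_const_gamma_0: "cell_solution v d (0, \<mu>) \<bar>\<mu>\<bar> (\<lambda>y. 0)"
proof -
  have "Ck_real 2 (\<lambda>y. 0)" unfolding Ck_real_2_iff by (intro exI[of _ "\<lambda>y. 0"]) auto
  moreover have "periodic_fun_simple' (\<lambda>y::real. 0::real)" by (rule periodicI) simp
  ultimately show ?thesis by (simp add: cell_solution_def)
qed

lemma Hbar_gamma_0: "Hbar v d (0, \<mu>) = \<bar>\<mu>\<bar>"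
  unfolding Hbar_def using cell_solution_gamma_0(1) cell_solution_const_gamma_0
  by (intro the_equality) blast+

lemma corrector_gamma_0: "corrector v d (0, \<mu>) = (\<lambda>y. 0)"
  unfolding corrector_def Hbar_gamma_0
proof (rule the_equality)
  show "cell_solution v d (0, \<mu>) \<bar>\<mu>\<bar> (\<lambda>y. 0) \<and> (0::real) = 0"
    using cell_solution_const_gamma_0 by blast
  show "w = (\<lambda>y. 0)" if "cell_solution v d (0, \<mu>) \<bar>\<mu>\<bar> w \<and> w 0 = 0" for w
    using cell_solution_gamma_0(2)[of v d \<mu> "\<bar>\<mu>\<bar>" w] that by (simp add: fun_eq_iff)
qed

lemma smooth_periodic_lipschitz:
  assumes "smooth_real v" "periodic_fun_simple' v"
  obtains L where "\<And>x y. \<bar>v x - v y\<bar> \<le> L * \<bar>x - y\<bar>"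
proof -
  have "Ck_real 1 v" using assms(1) by (simp only: smooth_real_def)
  then have v: "\<And>x. (v has_real_derivative deriv v x) (at x)" "continuous_on UNIV (deriv v)"
    unfolding Ck_real_1_iff by blast+
  obtain L where "\<And>x. \<bar>deriv v x\<bar> \<le> L"
    using periodic_bounded[OF DERIV_periodic[OF v(1) assms(2)] v(2)] by blast
  then have "\<bar>v x - v y\<bar> \<le> L * \<bar>x - y\<bar>" for x y
    using field_differentiable_bound[of UNIV v "deriv v" L y x] v(1) by (simp add: abs_minus_commute)
  then show ?thesis by (rule that)
qed

theorem theorem1p1:
  fixes v :: "real \<Rightarrow> real"
  assumes "smooth_real v" and "periodic_fun_simple' v" and "\<not> v constant_on UNIV"
  shows "(\<forall>\<mu>. \<forall>d>0. Hbar v d (0, \<mu>) = \<bar>\<mu>\<bar> \<and> Hbar v d (0, - \<mu>) = \<bar>\<mu>\<bar>)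
    \<and> (\<forall>\<gamma> \<mu>. \<gamma> \<noteq> 0 \<longrightarrow>
         (\<forall>d>0. \<exists>D. ((\<lambda>d. Hbar v d (\<gamma>, \<mu>)) has_real_derivative D) (at d) \<and> D < 0)
         \<and> strict_antimono_on {0<..} (\<lambda>d. Hbar v d (\<gamma>, \<mu>)))
    \<and> (\<forall>p. ((\<lambda>d. Hbar v d p) \<longlongrightarrow> Hbar0 v p) (at_right 0))
    \<and> (\<forall>\<gamma> \<mu>. ((\<lambda>d. Hbar v d (\<gamma>, \<mu>)) \<longlongrightarrow> norm (\<gamma>, \<mu>) + \<gamma> * integral {0..1} v) at_top
         \<and> uniform_limit UNIV (\<lambda>d. corrector v d (\<gamma>, \<mu>)) (\<lambda>y. 0) at_top)"
proof -
  obtain L where lip: "\<And>x y. \<bar>v x - v y\<bar> \<le> L * \<bar>x - y\<bar>"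
    using smooth_periodic_lipschitz[OF assms(1,2)] by blast
  have v_cont: "continuous_on UNIV v"
    using assms(1) by (auto simp: smooth_real_def Ck_real_def dest: spec[of _ 0])
  have shear: "shear_flow v \<gamma>" if "\<gamma> \<noteq> 0" for \<gamma>
    using v_cont assms(2) that by (simp add: shear_flow_def)
  have deriv: "\<exists>D. ((\<lambda>d. Hbar v d (\<gamma>, \<mu>)) has_real_derivative D) (at d) \<and> D < 0"
    if "\<gamma> \<noteq> 0" "d > 0" for \<gamma> \<mu> d
    using shear_flow.Hbar_derivative_neg[OF shear[OF that(1)] that(2) assms(3)] by blast
  have anti: "strict_antimono_on {0<..} (\<lambda>d. Hbar v d (\<gamma>, \<mu>))" if "\<gamma> \<noteq> 0" for \<gamma> \<mu>
  proof (rule monotone_onI)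
    fix a b :: real assume "a \<in> {0<..}" "b \<in> {0<..}" "a < b"
    then show "Hbar v a (\<gamma>, \<mu>) > Hbar v b (\<gamma>, \<mu>)"
      using DERIV_neg_imp_decreasing[of a b "\<lambda>d. Hbar v d (\<gamma>, \<mu>)"] deriv[OF that, of _ \<mu>] by auto
  qed
  have cell: "\<exists>w. cell_solution v d (\<gamma>, \<mu>) (Hbar v d (\<gamma>, \<mu>)) w" if "d > 0" for d \<gamma> \<mu>
  proof (cases "\<gamma> = 0")
    case True
    then show ?thesis using cell_solution_const_gamma_0 Hbar_gamma_0 by metis
  next
    case False
    then show ?thesis using shear_flow.corrector(1)[OF shear that] by blast
  qed
  have small: "((\<lambda>d. Hbar v d p) \<longlongrightarrow> Hbar0 v p) (at_right 0)" for p
    using Hbar_tendsto_Hbar0[OF cell v_cont assms(2) lip, of "fst p" "snd p"] by simp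
  have large: "((\<lambda>d. Hbar v d (\<gamma>, \<mu>)) \<longlongrightarrow> norm (\<gamma>, \<mu>) + \<gamma> * integral {0..1} v) at_top
         \<and> uniform_limit UNIV (\<lambda>d. corrector v d (\<gamma>, \<mu>)) (\<lambda>y. 0) at_top" for \<gamma> \<mu>
  proof (cases "\<gamma> = 0")
    case True
    then show ?thesis by (simp add: Hbar_gamma_0 corrector_gamma_0 norm_Pair uniform_limit_const)
  next
    case False
    have "norm (\<gamma>, \<mu>) = shear_flow.S \<gamma> \<mu>"
      by (simp add: norm_Pair shear_flow.S_def[OF shear[OF False]])
    then show ?thesis using shear_flow.Hbar_corrector_large_d[OF shear[OF False], of \<mu>] by simp
  qed
  show ?thesis using Hbar_gamma_0 deriv anti small large by simp
qed

end
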